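(* Let $\mathbb{P}$ be a probability distribution on $[p]$ and $\mathcal{G}$ a DAG on $[p]$. If $\mathbb{P}$ satisfies the faithfulness assumption with respect to $\mathcal{G}$, then it satisfies the triangle assumption with respect to $\mathcal{G}$; if it satisfies the triangle assumption with respect to $\mathcal{G}$, then it satisfies the edge assumption with respect to $\mathcal{G}$; and if it satisfies the edge assumption with respect to $\mathcal{G}$, then it satisfies the sparsest Markov representation assumption with respect to $\mathcal{G}$. Moreover, all three implications are strict (none of the converse implications holds in general).
   Context: $[p]=\{1,\dots,p\}$; $S_p$ is the set of permutations of $[p]$; $|\mathcal{G}|$ is the number of arrows of a DAG and $\mathrm{Pa}_\mathcal{G}(i)$ the parents of $i$. $\mathcal{M}(\mathcal{G})$ is the Markov equivalence class of $\mathcal{G}$ (all DAGs with the same $d$-separation relations). $\mathbb{P}$ is Markov with respect to $\mathcal{G}$ if $X_A\perp\!\!\!\perp X_B\mid X_C$ in $\mathbb{P}$ whenever $A,B$ are $d$-separated given $C$ in $\mathcal{G}$. A linear extension of a DAG is a permutation in which $i$ precedes $j$ for each arrow $i\to j$. An arrow $i\to j$ is covered if $\mathrm{Pa}_\mathcal{G}(i)=\mathrm{Pa}_\mathcal{G}(j)\setminus\{i\}$. Let $\mathcal{C}$ be the set of conditional independence relations $i\perp\!\!\!\perp j\mid S$ of $\mathbb{P}$. For $\pi=\pi_1\cdots\pi_p\in S_p$, the minimal independence map $\mathcal{G}_\pi$ is the DAG on $[p]$ with $\pi_i\to\pi_j$ an arrow iff $i<j$ and $\pi_i\perp\!\!\!\perp\pi_j\mid\{\pi_1,\dots,\pi_j\}\setminus\{\pi_i,\pi_j\}$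 is not in $\mathcal{C}$. $\mathcal{A}_p(\mathcal{C})$ is the polytope obtained from the permutohedron (vertices indexed by $S_p$, edges given by transposition of adjacent entries $\pi_i,\pi_{i+1}$) by contracting all edges whose relation $\pi_i\perp\!\!\!\perp\pi_{i+1}\mid\{\pi_1,\dots,\pi_{i-1}\}$ lies in $\mathcal{C}$. In its edge graph, vertices are identified with the distinct DAGs $\mathcal{G}_\pi$, and two distinct such DAGs are adjacent iff they arise from two permutations differing by an adjacent transposition. Edge sparsest permutation algorithm. Input: $\mathcal{C}$ and $\pi\in S_p$. Set $\mathcal{G}:=\mathcal{G}_\pi$. Using depth-first search with root $\mathcal{G}$ along the edges of $\mathcal{A}_p(\mathcal{C})$ (each step moving to a DAG with at most as many arrows), search for a minimal independence map $\mathcal{G}_\tau$ with $|\mathcal{G}|>|\mathcal{G}_\tau|$. If none exists, return $\mathcal{G}$; else set $\mathcal{G}:=\mathcal{G}_\tau$ and repeat. Triangle sparsest permutation algorithm. Input: $\mathcal{C}$ and $\pi\in S_p$. Set $\mathcal{G}:=\mathcal{G}_\pi$. Using depth-first search with root $\mathcal{G}$, search for a minimal independence map $\mathcal{G}_\tau$ with $|\mathcal{G}|>|\mathcal{G}_\tau|$ connected to $\mathcal{G}$ by a weakly decreasing sequence determined by covered arrow reversals, i.e. a sequence of minimal independence maps $(\mathcal{G}_{\pi^1},\dots,\mathcal{G}_{\pi^N})$ with $|\mathcal{G}_{\pi^i}|\ge|\mathcal{G}_{\pi^{i+1}}|$ for all $i$, where $\mathcal{G}_{\pi^{i+1}}$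 is produced from $\mathcal{G}_{\pi^i}$ by reversing a covered arrow of $\mathcal{G}_{\pi^i}$, taking a linear extension $\pi^{i+1}$ of the resulting DAG, and forming its minimal independence map. If no such $\mathcal{G}_\tau$ exists, return $\mathcal{G}$; else set $\mathcal{G}:=\mathcal{G}_\tau$ and repeat. Faithfulness assumption: for all $i\ne j$ and $S\subset[p]\setminus\{i,j\}$, $X_i\perp\!\!\!\perp X_j\mid X_S$ in $\mathbb{P}$ iff $i,j$ are $d$-separated given $S$ in $\mathcal{G}$. Triangle (respectively edge) assumption: $\mathbb{P}$ is Markov with respect to $\mathcal{G}$ and the triangle (respectively edge) sparsest permutation algorithm, run on $\mathcal{C}$ from any starting permutation, returns only DAGs in $\mathcal{M}(\mathcal{G})$. Sparsest Markov representation assumption: $\mathbb{P}$ is Markov with respect to $\mathcal{G}$ and $|\mathcal{G}|<|\mathcal{H}|$ for every DAG $\mathcal{H}\notin\mathcal{M}(\mathcal{G})$ with respect to which $\mathbb{P}$ is Markov.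
   Formalization: Triangle ⇒ edge is proved only when the vertices of the polytope A_p(C) really correspond one-to-one to the DAGs G_π, as its description says; without this it fails (p=5). The distribution showing that triangle does not imply faithfulness lies outside that class. *)

theory Defs
  imports "HOL-Probability.Probability" "HOL-Combinatorics.Permutations"
begin

section \<open>DAGs on \<open>{1..p}\<close> and d-separation\<close>

text \<open>A directed graph on \<open>{1..p}\<close> is represented by its set of arrows; the vertex set is always
  all of \<open>{1..p}\<close>, so the number of arrows is the cardinality.\<close>

type_synonym digraph = "(nat \<times> nat) set"

definition dag_on :: "nat \<Rightarrow> digraph \<Rightarrow> bool" where
  "dag_on p G \<longleftrightarrow> G \<subseteq> {1..p} \<times> {1..p} \<and> acyclic G"

definition parents :: "digraph \<Rightarrow> nat \<Rightarrow> nat set" where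
  "parents G i = {k. (k, i) \<in> G}"

definition adjacent :: "digraph \<Rightarrow> nat \<Rightarrow> nat \<Rightarrow> bool" where
  "adjacent G u v \<longleftrightarrow> (u, v) \<in> G \<or> (v, u) \<in> G"

definition undirected_path :: "digraph \<Rightarrow> nat list \<Rightarrow> bool" where
  "undirected_path G vs \<longleftrightarrow>
     vs \<noteq> [] \<and> distinct vs \<and> (\<forall>k. Suc k < length vs \<longrightarrow> adjacent G (vs ! k) (vs ! Suc k))"

text \<open>The inner vertices of the path are those at positions \<open>Suc k\<close> with
  \<open>Suc (Suc k) < length vs\<close>. Since \<open>G\<^sup>*\<close> is reflexive, the collider clause says that the collider
  or one of its descendants is in \<open>C\<close>.\<close>

definition d_connecting :: "digraph \<Rightarrow> nat set \<Rightarrow> nat list \<Rightarrow> bool" where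
  "d_connecting G C vs \<longleftrightarrow> undirected_path G vs \<and>
     (\<forall>k. Suc (Suc k) < length vs \<longrightarrow>
        (if (vs ! k, vs ! Suc k) \<in> G \<and> (vs ! Suc (Suc k), vs ! Suc k) \<in> G
         then \<exists>d\<in>C. (vs ! Suc k, d) \<in> G\<^sup>*
         else vs ! Suc k \<notin> C))"

definition d_separated :: "digraph \<Rightarrow> nat set \<Rightarrow> nat set \<Rightarrow> nat set \<Rightarrow> bool" where
  "d_separated G A B C \<longleftrightarrow> \<not> (\<exists>vs. d_connecting G C vs \<and> hd vs \<in> A \<and> last vs \<in> B)"

definition disjoint_triple :: "nat \<Rightarrow> nat set \<Rightarrow> nat set \<Rightarrow> nat set \<Rightarrow> bool" where
  "disjoint_triple p A B C \<longleftrightarrow>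
     A \<subseteq> {1..p} \<and> B \<subseteq> {1..p} \<and> C \<subseteq> {1..p} \<and> A \<inter> B = {} \<and> A \<inter> C = {} \<and> B \<inter> C = {}"

definition markov_equiv_class :: "nat \<Rightarrow> digraph \<Rightarrow> digraph set" where
  "markov_equiv_class p G =
     {H. dag_on p H \<and>
         (\<forall>A B C. disjoint_triple p A B C \<longrightarrow> (d_separated H A B C \<longleftrightarrow> d_separated G A B C))}"


section \<open>Conditional independence\<close>

text \<open>A distribution of \<open>(X\<^sub>1, \<dots>, X\<^sub>p)\<close>, where \<open>X\<^sub>i\<close> takes values in the measurable space \<open>M i\<close>,
  is a probability measure on the product \<open>\<sigma>\<close>-algebra; \<open>X\<^sub>i\<close> is the \<open>i\<close>-th coordinate.\<close>

definition joint_distribution :: "nat \<Rightarrow> (nat \<Rightarrow> 'a measure) \<Rightarrow> (nat \<Rightarrow> 'a) measure \<Rightarrow> bool" where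
  "joint_distribution p M P \<longleftrightarrow> prob_space P \<and> sets P = sets (PiM {1..p} M)"

text \<open>The \<open>\<sigma>\<close>-algebra generated by the subvector \<open>X\<^sub>A\<close>.\<close>

definition subvector_algebra ::
    "(nat \<Rightarrow> 'a measure) \<Rightarrow> (nat \<Rightarrow> 'a) measure \<Rightarrow> nat set \<Rightarrow> (nat \<Rightarrow> 'a) measure" where
  "subvector_algebra M P A = vimage_algebra (space P) (\<lambda>\<omega>. restrict \<omega> A) (PiM A M)"

definition cond_indep ::
    "(nat \<Rightarrow> 'a measure) \<Rightarrow> (nat \<Rightarrow> 'a) measure \<Rightarrow> nat set \<Rightarrow> nat set \<Rightarrow> nat set \<Rightarrow> bool" where
  "cond_indep M P A B C \<longleftrightarrow>
     (\<forall>E \<in> sets (subvector_algebra M P A). \<forall>F \<in> sets (subvector_algebra M P B).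
        AE \<omega> in P.
          real_cond_exp P (subvector_algebra M P C) (indicator (E \<inter> F)) \<omega> =
          real_cond_exp P (subvector_algebra M P C) (indicator E) \<omega> *
          real_cond_exp P (subvector_algebra M P C) (indicator F) \<omega>)"

definition markov_wrt ::
    "nat \<Rightarrow> (nat \<Rightarrow> 'a measure) \<Rightarrow> (nat \<Rightarrow> 'a) measure \<Rightarrow> digraph \<Rightarrow> bool" where
  "markov_wrt p M P G \<longleftrightarrow>
     (\<forall>A B C. disjoint_triple p A B C \<longrightarrow> d_separated G A B C \<longrightarrow> cond_indep M P A B C)"

text \<open>The triple \<open>(i, j, S)\<close> stands for the relation \<open>i \<bottom> j | S\<close>.\<close>

type_synonym ci_set = "(nat \<times> nat \<times> nat set) set"

definition ci_relations ::
    "nat \<Rightarrow> (nat \<Rightarrow> 'a measure) \<Rightarrow> (nat \<Rightarrow> 'a) measure \<Rightarrow> ci_set" where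
  "ci_relations p M P =
     {(i, j, S). i \<in> {1..p} \<and> j \<in> {1..p} \<and> i \<noteq> j \<and> S \<subseteq> {1..p} - {i, j} \<and>
                 cond_indep M P {i} {j} S}"


section \<open>Minimal independence maps and the polytope \<open>A\<^sub>p(C)\<close>\<close>

text \<open>A permutation \<open>\<pi>\<^sub>1 \<dots> \<pi>\<^sub>p\<close> is a function with \<open>\<pi> permutes {1..p}\<close>; the position of \<open>i\<close> in it
  is \<open>inv \<pi> i\<close>.\<close>

definition min_imap :: "nat \<Rightarrow> ci_set \<Rightarrow> (nat \<Rightarrow> nat) \<Rightarrow> digraph" where
  "min_imap p C \<pi> =
     {(\<pi> i, \<pi> j) | i j. 1 \<le> i \<and> i < j \<and> j \<le> p \<and> (\<pi> i, \<pi> j, \<pi> ` {1..j} - {\<pi> i, \<pi> j}) \<notin> C}"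

definition linear_extension :: "nat \<Rightarrow> (nat \<Rightarrow> nat) \<Rightarrow> digraph \<Rightarrow> bool" where
  "linear_extension p \<pi> G \<longleftrightarrow> \<pi> permutes {1..p} \<and> (\<forall>(i, j)\<in>G. inv \<pi> i < inv \<pi> j)"

definition covered_arrow :: "digraph \<Rightarrow> nat \<Rightarrow> nat \<Rightarrow> bool" where
  "covered_arrow G i j \<longleftrightarrow> (i, j) \<in> G \<and> parents G i = parents G j - {i}"

definition permutohedron_edge :: "nat \<Rightarrow> nat \<Rightarrow> (nat \<Rightarrow> nat) \<Rightarrow> (nat \<Rightarrow> nat) \<Rightarrow> bool" where
  "permutohedron_edge p k \<pi> \<tau> \<longleftrightarrow>
     \<pi> permutes {1..p} \<and> 1 \<le> k \<and> Suc k \<le> p \<and> \<tau> = \<pi> \<circ> Transposition.transpose k (Suc k)"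

definition contracted_edge :: "nat \<Rightarrow> ci_set \<Rightarrow> (nat \<Rightarrow> nat) \<Rightarrow> (nat \<Rightarrow> nat) \<Rightarrow> bool" where
  "contracted_edge p C \<pi> \<tau> \<longleftrightarrow>
     (\<exists>k. permutohedron_edge p k \<pi> \<tau> \<and> (\<pi> k, \<pi> (Suc k), \<pi> ` {1..<k}) \<in> C)"

text \<open>The vertices of \<open>A\<^sub>p(C)\<close> are the classes of permutations joined by contracted edges. The
  following says that sending the class of \<open>\<pi>\<close> to \<open>min_imap p C \<pi>\<close> is well defined and injective,
  i.e. that the vertices may be identified with the distinct minimal independence maps. It holds
  when \<open>C\<close> is a graphoid, but can fail for a distribution violating the intersection property.\<close>

definition vertices_identified_with_dags :: "nat \<Rightarrow> ci_set \<Rightarrow> bool" where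
  "vertices_identified_with_dags p C \<longleftrightarrow>
     (\<forall>\<pi> \<tau>. \<pi> permutes {1..p} \<longrightarrow> \<tau> permutes {1..p} \<longrightarrow>
        ((contracted_edge p C)\<^sup>*\<^sup>* \<pi> \<tau> \<longleftrightarrow> min_imap p C \<pi> = min_imap p C \<tau>))"

definition polytope_edge :: "nat \<Rightarrow> ci_set \<Rightarrow> digraph \<Rightarrow> digraph \<Rightarrow> bool" where
  "polytope_edge p C D E \<longleftrightarrow>
     D \<noteq> E \<and> (\<exists>\<pi> \<tau> k. permutohedron_edge p k \<pi> \<tau> \<and> D = min_imap p C \<pi> \<and> E = min_imap p C \<tau>)"


section \<open>The two sparsest permutation algorithms\<close>

definition edge_step :: "nat \<Rightarrow> ci_set \<Rightarrow> digraph \<Rightarrow> digraph \<Rightarrow> bool" where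
  "edge_step p C D E \<longleftrightarrow> polytope_edge p C D E \<and> card E \<le> card D"

definition triangle_step :: "nat \<Rightarrow> ci_set \<Rightarrow> digraph \<Rightarrow> digraph \<Rightarrow> bool" where
  "triangle_step p C D E \<longleftrightarrow>
     (\<exists>i j \<tau>. covered_arrow D i j \<and> linear_extension p \<tau> (insert (j, i) (D - {(i, j)})) \<and>
              E = min_imap p C \<tau>) \<and>
     card E \<le> card D"

text \<open>\<open>search_returns step D R\<close>: some execution with current DAG \<open>D\<close> returns \<open>R\<close>. Depth-first
  search from \<open>D\<close> is exhaustive, so it succeeds iff a sparser DAG is reachable; which of these is
  found first depends on the order of exploration and is left open.\<close>

inductive search_returns :: "(digraph \<Rightarrow> digraph \<Rightarrow> bool) \<Rightarrow> digraph \<Rightarrow> digraph \<Rightarrow> bool"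
  for step where
  stop: "\<not> (\<exists>E. step\<^sup>*\<^sup>* D E \<and> card E < card D) \<Longrightarrow> search_returns step D D"
| improve: "step\<^sup>*\<^sup>* D E \<Longrightarrow> card E < card D \<Longrightarrow> search_returns step E R \<Longrightarrow> search_returns step D R"

definition edge_sp_returns :: "nat \<Rightarrow> ci_set \<Rightarrow> (nat \<Rightarrow> nat) \<Rightarrow> digraph \<Rightarrow> bool" where
  "edge_sp_returns p C \<pi> R \<longleftrightarrow> search_returns (edge_step p C) (min_imap p C \<pi>) R"

definition triangle_sp_returns :: "nat \<Rightarrow> ci_set \<Rightarrow> (nat \<Rightarrow> nat) \<Rightarrow> digraph \<Rightarrow> bool" where
  "triangle_sp_returns p C \<pi> R \<longleftrightarrow> search_returns (triangle_step p C) (min_imap p C \<pi>) R"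


section \<open>The four assumptions\<close>

definition faithfulness_assumption ::
    "nat \<Rightarrow> (nat \<Rightarrow> 'a measure) \<Rightarrow> (nat \<Rightarrow> 'a) measure \<Rightarrow> digraph \<Rightarrow> bool" where
  "faithfulness_assumption p M P G \<longleftrightarrow>
     (\<forall>i\<in>{1..p}. \<forall>j\<in>{1..p}. i \<noteq> j \<longrightarrow>
        (\<forall>S \<subseteq> {1..p} - {i, j}. cond_indep M P {i} {j} S \<longleftrightarrow> d_separated G {i} {j} S))"

definition triangle_assumption ::
    "nat \<Rightarrow> (nat \<Rightarrow> 'a measure) \<Rightarrow> (nat \<Rightarrow> 'a) measure \<Rightarrow> digraph \<Rightarrow> bool" where
  "triangle_assumption p M P G \<longleftrightarrow> markov_wrt p M P G \<and>
     (\<forall>\<pi> R. \<pi> permutes {1..p} \<longrightarrow> triangle_sp_returns p (ci_relations p M P) \<pi> R \<longrightarrow>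
        R \<in> markov_equiv_class p G)"

definition edge_assumption ::
    "nat \<Rightarrow> (nat \<Rightarrow> 'a measure) \<Rightarrow> (nat \<Rightarrow> 'a) measure \<Rightarrow> digraph \<Rightarrow> bool" where
  "edge_assumption p M P G \<longleftrightarrow> markov_wrt p M P G \<and>
     (\<forall>\<pi> R. \<pi> permutes {1..p} \<longrightarrow> edge_sp_returns p (ci_relations p M P) \<pi> R \<longrightarrow>
        R \<in> markov_equiv_class p G)"

definition sparsest_markov_assumption ::
    "nat \<Rightarrow> (nat \<Rightarrow> 'a measure) \<Rightarrow> (nat \<Rightarrow> 'a) measure \<Rightarrow> digraph \<Rightarrow> bool" where
  "sparsest_markov_assumption p M P G \<longleftrightarrow> markov_wrt p M P G \<and>
     (\<forall>H. dag_on p H \<longrightarrow> H \<notin> markov_equiv_class p G \<longrightarrow> markov_wrt p M P H \<longrightarrow> card G < card H)"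

end

theory Submission
  imports Defs "HOL-Combinatorics.Multiset_Permutations"
begin

text \<open>
  Suppose the independences are exactly the d-separations of \<open>G\<close>, and let \<open>\<pi>\<close> be an order.
  Among the vertices not yet moved to the end, let \<open>Y\<close> be the last one in the order that is a sink
  of \<open>G\<close>, and \<open>Z\<close> its successor. Weak transitivity and composition of d-separation show that
  \<open>Y \<rightarrow> Z\<close> is either absent from \<open>G\<^sub>\<pi>\<close> or a covered arrow of it, so exchanging \<open>Y\<close> and \<open>Z\<close> changes
  nothing or is a triangle step. Iterating, every \<open>G\<^sub>\<pi>\<close> is joined to \<open>G\<close> by a weakly decreasing sequence;
  if no sparser DAG can be reached, each step is a mere covered reversal, and these preserve the Markov
  equivalence class.

  For a graphoid, the minimal independence map of any linear extension of an independence map \<open>D\<close> is \<open>D\<close>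
  without the arrows \<open>x \<rightarrow> y\<close> with \<open>x \<bottom> y | Pa(y) - {x}\<close>; it does not depend on the extension. As the two
  ends of a covered arrow can be made neighbours in a linear extension, every triangle step is a walk in
  the polytope. The identification of vertices with DAGs yields the intersection property needed here.

  When intersection holds, triangle steps only enlarge the set of d-separations, so the triangle assumption
  already implies faithfulness. The first separating distribution therefore has to violate intersection.
\<close>

section \<open>Walks and d-separation\<close>

text \<open>Both \<open>d_sep G\<close> and conditional independence are semigraphoids, and most
  arguments are made for an abstract one. Soundness of d-separation, proved once, then gives the
  Markov property of minimal independence maps, Markov equivalence under covered reversals (with the
  separations of the other DAG as the relation) and the inclusion of a minimal independence map in
  any Markov DAG that its order extends. The last implication starts the edge search at such an
  order; d-separation fixes the number of arrows of the result. Why intersection would merge the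
  first two assumptions: if \<open>i\<close> and \<open>j\<close> are independent given
  \<open>S\<close>, an order beginning with \<open>S\<close>, \<open>i\<close>, \<open>j\<close> has
  a map in which they are d-separated given \<open>S\<close>. Triangle steps preserve this, so it
  would hold in the returned DAG and hence in \<open>G\<close>. The converses fail for finite tables
  with natural weights: independence becomes an identity of natural numbers, and at most 120 orders
  have to be searched. In the last two examples a search is caught among DAGs with five arrows while
  \<open>G\<close> has four.\<close>

definition unblocked :: "digraph \<Rightarrow> nat set \<Rightarrow> nat \<Rightarrow> nat \<Rightarrow> nat \<Rightarrow> bool" where
  "unblocked G S a b c \<longleftrightarrow> (if (a, b) \<in> G \<and> (c, b) \<in> G then \<exists>d\<in>S. (b, d) \<in> G\<^sup>* else b \<notin> S)"

fun active_walk :: "digraph \<Rightarrow> nat set \<Rightarrow> nat list \<Rightarrow> bool" where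
  "active_walk G S [] = False"
| "active_walk G S [a] = True"
| "active_walk G S [a, b] = adjacent G a b"
| "active_walk G S (a # b # c # vs) =
     (adjacent G a b \<and> unblocked G S a b c \<and> active_walk G S (b # c # vs))"

text \<open>Walks may repeat vertices, so they can be concatenated and cut without further care; in
  acyclic graphs \<open>d_connected_distinct\<close> recovers the paths used by
  \<open>d_connecting\<close>.\<close>

definition d_connected :: "digraph \<Rightarrow> nat set \<Rightarrow> nat \<Rightarrow> nat \<Rightarrow> bool" where
  "d_connected G S a b \<longleftrightarrow> (\<exists>vs. active_walk G S vs \<and> hd vs = a \<and> last vs = b)"

lemma adjacent_sym: "adjacent G a b \<longleftrightarrow> adjacent G b a"
  by (auto simp: adjacent_def)

lemma unblocked_sym: "unblocked G S a b c \<longleftrightarrow> unblocked G S c b a"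
  by (auto simp: unblocked_def)

lemma active_walk_nth:
  "active_walk G S vs \<longleftrightarrow> vs \<noteq> [] \<and>
     (\<forall>k. Suc k < length vs \<longrightarrow> adjacent G (vs ! k) (vs ! Suc k)) \<and>
     (\<forall>k. Suc (Suc k) < length vs \<longrightarrow> unblocked G S (vs ! k) (vs ! Suc k) (vs ! Suc (Suc k)))"
proof (induction G S vs rule: active_walk.induct)
  case (4 G S a b c vs)
  have all_Suc: "(\<forall>k. P k) \<longleftrightarrow> P 0 \<and> (\<forall>k. P (Suc k))" for P :: "nat \<Rightarrow> bool"
    by (metis not0_implies_Suc)
  show ?case
    unfolding active_walk.simps(4) 4
    by (subst (3) all_Suc, subst (4) all_Suc) auto
qed auto

lemma d_connecting_iff: "d_connecting G S vs \<longleftrightarrow> active_walk G S vs \<and> distinct vs"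
  unfolding d_connecting_def undirected_path_def active_walk_nth unblocked_def by auto

lemma active_walk_append_iff:
  assumes "xs \<noteq> []" "ys \<noteq> []"
  shows "active_walk G S (xs @ v # ys) \<longleftrightarrow>
    active_walk G S (xs @ [v]) \<and> active_walk G S (v # ys) \<and> unblocked G S (last xs) v (hd ys)"
  using assms(1)
proof (induction xs rule: induct_list012)
  case (2 a)
  then show ?case using assms(2) by (cases ys) auto
next
  case (3 a b xs)
  then show ?case by (cases xs) auto
qed simp

lemma active_walk_prefix: "active_walk G S (xs @ v # ys) \<Longrightarrow> active_walk G S (xs @ [v])"
  using active_walk_append_iff by (cases "xs = []"; cases "ys = []") auto

lemma active_walk_suffix: "active_walk G S (xs @ v # ys) \<Longrightarrow> active_walk G S (v # ys)"
  using active_walk_append_iff by (cases "xs = []"; cases "ys = []") auto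

lemma active_walk_rev: "active_walk G S (rev vs) \<longleftrightarrow> active_walk G S vs"
proof (induction G S vs rule: active_walk.induct)
  case (4 G S a b c vs)
  have "active_walk G S (rev (a # b # c # vs)) \<longleftrightarrow> active_walk G S ((rev vs @ [c]) @ b # [a])"
    by simp
  also have "\<dots> \<longleftrightarrow> active_walk G S (rev vs @ [c] @ [b]) \<and> adjacent G b a \<and> unblocked G S c b a"
    by (subst active_walk_append_iff) auto
  finally show ?case using 4 by (auto simp: adjacent_sym[of G a] unblocked_sym[of G S a])
qed (auto simp: adjacent_sym)

lemma d_connected_sym: "d_connected G S a b \<longleftrightarrow> d_connected G S b a"
  unfolding d_connected_def by (metis active_walk.simps(1) active_walk_rev hd_rev last_rev rev_rev_ident)

lemma adjacent_irrefl: "acyclic G \<Longrightarrow> \<not> adjacent G v v"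
  by (auto simp: adjacent_def acyclic_def)

lemma acyclic_antisym: "acyclic G \<Longrightarrow> (a, b) \<in> G \<Longrightarrow> (b, a) \<notin> G"
  by (meson acyclic_def r_into_trancl' trancl_into_trancl)

text \<open>As long as the arrows point forward the walk descends from \<open>a\<close>; the first
  vertex at which they stop doing so is an open collider below \<open>a\<close>.\<close>

lemma active_walk_descend:
  assumes "active_walk G S (a # b # vs)" "(a, b) \<in> G"
  shows "(\<exists>d\<in>S. (a, d) \<in> G\<^sup>*) \<or> (a, last (b # vs)) \<in> G\<^sup>+"
  using assms
proof (induction vs arbitrary: a b)
  case (Cons c vs)
  show ?case
  proof (cases "(c, b) \<in> G")
    case True
    then show ?thesis using Cons.prems by (auto simp: unblocked_def intro: converse_rtrancl_into_rtrancl)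
  next
    case False
    then have "(b, c) \<in> G" using Cons.prems by (cases vs) (auto simp: adjacent_def)
    then show ?thesis using Cons.IH[of b c] Cons.prems
      by (auto intro: converse_rtrancl_into_rtrancl trancl_into_trancl2)
  qed
qed auto

text \<open>Cutting a loop at \<open>v\<close> can only create a new collider \<open>v\<close>; the loop then leaves \<open>v\<close> along an
  arrow and, by acyclicity, meets a collider below \<open>v\<close>, which is open.\<close>

lemma active_walk_cut:
  assumes G: "acyclic G" and w: "active_walk G S (xs @ v # ys @ v # zs)"
  shows "active_walk G S (xs @ v # zs)"
proof (cases "xs = [] \<or> zs = []")
  case True
  then show ?thesis using w active_walk_suffix[of G S "xs @ v # ys" v zs] active_walk_prefix by auto
next
  case False
  then have ne: "xs \<noteq> []" "zs \<noteq> []" by auto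
  have 1: "active_walk G S (xs @ [v])" "active_walk G S (v # ys @ v # zs)"
    "unblocked G S (last xs) v (hd (ys @ [v]))"
    using w active_walk_append_iff[OF ne(1), of "ys @ v # zs" G S v] by (auto simp: hd_append)
  have 2: "active_walk G S (v # ys @ [v])" "active_walk G S (v # zs)"
    "unblocked G S (last (v # ys)) v (hd zs)"
    using 1(2) active_walk_append_iff[of "v # ys" zs G S v] ne by auto
  have "ys \<noteq> []" using 2(1) adjacent_irrefl[OF G] by auto
  then obtain y ys' where ys: "ys = y # ys'" by (cases ys) auto
  have adj: "adjacent G v y" using 2(1) ys by (cases ys') auto
  have "unblocked G S (last xs) v (hd zs)"
  proof (cases "(last xs, v) \<in> G \<and> (hd zs, v) \<in> G")
    case True
    have "\<exists>d\<in>S. (v, d) \<in> G\<^sup>*"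
    proof (cases "(y, v) \<in> G")
      case True
      then show ?thesis using 1(3) \<open>(last xs, v) \<in> G \<and> _\<close> ys by (auto simp: unblocked_def)
    next
      case False
      then have "(v, y) \<in> G" using adj by (auto simp: adjacent_def)
      then show ?thesis using active_walk_descend[of G S v y "ys' @ [v]"] 2(1) ys G
        by (auto simp: acyclic_def)
    qed
    then show ?thesis using True by (simp add: unblocked_def)
  next
    case False
    have "v \<notin> S"
      using False 1(3) 2(3) unblocked_def by (metis (no_types, lifting))
    then show ?thesis using False by (auto simp: unblocked_def)
  qed
  then show ?thesis using active_walk_append_iff[OF ne] 1 2 by blast
qed

lemma d_connected_distinct:
  assumes "acyclic G" "d_connected G S a b"
  obtains vs where "active_walk G S vs" "hd vs = a" "last vs = b" "distinct vs"
proof -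
  have "active_walk G S vs \<Longrightarrow> \<exists>ws. active_walk G S ws \<and> hd ws = hd vs \<and> last ws = last vs \<and> distinct ws"
    for vs
  proof (induction "length vs" arbitrary: vs rule: less_induct)
    case less
    show ?case
    proof (cases "distinct vs")
      case False
      then obtain xs v ys zs where vs: "vs = xs @ [v] @ ys @ [v] @ zs"
        using not_distinct_decomp by blast
      let ?ws = "xs @ v # zs"
      have "active_walk G S ?ws" using active_walk_cut[OF assms(1)] less.prems vs by auto
      moreover have "length ?ws < length vs" "hd ?ws = hd vs" "last ?ws = last vs"
        using vs by (auto simp: hd_append)
      ultimately show ?thesis using less.hyps[of ?ws] by auto
    qed (use less.prems in blast)
  qed
  then show thesis using assms(2) that unfolding d_connected_def by blast
qed

lemma d_separated_iff:
  assumes "acyclic G"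
  shows "d_separated G A B S \<longleftrightarrow> (\<forall>a\<in>A. \<forall>b\<in>B. \<not> d_connected G S a b)"
  unfolding d_separated_def d_connecting_iff
  by (metis d_connected_def d_connected_distinct[OF assms])

text \<open>Enlarging \<open>S\<close> keeps open colliders open. The inner vertices are
  \<open>butlast (tl vs)\<close>, and none of them may newly enter the condition.\<close>

lemma active_walk_mono:
  assumes "active_walk G S vs" "S \<subseteq> S'" "set (butlast (tl vs)) \<inter> S' \<subseteq> S"
  shows "active_walk G S' vs"
  using assms
  by (induction G S vs rule: active_walk.induct) (auto simp: unblocked_def split: if_splits)

lemma active_walk_snoc:
  assumes "acyclic G" "active_walk G S vs" "(last vs, z) \<in> G" "last vs \<notin> S"
  shows "active_walk G S (vs @ [z])"
proof -
  obtain ws y where vs: "vs = ws @ [y]" using assms(2) by (cases vs rule: rev_cases) auto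
  have "adjacent G y z" using assms(3) vs by (auto simp: adjacent_def)
  moreover have "unblocked G S (last ws) y z"
    using assms vs acyclic_antisym[OF assms(1)] by (auto simp: unblocked_def)
  ultimately show ?thesis using active_walk_append_iff[of ws "[z]" G S y] assms(2) vs
    by (cases "ws = []") auto
qed

lemma d_connected_descend:
  assumes G: "acyclic G" and "(b, d) \<in> G\<^sup>*" and "\<And>e. (b, e) \<in> G\<^sup>* \<Longrightarrow> e \<notin> S" and "d_connected G S a b"
  shows "d_connected G S a d"
  using assms(2)
proof (induction rule: rtrancl_induct)
  case (step y z)
  then obtain vs where "active_walk G S vs" "hd vs = a" "last vs = y" by (auto simp: d_connected_def)
  then show ?case using active_walk_snoc[OF G, of S vs z] step assms(3)
    unfolding d_connected_def by (metis active_walk.simps(1) hd_append2 last_snoc)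
qed (use assms in auto)

text \<open>Up to the first collider that is open only thanks to \<open>D\<close>, the walk is active given \<open>S\<close>; from
  there follow arrows down to \<open>D\<close>.\<close>

lemma d_connected_drop_below:
  assumes G: "acyclic G" and "d_connected G (S \<union> D) a b" and below: "\<And>d. d \<in> D \<Longrightarrow> \<exists>e\<in>E. (d, e) \<in> G\<^sup>*"
  shows "d_connected G S a b \<or> (\<exists>e\<in>E. d_connected G S a e)"
proof -
  have "active_walk G (S \<union> D) vs \<Longrightarrow> active_walk G S vs \<or> (\<exists>e\<in>E. d_connected G S (hd vs) e)" for vs
  proof (induction vs rule: rev_induct)
    case (snoc v ws)
    show ?case
    proof (cases ws rule: rev_cases)
      case (snoc us b)
      note ws = this
      show ?thesis
      proof (cases "us = []")
        case True
        then show ?thesis using snoc.prems ws by auto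
      next
        case False
        have w: "active_walk G (S \<union> D) (us @ [b])" "adjacent G b v" "unblocked G (S \<union> D) (last us) b v"
          using snoc.prems ws active_walk_append_iff[OF False, of "[v]" G "S \<union> D" b] by auto
        have hd: "hd (ws @ [v]) = hd (us @ [b])" using ws by (auto simp: hd_append)
        show ?thesis
        proof (cases "\<exists>e\<in>E. d_connected G S (hd (us @ [b])) e")
          case False
          then have a: "active_walk G S (us @ [b])" using snoc.IH w(1) ws by auto
          then have c: "d_connected G S (hd (us @ [b])) b" by (auto simp: d_connected_def intro!: exI[of _ "us @ [b]"])
          have "unblocked G S (last us) b v"
          proof (rule ccontr)
            assume "\<not> ?thesis"
            then have "\<And>e. (b, e) \<in> G\<^sup>* \<Longrightarrow> e \<notin> S" "\<exists>d\<in>D. (b, d) \<in> G\<^sup>*"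
              using w(3) by (auto simp: unblocked_def split: if_splits)
            then have "\<And>e. (b, e) \<in> G\<^sup>* \<Longrightarrow> e \<notin> S" "\<exists>e\<in>E. (b, e) \<in> G\<^sup>*"
              using below by (blast, meson rtrancl_trans)
            then show False using d_connected_descend[OF G _ _ c] False by blast
          qed
          then show ?thesis using a w ws active_walk_append_iff[OF \<open>us \<noteq> []\<close>, of "[v]" G S b] by auto
        qed (use hd in auto)
      qed
    qed simp
  qed simp
  then show ?thesis using assms(2) unfolding d_connected_def by blast
qed

text \<open>Read contrapositively, this is weak union with composition built in: \<open>b\<close>
  and the elements of \<open>D\<close> are treated one at a time.\<close>

lemma d_connected_drop:
  assumes "acyclic G" "d_connected G (S \<union> D) a b"
  shows "d_connected G S a b \<or> (\<exists>d\<in>D. d_connected G S a d)"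
  using d_connected_drop_below[OF assms, of D] by blast

text \<open>A collider opened by an element of \<open>D\<close> is also opened by the element of
  \<open>S\<close> below it, and a smaller condition blocks no non-collider.\<close>

lemma active_walk_drop_above:
  assumes "active_walk G (S \<union> D) vs" "\<And>d. d \<in> D \<Longrightarrow> \<exists>e\<in>S. (d, e) \<in> G\<^sup>*"
  shows "active_walk G S vs"
  using assms
proof (induction G S vs rule: active_walk.induct)
  case (4 G S a b c vs)
  then have "unblocked G S a b c"
    by (auto simp: unblocked_def split: if_splits) (meson rtrancl_trans)+
  then show ?case using 4 by auto
qed auto

text \<open>An open collider is an ancestor of \<open>S\<close>; any other inner vertex has an arrow
  of the walk leaving it, and \<open>active_walk_descend\<close> follows that arrow towards its end
  of the walk.\<close>

lemma active_walk_ancestors: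
  assumes "active_walk G S vs" "v \<in> set vs"
  shows "\<exists>d \<in> insert (hd vs) (insert (last vs) S). (v, d) \<in> G\<^sup>*"
proof -
  obtain xs ys where vs: "vs = xs @ v # ys" using assms(2) split_list by metis
  show ?thesis
  proof (cases "xs = [] \<or> ys = []")
    case True
    then show ?thesis using vs by auto
  next
    case False
    then have ne: "xs \<noteq> []" "ys \<noteq> []" by auto
    then have w: "active_walk G S (xs @ [v])" "active_walk G S (v # ys)" "unblocked G S (last xs) v (hd ys)"
      using assms vs active_walk_append_iff by metis+
    obtain y ys' where ys: "ys = y # ys'" using ne by (cases ys) auto
    obtain xs' x where xs: "xs = xs' @ [x]" using ne by (cases xs rule: rev_cases) auto
    have rv: "active_walk G S (v # x # rev xs')" using w(1) active_walk_rev[of G S "xs @ [v]"] xs by simp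
    have adj: "adjacent G v y" "adjacent G v x"
      using w(2) rv ys by (cases ys'; cases "rev xs'"; auto)+
    consider "(v, y) \<in> G" | "(v, x) \<in> G" | "(y, v) \<in> G" "(x, v) \<in> G" using adj by (auto simp: adjacent_def)
    then show ?thesis
    proof cases
      case 1
      then show ?thesis using active_walk_descend[of G S v y ys'] w(2) ys vs trancl_into_rtrancl by fastforce
    next
      case 2
      then show ?thesis using active_walk_descend[of G S v x "rev xs'"] rv xs vs trancl_into_rtrancl
        by (fastforce simp: last_rev hd_append last_ConsR split: if_splits)
    next
      case 3
      then show ?thesis using w(3) xs ys by (auto simp: unblocked_def)
    qed
  qed
qed

text \<open>By \<open>active_walk_ancestors\<close> a vertex of \<open>T\<close> cannot lie on the
  walk at all, so conditioning on it blocks nothing.\<close>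

lemma d_connected_add:
  assumes G: "acyclic G" and "d_connected G S a b" "\<And>t d. t \<in> T \<Longrightarrow> d \<in> insert a (insert b S) \<Longrightarrow> (t, d) \<notin> G\<^sup>*"
  shows "d_connected G (S \<union> T) a b"
proof -
  obtain vs where vs: "active_walk G S vs" "hd vs = a" "last vs = b"
    using assms by (auto simp: d_connected_def)
  have "set vs \<inter> T = {}" using active_walk_ancestors[OF vs(1)] vs assms(3) by blast
  moreover have "set (butlast (tl vs)) \<subseteq> set vs"
    by (metis in_set_butlastD list.set_sel(2) subsetI tl_Nil)
  ultimately have "active_walk G (S \<union> T) vs" using active_walk_mono[OF vs(1), of "S \<union> T"] by blast
  then show ?thesis using vs d_connected_def by blast
qed

text \<open>Join a path from \<open>i\<close> to \<open>k\<close> with one from \<open>k\<close> to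
  \<open>j\<close>. Whether \<open>k\<close> is open there without being in the condition decides
  between the two alternatives; \<open>k\<close> lies inside neither path, so adding it blocks
  nothing else.\<close>

lemma d_connected_weak_transitive:
  assumes G: "acyclic G" and "d_connected G S i k" "d_connected G S j k" "k \<notin> S"
  shows "d_connected G S i j \<or> d_connected G (insert k S) i j"
proof (cases "i = k \<or> j = k")
  case True
  then show ?thesis using assms d_connected_sym by blast
next
  case False
  obtain v1 where 1: "active_walk G S v1" "hd v1 = i" "last v1 = k" "distinct v1"
    using d_connected_distinct[OF G assms(2)] .
  obtain v2 where 2: "active_walk G S v2" "hd v2 = k" "last v2 = j" "distinct v2"
    using d_connected_distinct[OF G, of S k j] assms(3) d_connected_sym by blast
  obtain xs where v1: "v1 = xs @ [k]" using 1 by (cases v1 rule: rev_cases) auto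
  obtain ys where v2: "v2 = k # ys" using 2 by (cases v2) auto
  have ne: "xs \<noteq> []" "ys \<noteq> []" using 1 2 v1 v2 False by auto
  have ends: "hd (xs @ k # ys) = i" "last (xs @ k # ys) = j" using 1 2 v1 v2 ne by auto
  show ?thesis
  proof (cases "unblocked G S (last xs) k (hd ys)")
    case True
    then have "active_walk G S (xs @ k # ys)" using active_walk_append_iff ne v1 v2 1 2 by metis
    then show ?thesis using ends d_connected_def by blast
  next
    case False
    then have "unblocked G (insert k S) (last xs) k (hd ys)"
      using \<open>k \<notin> S\<close> by (auto simp: unblocked_def split: if_splits)
    moreover have "active_walk G (insert k S) v1"
      by (rule active_walk_mono[OF 1(1)]) (use 1(4) v1 ne in \<open>auto dest: in_set_butlastD list.set_sel(2)\<close>)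
    moreover have "active_walk G (insert k S) v2"
      by (rule active_walk_mono[OF 2(1)]) (use 2(4) v2 in \<open>auto dest: in_set_butlastD\<close>)
    ultimately have "active_walk G (insert k S) (xs @ k # ys)" using active_walk_append_iff ne v1 v2 by metis
    then show ?thesis using ends d_connected_def by blast
  qed
qed

lemma d_connected_adjacent: "adjacent G a b \<Longrightarrow> d_connected G S a b"
  unfolding d_connected_def by (rule exI[of _ "[a, b]"]) auto

section \<open>Semigraphoids\<close>

lemma d_connected_snoc:
  assumes "acyclic G" "d_connected G S b z" "(z, n) \<in> G" "z \<notin> S"
  shows "d_connected G S b n"
proof -
  obtain vs where "active_walk G S vs" "hd vs = b" "last vs = z" using assms(2) by (auto simp: d_connected_def)
  then show ?thesis using active_walk_snoc[OF assms(1), of S vs n] assms unfolding d_connected_def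
    by (metis active_walk.simps(1) hd_append2 last_snoc)
qed

text \<open>For acyclic \<open>G\<close> this is \<open>d_separated\<close>. The elementwise form
  makes composition immediate.\<close>

definition d_sep :: "digraph \<Rightarrow> nat set \<Rightarrow> nat set \<Rightarrow> nat set \<Rightarrow> bool" where
  "d_sep G A B S \<longleftrightarrow> (\<forall>a\<in>A. \<forall>b\<in>B. \<not> d_connected G S a b)"

lemma d_sep_sym: "d_sep G A B S \<Longrightarrow> d_sep G B A S"
  using d_connected_sym unfolding d_sep_def by blast

text \<open>Instantiated with \<open>d_sep G\<close> as well as with conditional independence. The
  sets may overlap, which saves side conditions and is sound in both instances.\<close>

locale semigraphoid =
  fixes V :: "nat set" and J :: "nat set \<Rightarrow> nat set \<Rightarrow> nat set \<Rightarrow> bool"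
  assumes finite_V: "finite V"
    and symmetric: "J A B C \<Longrightarrow> A \<subseteq> V \<Longrightarrow> B \<subseteq> V \<Longrightarrow> C \<subseteq> V \<Longrightarrow> J B A C"
    and trivial: "A \<subseteq> V \<Longrightarrow> C \<subseteq> V \<Longrightarrow> J A {} C"
    and decomposition: "J A B' C \<Longrightarrow> A \<subseteq> V \<Longrightarrow> B' \<subseteq> V \<Longrightarrow> C \<subseteq> V \<Longrightarrow> B \<subseteq> B' \<Longrightarrow> J A B C"
    and weak_union: "J A (B \<union> D) C \<Longrightarrow> A \<subseteq> V \<Longrightarrow> B \<subseteq> V \<Longrightarrow> C \<subseteq> V \<Longrightarrow> D \<subseteq> V \<Longrightarrow> J A B (C \<union> D)"
    and contraction: "J A B C \<Longrightarrow> J A D (C \<union> B) \<Longrightarrow> A \<subseteq> V \<Longrightarrow> B \<subseteq> V \<Longrightarrow> C \<subseteq> V \<Longrightarrow> D \<subseteq> V \<Longrightarrow>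
      J A (B \<union> D) C"
begin

text \<open>Decomposition, then weak union: what is not kept of \<open>U\<close> may enter the
  condition.\<close>

lemma shrink:
  assumes "J A U C" "A \<subseteq> V" "U \<subseteq> V" "C \<subseteq> V" "B \<union> (C' - C) \<subseteq> U" "C \<subseteq> C'" "C' \<subseteq> V"
  shows "J A B C'"
proof -
  have "J A (B \<union> (C' - C)) C" using decomposition[OF assms(1-5)] .
  then have "J A B (C \<union> (C' - C))" by (rule weak_union) (use assms in auto)
  then show ?thesis using assms(6) by (simp add: Un_absorb1)
qed

end

text \<open>Intersection is stated for single vertices: in this form it follows from the
  identification of polytope vertices with DAGs, and it can be tested by enumeration.\<close>

locale graphoid = semigraphoid +
  assumes intersection: "i \<in> V \<Longrightarrow> x \<in> V \<Longrightarrow> y \<in> V \<Longrightarrow> i \<noteq> x \<Longrightarrow> i \<noteq> y \<Longrightarrow> x \<noteq> y \<Longrightarrow> S \<subseteq> V - {i, x, y} \<Longrightarrow>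
    J {i} {x} (insert y S) \<Longrightarrow> J {i} {y} (insert x S) \<Longrightarrow> J {i} {x} S"

text \<open>A walk that avoids \<open>B\<close> stays active when \<open>B\<close> is added to the
  condition; one that meets \<open>B\<close> has a prefix connecting \<open>A\<close> to
  \<open>B\<close> given \<open>C\<close>.\<close>

lemma d_sep_contraction:
  assumes "d_sep G A B C" "d_sep G A D (C \<union> B)"
  shows "d_sep G A (B \<union> D) C"
  unfolding d_sep_def
proof (intro ballI notI)
  fix a d assume a: "a \<in> A" and d: "d \<in> B \<union> D" and "d_connected G C a d"
  then obtain vs where vs: "active_walk G C vs" "hd vs = a" "last vs = d" by (auto simp: d_connected_def)
  show False
  proof (cases "set vs \<inter> B = {}")
    case True
    have "set (butlast (tl vs)) \<subseteq> set vs"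
      by (metis in_set_butlastD list.set_sel(2) subsetI tl_Nil)
    then have "active_walk G (C \<union> B) vs" using True by (intro active_walk_mono[OF vs(1)]) auto
    moreover have "d \<in> D" using vs d True
      by (metis IntI UnE active_walk.simps(1) empty_iff last_in_set)
    ultimately show False using assms(2) vs a unfolding d_sep_def d_connected_def by blast
  next
    case False
    then obtain b where b: "b \<in> set vs" "b \<in> B" by blast
    then obtain xs ys where "vs = xs @ b # ys" using split_list by metis
    then have "active_walk G C (xs @ [b])" "hd (xs @ [b]) = a" using vs active_walk_prefix by (auto simp: hd_append)
    then have "d_connected G C a b" unfolding d_connected_def by (metis last_snoc)
    then show False using assms(1) a b by (auto simp: d_sep_def)
  qed
qed

text \<open>Cut the walk at its first vertex in \<open>B \<union> D\<close>: the prefix is active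
  given \<open>C \<union> D\<close> and given \<open>C \<union> B\<close>, and one of the two
  assumptions excludes its end.\<close>

lemma d_sep_intersection:
  assumes "d_sep G A B (C \<union> D)" "d_sep G A D (C \<union> B)"
  shows "d_sep G A B C"
  unfolding d_sep_def
proof (intro ballI notI)
  fix a b assume a: "a \<in> A" and b: "b \<in> B" and "d_connected G C a b"
  then obtain vs where vs: "active_walk G C vs" "hd vs = a" "last vs = b" by (auto simp: d_connected_def)
  then have "\<exists>x\<in>set vs. x \<in> B \<union> D" using b by (metis UnI1 active_walk.simps(1) last_in_set)
  then obtain xs x ys where x: "vs = xs @ x # ys" "x \<in> B \<union> D" "\<forall>y\<in>set xs. y \<notin> B \<union> D"
    using split_list_first_prop[of vs "\<lambda>x. x \<in> B \<union> D"] by auto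
  have w: "active_walk G C (xs @ [x])" "hd (xs @ [x]) = a" using vs x(1) active_walk_prefix by (auto simp: hd_append)
  have "set (butlast (tl (xs @ [x]))) \<subseteq> set xs" by (cases xs) auto
  then have "active_walk G (C \<union> D) (xs @ [x])" "active_walk G (C \<union> B) (xs @ [x])"
    using x(3) by (auto intro!: active_walk_mono[OF w(1)])
  then have "d_connected G (C \<union> D) a x" "d_connected G (C \<union> B) a x"
    using w(2) unfolding d_connected_def by (metis last_snoc)+
  then show False using assms a x(2) by (auto simp: d_sep_def)
qed

lemma graphoid_d_sep:
  assumes "acyclic G" "finite V"
  shows "graphoid V (d_sep G)"
proof unfold_locales
  fix A B C D assume w: "d_sep G A (B \<union> D) C"
  show "d_sep G A B (C \<union> D)"
    unfolding d_sep_def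
  proof (intro ballI notI)
    fix a b assume "a \<in> A" "b \<in> B" "d_connected G (C \<union> D) a b"
    then show False using d_connected_drop[OF assms(1)] w unfolding d_sep_def by blast
  qed
next
  fix i x y S
  assume "d_sep G {i} {x} (insert y S)" "d_sep G {i} {y} (insert x S)"
  then show "d_sep G {i} {x} S" using d_sep_intersection[of G "{i}" "{x}" S "{y}"] by simp
next
  fix A B C D assume "d_sep G A B C" "d_sep G A D (C \<union> B)"
  then show "d_sep G A (B \<union> D) C" by (rule d_sep_contraction)
qed (use assms(2) d_sep_sym in \<open>auto simp: d_sep_def\<close>)

section \<open>Topological orders and soundness of d-separation\<close>

definition topological :: "nat list \<Rightarrow> digraph \<Rightarrow> bool" where
  "topological xs G \<longleftrightarrow> distinct xs \<and> (\<forall>us y ws. xs = us @ y # ws \<longrightarrow> parents G y \<subseteq> set us)"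

lemma topologicalD: "topological xs G \<Longrightarrow> xs = us @ y # ws \<Longrightarrow> parents G y \<subseteq> set us"
  by (auto simp: topological_def)

lemma topological_ancestral:
  assumes "topological (us @ ws) G" "v \<in> set us" "(u, v) \<in> G\<^sup>*"
  shows "u \<in> set us"
  using assms(3,2)
proof (induction rule: converse_rtrancl_induct)
  case (step y z)
  then obtain as bs where "us = as @ z # bs" using split_list by metis
  then show ?case using topologicalD[OF assms(1), of as z "bs @ ws"] step by (auto simp: parents_def)
qed

lemma topological_acyclic:
  assumes "topological xs G" "G \<subseteq> set xs \<times> set xs"
  shows "acyclic G"
proof -
  have "\<exists>f. \<forall>(a, b)\<in>G \<inter> set xs \<times> set xs. (f b :: nat) > f a" if "topological xs G" for xs
    using that
  proof (induction xs rule: rev_induct)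
    case (snoc n xs)
    have t: "topological xs G" using snoc.prems by (auto simp: topological_def)
    obtain f where f: "\<forall>(a, b)\<in>G \<inter> set xs \<times> set xs. (f b :: nat) > f a" using snoc.IH[OF t] by blast
    obtain m where m: "\<forall>x\<in>set xs. f x < m" using finite_nat_set_iff_bounded[of "f ` set xs"] by auto
    have n: "n \<notin> set xs" using snoc.prems by (auto simp: topological_def)
    have "(f(n := m)) a < (f(n := m)) b" if "(a, b) \<in> G" "a \<in> set (xs @ [n])" "b \<in> set (xs @ [n])" for a b
    proof -
      have "a \<in> set xs" if "b = n"
        using topologicalD[OF snoc.prems, of xs n "[]"] \<open>(a, b) \<in> G\<close> that by (auto simp: parents_def)
      moreover have "a \<noteq> n" if "b \<in> set xs"
        using topological_ancestral[OF snoc.prems that] \<open>(a, b) \<in> G\<close> n by blast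
      ultimately show ?thesis using that f m n by auto
    qed
    then show ?case by (intro exI[of _ "f(n := m)"]) blast
  qed auto
  then obtain f where f: "\<forall>(a, b)\<in>G \<inter> set xs \<times> set xs. (f b :: nat) > f a" using assms(1) by blast
  have "acyclic (G\<inverse>)" by (rule acyclicI_order[of _ f]) (use f assms(2) in auto)
  then show ?thesis by simp
qed

text \<open>A walk leaving \<open>y\<close> along an arrow to a child \<open>w\<close> would make
  \<open>w\<close> an ancestor of an end or of a parent of \<open>y\<close>, hence put it before
  \<open>y\<close>. A walk leaving \<open>y\<close> through a parent is blocked there, the parent
  being a non-collider in the condition.\<close>

lemma d_sep_local_markov:
  assumes t: "topological (us @ y # ws) G" and G: "acyclic G"
  shows "d_sep G {y} (set us - parents G y) (parents G y)"
  unfolding d_sep_def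
proof (intro ballI notI)
  fix y' x assume "y' \<in> {y}" and x: "x \<in> set us - parents G y" and "d_connected G (parents G y) y' x"
  then have "d_connected G (parents G y) y x" by simp
  then obtain vs where vs: "active_walk G (parents G y) vs" "hd vs = y" "last vs = x" "distinct vs"
    by (rule d_connected_distinct[OF G])
  have dist: "distinct (us @ y # ws)" using t by (simp add: topological_def)
  obtain w zs where w: "vs = y # w # zs"
    using vs x dist by (cases vs; cases "tl vs") auto
  have pa: "parents G y \<subseteq> set us" using topologicalD[OF t] by blast
  consider "(y, w) \<in> G" | "(w, y) \<in> G" using vs(1) w by (cases zs) (auto simp: adjacent_def)
  then show False
  proof cases
    case 1
    obtain d where d: "d \<in> insert y (insert x (parents G y))" "(w, d) \<in> G\<^sup>*"
      using active_walk_ancestors[OF vs(1), of w] w vs by auto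
    then have "w \<in> set (us @ [y])"
      using topological_ancestral[of "us @ [y]" ws G d w] t x pa by auto
    then have "w \<in> set us" using vs(4) w by auto
    then have "y \<in> set us" using topological_ancestral[OF t, of w y] 1 by blast
    then show False using dist by auto
  next
    case 2
    then show False using vs w x acyclic_antisym[OF G 2]
      by (cases zs) (auto simp: parents_def unblocked_def)
  qed
qed

text \<open>The vertices are added one at a time; the last one is a sink of the graph so far, so its presence in
  \<open>A\<close>, \<open>B\<close> or \<open>C\<close> can be traded for that of its parents.\<close>

theorem (in semigraphoid) d_sep_sound:
  assumes G: "acyclic G" and t: "topological xs G" and xs: "set xs \<subseteq> V"
    and local: "\<And>us y ws. xs = us @ y # ws \<Longrightarrow> J {y} (set us - parents G y) (parents G y)"
    and sub: "A \<subseteq> set xs" "B \<subseteq> set xs" "C \<subseteq> set xs" and disj: "A \<inter> B = {}" "A \<inter> C = {}" "B \<inter> C = {}"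
    and sep: "d_sep G A B C"
  shows "J A B C"
proof -
  have "xs = us @ ws \<Longrightarrow> A \<subseteq> set us \<Longrightarrow> B \<subseteq> set us \<Longrightarrow> C \<subseteq> set us \<Longrightarrow>
      A \<inter> B = {} \<Longrightarrow> A \<inter> C = {} \<Longrightarrow> B \<inter> C = {} \<Longrightarrow> d_sep G A B C \<Longrightarrow> J A B C" for us ws A B C
  proof (induction us arbitrary: ws A B C rule: rev_induct)
    case Nil
    then show ?case using trivial by auto
  next
    case (snoc n us)
    let ?Pa = "parents G n"
    have eq: "xs = us @ n # ws" using snoc.prems by simp
    have t': "topological (us @ n # ws) G" using t eq by simp
    have V: "set us \<subseteq> V" "n \<in> V" "n \<notin> set us" using xs eq t by (auto simp: topological_def)
    have Pa: "?Pa \<subseteq> set us" using topologicalD[OF t eq] .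
    have core: "J (insert n A) B C"
      if sub: "A \<subseteq> set us" "B \<subseteq> set us" "C \<subseteq> set us" and disj: "A \<inter> B = {}" "A \<inter> C = {}" "B \<inter> C = {}"
        and sep: "d_sep G (insert n A) B C" for A B C
    proof -
      \<comment> \<open>\<open>n\<close> is independent of the other earlier vertices given its
        parents, so it can stand beside \<open>A\<close> once the parents missing from
        \<open>C\<close> do.\<close>
      define A' where "A' = A \<union> (?Pa - C)"
      have BPa: "B \<inter> ?Pa = {}"
        using sep d_connected_adjacent[of G n] by (auto simp: d_sep_def parents_def adjacent_def)
      have "d_sep G A' B C"
        unfolding d_sep_def
      proof (intro ballI notI)
        fix a b assume *: "a \<in> A'" "b \<in> B" "d_connected G C a b"
        then have "d_connected G C b a" using d_connected_sym by blast
        then have "a \<in> A \<or> d_connected G C b n"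
          using d_connected_snoc[OF G, of C b a n] * by (auto simp: A'_def parents_def)
        then show False using sep * d_connected_sym unfolding d_sep_def by blast
      qed
      then have "J A' B C"
        using sub disj Pa BPa by (intro snoc.IH[OF eq]) (auto simp: A'_def)
      then have 1: "J B A' C" by (rule symmetric) (use sub V Pa in \<open>auto simp: A'_def\<close>)
      have "J {n} (set us - ?Pa) ?Pa" using local[OF eq] .
      then have "J {n} B (C \<union> A')"
        by (rule shrink) (use sub V Pa BPa in \<open>auto simp: A'_def\<close>)
      then have "J B {n} (C \<union> A')" by (rule symmetric) (use sub V Pa in \<open>auto simp: A'_def\<close>)
      then have "J B (A' \<union> {n}) C" by (rule contraction[OF 1]) (use sub V Pa in \<open>auto simp: A'_def\<close>)
      then have "J B (insert n A) C"
        by (rule decomposition) (use sub V Pa in \<open>auto simp: A'_def\<close>)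
      then show ?thesis by (rule symmetric) (use sub V in auto)
    qed
    have core': "J A (insert n B) C"
      if "A \<subseteq> set us" "B \<subseteq> set us" "C \<subseteq> set us" and "A \<inter> B = {}" "A \<inter> C = {}" "B \<inter> C = {}"
        and "d_sep G A (insert n B) C" for A B C
    proof (rule symmetric)
      show "J (insert n B) A C"
        using that d_sep_sym[OF that(7)] by (intro core) auto
    qed (use that V in auto)
    consider "n \<in> A" | "n \<in> B" | "n \<in> C" | "n \<notin> A \<union> B \<union> C" by blast
    then show ?case
    proof cases
      case 1
      have "J (insert n (A - {n})) B C"
        by (rule core) (use snoc.prems 1 in \<open>auto simp: insert_absorb\<close>)
      then show ?thesis using 1 by (simp add: insert_absorb)
    next
      case 2
      have "J A (insert n (B - {n})) C"
        by (rule core') (use snoc.prems 2 in \<open>auto simp: insert_absorb\<close>)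
      then show ?thesis using 2 by (simp add: insert_absorb)
    next
      case 3
      define C' where "C' = C - {n}"
      have C: "C = insert n C'" "C' \<subseteq> set us" "A \<subseteq> set us" "B \<subseteq> set us" "A \<inter> C' = {}" "B \<inter> C' = {}" "n \<notin> C'"
        using 3 snoc.prems by (auto simp: C'_def)
      have n: "(n, d) \<notin> G\<^sup>*" if "d \<in> set us" for d
        using topological_ancestral[OF t' that] V by blast
      have sep': "\<not> d_connected G C' a b" if "a \<in> A" "b \<in> B" for a b
      proof
        assume "d_connected G C' a b"
        then have "d_connected G (C' \<union> {n}) a b"
          by (rule d_connected_add[OF G]) (use n C that in blast)
        then show False using snoc.prems C that by (auto simp: d_sep_def)
      qed
      \<comment> \<open>If \<open>A\<close> and \<open>B\<close> both reached \<open>n\<close> given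
        \<open>C'\<close>, weak transitivity would connect them given \<open>C'\<close> or given
        \<open>C\<close>. So \<open>n\<close> can be put beside one of them and then moved into the
        condition by weak union.\<close>
      have "(\<forall>b\<in>B. \<not> d_connected G C' n b) \<or> (\<forall>a\<in>A. \<not> d_connected G C' a n)"
      proof (rule ccontr)
        assume "\<not> ?thesis"
        then obtain a b where ab: "a \<in> A" "b \<in> B" "d_connected G C' a n" "d_connected G C' b n"
          using d_connected_sym by blast
        then have "d_connected G C' a b \<or> d_connected G (insert n C') a b"
          using d_connected_weak_transitive[OF G] C by blast
        then show False using sep' ab snoc.prems C by (auto simp: d_sep_def)
      qed
      then show ?thesis
      proof
        assume "\<forall>b\<in>B. \<not> d_connected G C' n b"
        then have "J (insert n A) B C'" using sep' C snoc.prems by (intro core) (auto simp: d_sep_def)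
        then have "J (A \<union> {n}) B C'" by simp
        then have "J B (A \<union> {n}) C'" by (rule symmetric[of "A \<union> {n}"]) (use C V in auto)
        then have "J B A (C' \<union> {n})" by (rule weak_union) (use C V in auto)
        then have "J A B (C' \<union> {n})" by (rule symmetric[of B]) (use C V in auto)
        then show ?thesis using C by simp
      next
        assume "\<forall>a\<in>A. \<not> d_connected G C' a n"
        then have "J A (insert n B) C'" using sep' C snoc.prems by (intro core') (auto simp: d_sep_def)
        then have "J A (B \<union> {n}) C'" by simp
        then have "J A B (C' \<union> {n})" by (rule weak_union) (use C V in auto)
        then show ?thesis using C by simp
      qed
    next
      case 4
      then show ?thesis using snoc.prems by (intro snoc.IH[OF eq]) auto
    qed
  qed
  from this[of xs "[]"] show ?thesis using sub disj sep by simp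
qed

section \<open>Minimal independence maps of orders\<close>

definition order_imap :: "(nat set \<Rightarrow> nat set \<Rightarrow> nat set \<Rightarrow> bool) \<Rightarrow> nat list \<Rightarrow> digraph" where
  "order_imap J xs =
     {(x, y). \<exists>us ws. xs = us @ y # ws \<and> x \<in> set us \<and> \<not> J {x} {y} (set us - {x})}"

definition prune :: "(nat set \<Rightarrow> nat set \<Rightarrow> nat set \<Rightarrow> bool) \<Rightarrow> digraph \<Rightarrow> digraph" where
  "prune J G = {(x, y) \<in> G. \<not> J {x} {y} (parents G y - {x})}"

text \<open>With \<open>J = d_sep H\<close> this compares two DAGs: every d-separation of
  \<open>G\<close> holds in \<open>H\<close>. Required in both directions, it is Markov
  equivalence.\<close>

definition independence_map :: "nat set \<Rightarrow> (nat set \<Rightarrow> nat set \<Rightarrow> nat set \<Rightarrow> bool) \<Rightarrow> digraph \<Rightarrow> bool" where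
  "independence_map V J G \<longleftrightarrow> G \<subseteq> V \<times> V \<and> acyclic G \<and>
     (\<forall>A B C. A \<subseteq> V \<longrightarrow> B \<subseteq> V \<longrightarrow> C \<subseteq> V \<longrightarrow> A \<inter> B = {} \<longrightarrow> A \<inter> C = {} \<longrightarrow> B \<inter> C = {} \<longrightarrow>
        d_sep G A B C \<longrightarrow> J A B C)"

lemma independence_mapD:
  "independence_map V J G \<Longrightarrow> d_sep G A B C \<Longrightarrow> A \<subseteq> V \<Longrightarrow> B \<subseteq> V \<Longrightarrow> C \<subseteq> V \<Longrightarrow>
     A \<inter> B = {} \<Longrightarrow> A \<inter> C = {} \<Longrightarrow> B \<inter> C = {} \<Longrightarrow> J A B C"
  by (simp add: independence_map_def)

lemma distinct_split_unique:
  assumes "distinct (us @ y # ws)" "us @ y # ws = us' @ y # ws'"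
  shows "us' = us \<and> ws' = ws"
proof -
  have "y \<notin> set us" "y \<notin> set ws" using assms(1) by auto
  then show ?thesis using append_Cons_eq_iff[of y us ws us' ws'] assms(2) by simp
qed

lemma split_unique:
  assumes "distinct zs" "zs = us @ y # ws" "zs = us' @ y # ws'"
  shows "us' = us"
  using distinct_split_unique[of us y ws us' ws'] assms by metis

lemma order_imap_iff:
  assumes "distinct (us @ y # ws)"
  shows "(x, y) \<in> order_imap J (us @ y # ws) \<longleftrightarrow> x \<in> set us \<and> \<not> J {x} {y} (set us - {x})"
  using distinct_split_unique[OF assms] unfolding order_imap_def by blast

lemma order_imap_subset: "order_imap J xs \<subseteq> set xs \<times> set xs"
  by (auto simp: order_imap_def)

lemma topological_order_imap: "distinct xs \<Longrightarrow> topological xs (order_imap J xs)"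
  using order_imap_iff by (fastforce simp: topological_def parents_def)

lemma acyclic_order_imap: "distinct xs \<Longrightarrow> acyclic (order_imap J xs)"
  using topological_acyclic topological_order_imap order_imap_subset by metis

lemma parents_order_imap:
  assumes "distinct (us @ y # ws)"
  shows "parents (order_imap J (us @ y # ws)) y = {x \<in> set us. \<not> J {x} {y} (set us - {x})}"
  using order_imap_iff[OF assms] by (auto simp: parents_def)

context semigraphoid
begin

text \<open>Soundness reduces the global Markov property to the local one along a single
  order.\<close>

lemma independence_mapI:
  assumes "acyclic G" "topological xs G" "set xs = V" "G \<subseteq> V \<times> V"
    and "\<And>us y ws. xs = us @ y # ws \<Longrightarrow> J {y} (set us - parents G y) (parents G y)"
  shows "independence_map V J G"
  unfolding independence_map_def
proof (intro conjI allI impI)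
  fix A B C
  assume "A \<subseteq> V" "B \<subseteq> V" "C \<subseteq> V" "A \<inter> B = {}" "A \<inter> C = {}" "B \<inter> C = {}" "d_sep G A B C"
  then show "J A B C"
    by (intro d_sep_sound[OF assms(1,2), where A = A and B = B and C = C]) (use assms(3,5) in simp_all)
qed (use assms in simp_all)

lemma independence_map_local:
  assumes "independence_map V J G" "topological (us @ y # ws) G" "set (us @ y # ws) = V"
  shows "J {y} (set us - parents G y) (parents G y)"
proof -
  have "acyclic G" using assms by (simp add: independence_map_def)
  then have "d_sep G {y} (set us - parents G y) (parents G y)"
    using d_sep_local_markov assms by blast
  moreover have "parents G y \<subseteq> set us" "y \<notin> set us"
    using topologicalD[OF assms(2)] assms(2) by (auto simp: topological_def)
  ultimately show ?thesis by (intro independence_mapD[OF assms(1)]) (use assms(3) in auto)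
qed

text \<open>An earlier vertex that is not a parent is independent of \<open>y\<close> given the
  parents, and weak union moves the remaining predecessors into the condition. Being true in every
  semigraphoid, this applies to arbitrary distributions, as in
  \<open>edge_imp_sparsest\<close>.\<close>

lemma order_imap_subset_imap:
  assumes "independence_map V J G" "topological xs G" "set xs = V"
  shows "order_imap J xs \<subseteq> G"
proof
  fix e assume e: "e \<in> order_imap J xs"
  then obtain x y us ws where xy: "e = (x, y)" "xs = us @ y # ws" "x \<in> set us" "\<not> J {x} {y} (set us - {x})"
    by (auto simp: order_imap_def)
  have y: "y \<notin> set us" using assms(2) xy by (auto simp: topological_def)
  have Pa: "parents G y \<subseteq> set us" using topologicalD[OF assms(2) xy(2)] .
  have V: "set us \<subseteq> V" "y \<in> V" using assms(3) xy by auto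
  show "e \<in> G"
  proof (rule ccontr)
    assume "e \<notin> G"
    then have "x \<notin> parents G y" using xy by (simp add: parents_def)
    moreover have "J {y} (set us - parents G y) (parents G y)"
      using independence_map_local assms xy by blast
    ultimately have "J {y} {x} (set us - {x})"
      by (elim shrink) (use V Pa xy in auto)
    then have "J {x} {y} (set us - {x})" by (rule symmetric) (use V xy in auto)
    then show False using xy by simp
  qed
qed

end

context graphoid
begin

text \<open>Given its parents, \<open>y\<close> is independent of the other predecessors.
  Contraction adds these to the condition and intersection removes them again, so conditioning on
  all predecessors or on the parents alone decides an arrow in the same way.\<close>

lemma order_imap_eq_prune:
  assumes G: "independence_map V J G" and t: "topological xs G" and xs: "set xs = V"
  shows "order_imap J xs = prune J G"
proof (rule set_eqI)
  fix e :: "nat \<times> nat"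
  obtain x y where e: "e = (x, y)" by fastforce
  show "e \<in> order_imap J xs \<longleftrightarrow> e \<in> prune J G"
  proof (cases "(x, y) \<in> G")
    case False
    then show ?thesis using order_imap_subset_imap[OF assms] e by (auto simp: prune_def)
  next
    case True
    then have "y \<in> set xs" using G xs by (auto simp: independence_map_def)
    then obtain us ws where split: "xs = us @ y # ws" using split_list by metis
    let ?Pa = "parents G y" and ?N = "set us - parents G y"
    have d: "distinct (us @ y # ws)" using t split by (simp add: topological_def)
    then have y: "y \<notin> set us" by auto
    have Pa: "?Pa \<subseteq> set us" using topologicalD[OF t split] .
    have x: "x \<in> ?Pa" using True by (simp add: parents_def)
    have V: "set us \<subseteq> V" "y \<in> V" using xs split by auto
    have loc: "J {y} ?N ?Pa" using independence_map_local[OF G] t xs split by blast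
    have "J {y} {x} (set us - {x}) \<longleftrightarrow> J {y} {x} (?Pa - {x})"
    proof
      assume J: "J {y} {x} (?Pa - {x})"
      have "?Pa - {x} \<union> {x} = ?Pa" using x by auto
      then have "J {y} ?N (?Pa - {x} \<union> {x})" using loc by simp
      with J have "J {y} ({x} \<union> ?N) (?Pa - {x})"
        by (rule contraction) (use V Pa x in auto)
      then show "J {y} {x} (set us - {x})"
        by (rule shrink) (use V Pa x in auto)
    next
      assume J: "J {y} {x} (set us - {x})"
      \<comment> \<open>\<open>T\<close> is the set of non-parents already removed. Each
        \<open>z\<close> is removed by intersection, its own independence from \<open>y\<close>
        coming from the local Markov property.\<close>
      have "T \<subseteq> ?N \<Longrightarrow> J {y} {x} (?Pa - {x} \<union> (?N - T))" if "finite T" for T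
        using that
      proof (induction T rule: finite_induct)
        case empty
        have "?Pa - {x} \<union> (?N - {}) = set us - {x}" using x Pa by auto
        then show ?case using J by simp
      next
        case (insert z T)
        let ?S = "?Pa - {x} \<union> (?N - insert z T)"
        have "insert z ?S = ?Pa - {x} \<union> (?N - T)" using insert by auto
        then have 1: "J {y} {x} (insert z ?S)" using insert by simp
        have 2: "J {y} {z} (insert x ?S)"
          using loc by (rule shrink) (use V Pa x insert.hyps insert.prems in auto)
        show ?case
          by (rule intersection[OF _ _ _ _ _ _ _ 1 2]) (use V Pa x y insert.hyps insert.prems in auto)
      qed
      from this[of ?N] show "J {y} {x} (?Pa - {x})" by simp
    qed
    then have "J {x} {y} (set us - {x}) \<longleftrightarrow> J {x} {y} (?Pa - {x})"
      using symmetric[of "{x}" "{y}"] symmetric[of "{y}" "{x}"] V Pa x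
      by (meson Diff_subset empty_subsetI insert_subset subset_trans subsetD)
    then show ?thesis
      using order_imap_iff[OF d] split e True x Pa by (auto simp: prune_def)
  qed
qed

text \<open>A missing arrow is an independence given all other predecessors; intersection turns
  these pairwise relations into the local Markov property.\<close>

lemma independence_map_order_imap:
  assumes "distinct xs" "set xs = V"
  shows "independence_map V J (order_imap J xs)"
proof (rule independence_mapI)
  fix us y ws assume split: "xs = us @ y # ws"
  have d: "distinct (us @ y # ws)" using assms split by simp
  have V: "set us \<subseteq> V" "y \<in> V" using assms split by auto
  define Pa where "Pa = parents (order_imap J xs) y"
  define N where "N = set us - Pa"
  have Pa: "Pa = {x \<in> set us. \<not> J {x} {y} (set us - {x})}"
    using parents_order_imap[OF d] split by (simp add: Pa_def)
  have y: "y \<notin> set us" using d by auto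
  have sub: "Pa \<subseteq> V" "N \<subseteq> V" "y \<notin> Pa" "y \<notin> N" "Pa \<inter> N = {}" using V Pa y by (auto simp: N_def)
  \<comment> \<open>Induction downwards from the full condition: if \<open>x\<close> is the only
    element of \<open>N - T\<close>, this is the missing arrow itself; otherwise two instances with
    larger \<open>T\<close> combine by intersection.\<close>
  have "\<forall>x\<in>N - T. J {y} {x} (Pa \<union> T)" if "T \<subseteq> N" for T
    using that
  proof (induction "card (N - T)" arbitrary: T rule: less_induct)
    case less
    show ?case
    proof
      fix x assume x: "x \<in> N - T"
      show "J {y} {x} (Pa \<union> T)"
      proof (cases "N - T = {x}")
        case True
        then have "Pa \<union> T = set us - {x}" using less.prems x Pa by (auto simp: N_def)
        moreover have "J {x} {y} (set us - {x})" using x Pa by (auto simp: N_def)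
        then have "J {y} {x} (set us - {x})" by (rule symmetric) (use V x in \<open>auto simp: N_def\<close>)
        ultimately show ?thesis by simp
      next
        case False
        then obtain z where z: "z \<in> N - T" "z \<noteq> x" using x by blast
        have less_card: "card (N - insert v T) < card (N - T)" if "v \<in> N - T" for v
        proof (rule psubset_card_mono)
          show "finite (N - T)" by (auto simp: N_def)
        qed (use that in auto)
        have "J {y} {x} (Pa \<union> insert z T)" "J {y} {z} (Pa \<union> insert x T)"
          using less.hyps[of "insert z T"] less.hyps[of "insert x T"] less_card z x less.prems by auto
        then have 1: "J {y} {x} (insert z (Pa \<union> T))" and 2: "J {y} {z} (insert x (Pa \<union> T))" by simp_all
        show ?thesis
          by (rule intersection[OF _ _ _ _ _ _ _ 1 2]) (use V sub x y z less.prems in \<open>auto simp: N_def\<close>)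
      qed
    qed
  qed
  then have N: "J {y} {x} (Pa \<union> T)" if "insert x T \<subseteq> N" "x \<notin> T" for x T using that by blast
  have "T \<subseteq> N \<Longrightarrow> J {y} T Pa" if "finite T" for T
    using that
  proof (induction T rule: finite_induct)
    case empty
    then show ?case using trivial[of "{y}" Pa] V sub by simp
  next
    case (insert x T)
    then have "J {y} (T \<union> {x}) Pa"
      using V sub N by (intro contraction) auto
    then show ?case by simp
  qed
  then show "J {y} (set us - parents (order_imap J xs) y) (parents (order_imap J xs) y)"
    by (auto simp: N_def Pa_def[symmetric])
qed (use assms acyclic_order_imap topological_order_imap order_imap_subset[of J xs] in simp_all)

end

section \<open>Covered arrow reversals\<close>

definition reverse_arrow :: "nat \<Rightarrow> nat \<Rightarrow> digraph \<Rightarrow> digraph" where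
  "reverse_arrow i j G = insert (j, i) (G - {(i, j)})"

lemma parents_reverse_arrow:
  "i \<noteq> j \<Longrightarrow> parents (reverse_arrow i j G) y =
     (if y = i then insert j (parents G i) else if y = j then parents G j - {i} else parents G y)"
  by (auto simp: parents_def reverse_arrow_def)

lemma covered_arrow_reverse:
  assumes "covered_arrow G i j" "(j, i) \<notin> G"
  shows "covered_arrow (reverse_arrow i j G) j i" "reverse_arrow j i (reverse_arrow i j G) = G"
proof -
  have ij: "i \<noteq> j" "(i, j) \<in> G" "parents G i = parents G j - {i}"
    using assms by (auto simp: covered_arrow_def)
  have "j \<notin> parents G i" using assms(2) by (simp add: parents_def)
  then show "covered_arrow (reverse_arrow i j G) j i"
    using ij parents_reverse_arrow[OF ij(1), of G]
    by (simp add: covered_arrow_def) (simp add: reverse_arrow_def)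
  show "reverse_arrow j i (reverse_arrow i j G) = G"
    using ij(1,2) assms(2) by (auto simp: reverse_arrow_def)
qed

lemma topological_swap:
  assumes t: "topological (us @ a # b # ws) G" and "a \<notin> parents G b"
  shows "topological (us @ b # a # ws) G"
  unfolding topological_def
proof (intro conjI allI impI)
  show "distinct (us @ b # a # ws)" using t by (auto simp: topological_def)
  fix vs y zs assume eq: "us @ b # a # ws = vs @ y # zs"
  have d: "distinct (us @ b # a # ws)" using t by (auto simp: topological_def)
  consider "y = a" | "y = b" | "y \<in> set us" | "y \<in> set ws"
    using eq by (metis append_Cons append_Nil in_set_conv_decomp set_ConsD Un_iff set_append)
  then show "parents G y \<subseteq> set vs"
  proof cases
    case 1
    then have "vs = us @ [b]" by (intro split_unique[OF d _ eq]) (use 1 in simp)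
    then show ?thesis using topologicalD[OF t, of us a] 1 by auto
  next
    case 2
    then have "vs = us" by (intro split_unique[OF d _ eq]) (use 2 in simp)
    then show ?thesis using topologicalD[OF t, of "us @ [a]" b] 2 assms(2) by auto
  next
    case 3
    then obtain as bs where us: "us = as @ y # bs" using split_list by metis
    then have "vs = as" by (intro split_unique[OF d _ eq]) (use us in simp)
    then show ?thesis using topologicalD[OF t, of as y] us by auto
  next
    case 4
    then obtain as bs where ws: "ws = as @ y # bs" using split_list by metis
    then have "vs = us @ b # a # as" by (intro split_unique[OF d _ eq]) (use ws in simp)
    then show ?thesis using topologicalD[OF t, of "us @ a # b # as" y] ws by auto
  qed
qed

lemma topological_reverse_arrow:
  assumes t: "topological (us @ i # j # ws) G" and c: "covered_arrow G i j"
  shows "topological (us @ j # i # ws) (reverse_arrow i j G)"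
proof -
  have ne: "i \<noteq> j" using t by (auto simp: topological_def)
  have "topological (us @ i # j # ws) (G - {(i, j)})"
    using t by (fastforce simp: topological_def parents_def)
  then have "topological (us @ j # i # ws) (G - {(i, j)})"
    by (rule topological_swap) (auto simp: parents_def)
  then show ?thesis
  proof -
    assume t': "topological (us @ j # i # ws) (G - {(i, j)})"
    show ?thesis
      unfolding topological_def
    proof (intro conjI allI impI)
      show d: "distinct (us @ j # i # ws)" using t' by (simp add: topological_def)
      fix vs y zs assume eq: "us @ j # i # ws = vs @ y # zs"
      then have "parents (G - {(i, j)}) y \<subseteq> set vs" using topologicalD[OF t'] by blast
      moreover have "j \<in> set vs" if "y = i"
        using distinct_split_unique[of "us @ [j]" i ws vs zs] eq d that by auto
      ultimately show "parents (reverse_arrow i j G) y \<subseteq> set vs"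
        by (auto simp: parents_def reverse_arrow_def)
    qed
  qed
qed

text \<open>Every parent of \<open>j\<close> other than \<open>i\<close> is a parent of
  \<open>i\<close> and hence precedes \<open>i\<close>. So no vertex of \<open>vs\<close> is a
  parent of \<open>j\<close>, and \<open>j\<close> can move left past all of them.\<close>

lemma covered_arrow_adjacent_order:
  assumes t: "topological (us @ i # vs @ j # ws) G" and c: "covered_arrow G i j"
  shows "topological (us @ i # j # vs @ ws) G"
  using t
proof (induction vs arbitrary: ws rule: rev_induct)
  case (snoc v vs)
  have "v \<notin> parents G j"
  proof
    assume "v \<in> parents G j"
    then have "v = i \<or> v \<in> parents G i" using c by (auto simp: covered_arrow_def)
    moreover have "parents G i \<subseteq> set us" by (rule topologicalD[OF snoc.prems]) simp
    moreover have "v \<notin> set us" "v \<noteq> i" using snoc.prems by (auto simp: topological_def)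
    ultimately show False by blast
  qed
  then have "topological ((us @ i # vs) @ j # v # ws) G"
    using topological_swap[of "us @ i # vs" v j ws G] snoc.prems by auto
  then show ?case using snoc.IH[of "v # ws"] by simp
qed simp

text \<open>Only \<open>i\<close> and \<open>j\<close> change their parents. With \<open>Pa\<close>
  their common parents, both DAGs say about these two vertices that the pair is independent of the
  earlier non-parents given \<open>Pa\<close>; they merely split this statement in opposite
  orders.\<close>

lemma d_sep_reverse_arrow_if:
  assumes t: "topological (us @ i # j # ws) G" and V: "set (us @ i # j # ws) = V"
    and G: "G \<subseteq> V \<times> V" and c: "covered_arrow G i j"
  shows "independence_map V (d_sep (reverse_arrow i j G)) G"
proof -
  let ?G' = "reverse_arrow i j G"
  have ij: "i \<noteq> j" "i \<in> V" "j \<in> V" using t V by (auto simp: topological_def)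
  have G': "?G' \<subseteq> V \<times> V" using G ij by (auto simp: reverse_arrow_def)
  have t': "topological (us @ j # i # ws) ?G'" using topological_reverse_arrow[OF t c] .
  have V': "set (us @ j # i # ws) = V" using V by auto
  have ac: "acyclic G" "acyclic ?G'"
    using topological_acyclic[OF t, unfolded V, OF G] topological_acyclic[OF t', unfolded V', OF G'] .
  interpret graphoid V "d_sep ?G'"
    using graphoid_d_sep[OF ac(2)] V by (metis List.finite_set)
  have d: "distinct (us @ i # j # ws)" using t by (simp add: topological_def)
  define Pa where "Pa = parents G i"
  have pj: "parents G j = insert i Pa" using c by (auto simp: covered_arrow_def parents_def Pa_def)
  have Pa: "Pa \<subseteq> set us" using topologicalD[OF t, of us i] by (simp add: Pa_def)
  have pa': "parents ?G' j = Pa" "parents ?G' i = insert j Pa"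
    using parents_reverse_arrow[OF ij(1), of G] pj Pa d ij by (auto simp: Pa_def[symmetric])
  have sub: "set us \<subseteq> V" "i \<notin> set us" "j \<notin> set us" using V d by auto
  have 1: "d_sep ?G' {j} (set us - Pa) Pa"
    using d_sep_local_markov[OF t' ac(2)] pa' by simp
  have "d_sep ?G' {i} (set (us @ [j]) - insert j Pa) (insert j Pa)"
    using d_sep_local_markov[of "us @ [j]" i ws ?G'] t' ac(2) pa' by simp
  moreover have "set (us @ [j]) - insert j Pa = set us - Pa" using sub by auto
  ultimately have 2: "d_sep ?G' {i} (set us - Pa) (Pa \<union> {j})" by simp
  have "d_sep ?G' (set us - Pa) ({j} \<union> {i}) Pa"
    by (rule contraction) (use 1 2 d_sep_sym sub Pa ij in auto)
  then have 3: "d_sep ?G' ({j} \<union> {i}) (set us - Pa) Pa" by (rule d_sep_sym)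
  show ?thesis
  proof (rule independence_mapI[OF ac(1) t V G])
    fix vs y zs assume eq: "us @ i # j # ws = vs @ y # zs"
    consider "y = i" | "y = j" | "y \<in> set us" | "y \<in> set ws"
      using eq by (metis append_Cons append_Nil in_set_conv_decomp set_ConsD Un_iff set_append)
    then show "d_sep ?G' {y} (set vs - parents G y) (parents G y)"
    proof cases
      case 1
      then have "vs = us" by (intro split_unique[OF d _ eq]) (use 1 in simp)
      then show ?thesis using 1 3 by (auto simp: d_sep_def Pa_def)
    next
      case 2
      then have "vs = us @ [i]" by (intro split_unique[OF d _ eq]) (use 2 in simp)
      moreover have "d_sep ?G' (set us - Pa) {j} (Pa \<union> {i})"
        by (rule weak_union) (use 3 d_sep_sym sub Pa ij in auto)
      then have "d_sep ?G' {j} (set us - Pa) (Pa \<union> {i})" by (rule d_sep_sym)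
      moreover have "set (us @ [i]) - insert i Pa = set us - Pa" using sub by auto
      ultimately show ?thesis using 2 pj by simp
    next
      case 3
      then obtain as bs where us: "us = as @ y # bs" using split_list by metis
      then have "vs = as" by (intro split_unique[OF d _ eq]) (use us in simp)
      moreover have "parents ?G' y = parents G y" using 3 sub parents_reverse_arrow[OF ij(1)] by auto
      ultimately show ?thesis using d_sep_local_markov[of as y "bs @ j # i # ws" ?G'] t' ac us by auto
    next
      case 4
      then obtain as bs where ws: "ws = as @ y # bs" using split_list by metis
      then have "vs = us @ i # j # as" by (intro split_unique[OF d _ eq]) (use ws in simp)
      moreover have "y \<noteq> i" "y \<noteq> j" using 4 d by auto
      then have "parents ?G' y = parents G y" using parents_reverse_arrow[OF ij(1)] by auto
      ultimately show ?thesis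
        using d_sep_local_markov[of "us @ j # i # as" y bs ?G'] t' ac ws by (auto simp: insert_commute)
    qed
  qed
qed

lemma independence_map_trans:
  "independence_map V (d_sep H) G \<Longrightarrow> independence_map V J H \<Longrightarrow> independence_map V J G"
  by (simp add: independence_map_def)

text \<open>The reversed arrow is covered again, so \<open>d_sep_reverse_arrow_if\<close> used twice
  gives Markov equivalence. In the orders returned \<open>i\<close> and \<open>j\<close> are
  neighbours, which makes the reversal a single transposition.\<close>

theorem covered_reversal:
  assumes xs: "topological xs G" "set xs = V" and G: "G \<subseteq> V \<times> V" and c: "covered_arrow G i j"
  obtains us vs ws where "xs = us @ i # vs @ j # ws" "topological (us @ i # j # vs @ ws) G"
    "topological (us @ j # i # vs @ ws) (reverse_arrow i j G)"
    "reverse_arrow i j G \<subseteq> V \<times> V" "card (reverse_arrow i j G) = card G"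
    "independence_map V (d_sep (reverse_arrow i j G)) G" "independence_map V (d_sep G) (reverse_arrow i j G)"
proof -
  have ij: "(i, j) \<in> G" "i \<in> V" "j \<in> V" using c G by (auto simp: covered_arrow_def)
  have ac: "acyclic G" using topological_acyclic[OF xs(1), unfolded xs(2), OF G] .
  have ji: "(j, i) \<notin> G" using acyclic_antisym[OF ac ij(1)] .
  obtain us' ws where 1: "xs = us' @ j # ws" using ij xs split_list by metis
  then have "i \<in> set us'" using topologicalD[OF xs(1)] ij by (auto simp: parents_def)
  then obtain us vs where 2: "us' = us @ i # vs" using split_list by metis
  have t: "topological (us @ i # j # vs @ ws) G"
    using covered_arrow_adjacent_order[OF _ c] xs 1 2 by simp
  have V: "set (us @ i # j # vs @ ws) = V" "set (us @ j # i # vs @ ws) = V" using xs 1 2 by auto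
  have G': "reverse_arrow i j G \<subseteq> V \<times> V" using G ij by (auto simp: reverse_arrow_def)
  have t': "topological (us @ j # i # vs @ ws) (reverse_arrow i j G)" using topological_reverse_arrow[OF t c] .
  have fin: "finite G" using G xs(2) finite_subset by (metis List.finite_set finite_cartesian_product)
  have "card (reverse_arrow i j G) = card G"
    unfolding reverse_arrow_def using fin ji card_Suc_Diff1[OF fin ij(1)] by simp
  moreover have "independence_map V (d_sep (reverse_arrow i j G)) G"
    using d_sep_reverse_arrow_if[OF t V(1) G c] .
  moreover have "independence_map V (d_sep G) (reverse_arrow i j G)"
    using d_sep_reverse_arrow_if[OF t' V(2) G' covered_arrow_reverse(1)[OF c ji]] covered_arrow_reverse(2)[OF c ji]
    by simp
  ultimately show thesis using that 1 2 t t' G' by simp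
qed

section \<open>Covered reversals towards the faithful DAG\<close>

definition sink_in :: "digraph \<Rightarrow> nat set \<Rightarrow> nat \<Rightarrow> bool" where
  "sink_in G U y \<longleftrightarrow> y \<in> U \<and> (\<forall>c\<in>U. (y, c) \<notin> G)"

definition ancestral :: "digraph \<Rightarrow> nat set \<Rightarrow> bool" where
  "ancestral G U \<longleftrightarrow> (\<forall>v\<in>U. \<forall>u. (u, v) \<in> G \<longrightarrow> u \<in> U)"

lemma ancestral_rtrancl: "ancestral G U \<Longrightarrow> v \<in> U \<Longrightarrow> (u, v) \<in> G\<^sup>* \<Longrightarrow> u \<in> U"
  by (erule converse_rtrancl_induct) (auto simp: ancestral_def)

lemma ex_sink_below:
  assumes "acyclic G" "finite U" "z \<in> U"
  obtains t where "sink_in G U t" "(z, t) \<in> G\<^sup>*"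
proof -
  let ?G = "G \<inter> U \<times> U"
  have "finite ?G" using assms(2) by auto
  moreover have "acyclic ?G" using acyclic_subset[OF assms(1)] by auto
  ultimately have "wf (?G\<inverse>)" by (rule finite_acyclic_wf_converse)
  then obtain t where t: "t \<in> {t \<in> U. (z, t) \<in> ?G\<^sup>*}"
    "\<And>y. (y, t) \<in> ?G\<inverse> \<Longrightarrow> y \<notin> {t \<in> U. (z, t) \<in> ?G\<^sup>*}"
    using wfE_min[of "?G\<inverse>" z "{t \<in> U. (z, t) \<in> ?G\<^sup>*}"] assms(3) by auto
  have "sink_in G U t"
    unfolding sink_in_def
  proof (intro conjI ballI notI)
    fix c assume c: "c \<in> U" "(t, c) \<in> G"
    then have "(t, c) \<in> ?G" using t(1) by auto
    then have "(z, c) \<in> ?G\<^sup>*" using t(1) by (auto intro: rtrancl_into_rtrancl)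
    then show False using t(2)[of c] \<open>(t, c) \<in> ?G\<close> c by auto
  qed (use t(1) in auto)
  moreover have "(z, t) \<in> G\<^sup>*" using t(1) rtrancl_mono[of ?G G] by auto
  ultimately show thesis using that by blast
qed

text \<open>A sink of an ancestral set is an ancestor of no other vertex of that set, so
  \<open>d_connected_add\<close> applies.\<close>

lemma d_connected_add_sink:
  assumes G: "acyclic G" and U: "ancestral G U" and Y: "sink_in G U y"
    and "a \<in> U - {y}" "b \<in> U - {y}" "S \<subseteq> U - {y}" and c: "d_connected G S a b"
  shows "d_connected G (insert y S) a b"
proof -
  have "(y, d) \<notin> G\<^sup>*" if d: "d \<in> U - {y}" for d
  proof
    assume "(y, d) \<in> G\<^sup>*"
    then obtain c where "(y, c) \<in> G" "(c, d) \<in> G\<^sup>*" using d by (auto elim: converse_rtranclE)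
    then show False using ancestral_rtrancl[OF U, of d c] d Y by (auto simp: sink_in_def)
  qed
  then have "d_connected G (S \<union> {y}) a b"
    by (intro d_connected_add[OF G c]) (use assms in blast)
  then show ?thesis by simp
qed

text \<open>If \<open>Y\<close> is the last sink of \<open>U\<close> in the order, then \<open>Z\<close> has a sink \<open>t\<close> of \<open>U\<close> below it, and \<open>t\<close>
  precedes \<open>Z\<close>. A walk between \<open>x\<close> and \<open>Y\<close> that needs \<open>Z\<close> to open a collider could then be opened by
  \<open>t\<close> or be diverted to \<open>t\<close>; hence conditioning on \<open>Z\<close> does not connect \<open>x\<close> and \<open>Y\<close>.\<close>

lemma last_sink_covered:
  assumes G: "acyclic G" and xs: "xs = us @ Y # Z # ws" "distinct xs"
    and U: "ancestral G U" "finite U" "insert Y (insert Z (set us)) \<subseteq> U"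
    and Y: "sink_in G U Y" and last: "\<And>t. sink_in G U t \<Longrightarrow> t \<in> insert Y (set us)"
    and arrow: "(Y, Z) \<in> order_imap (d_sep G) xs"
  shows "covered_arrow (order_imap (d_sep G) xs) Y Z"
proof -
  let ?D = "order_imap (d_sep G) xs"
  have d: "distinct (us @ Y # Z # ws)" using xs by simp
  have ne: "Y \<noteq> Z" "Y \<notin> set us" "Z \<notin> set us" using d by auto
  have pY: "parents ?D Y = {x \<in> set us. d_connected G (set us - {x}) x Y}"
    using parents_order_imap[of us Y "Z # ws"] xs by (simp add: d_sep_def)
  have "parents ?D Z = {x \<in> set (us @ [Y]). d_connected G (set (us @ [Y]) - {x}) x Z}"
    using parents_order_imap[of "us @ [Y]" Z ws] xs by (simp add: d_sep_def)
  then have pZ: "parents ?D Z = {x \<in> insert Y (set us). d_connected G (insert Y (set us) - {x}) x Z}"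
    by simp
  have "Y \<in> parents ?D Z" using arrow by (simp add: parents_def)
  then have YZ: "d_connected G (set us) Y Z" using pZ ne by simp
  have "x \<in> parents ?D Y \<longleftrightarrow> x \<in> parents ?D Z" if x: "x \<in> set us" for x
  proof -
    define S where "S = set us - {x}"
    have us: "set us = insert x S" "x \<notin> S" "S \<subseteq> U" "x \<in> U" "Y \<in> U" "Z \<in> U" "Y \<notin> S" "Z \<notin> S" "Y \<noteq> x" "Z \<noteq> x"
      using x U(3) ne by (auto simp: S_def)
    have "insert Y (set us) - {x} = insert Y S" using us by auto
    then have pZ': "x \<in> parents ?D Z \<longleftrightarrow> d_connected G (insert Y S) x Z" using pZ x by simp
    have pY': "x \<in> parents ?D Y \<longleftrightarrow> d_connected G S x Y" using pY x by (simp add: S_def)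
    \<comment> \<open>Removing \<open>x\<close> from the condition of the connection between
      \<open>Y\<close> and \<open>Z\<close> either keeps the connection or connects the starting end
      with \<open>x\<close>.\<close>
    have YZ': "d_connected G S Y Z \<or> d_connected G S Y x" "d_connected G S Z Y \<or> d_connected G S Z x"
      using d_connected_drop[OF G, of S "{x}" Y Z] d_connected_drop[OF G, of S "{x}" Z Y] YZ us
        d_connected_sym[of G "set us" Y Z] by auto
    show ?thesis
      unfolding pY' pZ'
    proof
      assume xY: "d_connected G S x Y"
      \<comment> \<open>Here \<open>Y\<close> is the intermediate vertex of weak transitivity; in
        the other direction it is \<open>Z\<close>.\<close>
      show "d_connected G (insert Y S) x Z"
      proof (rule ccontr)
        assume n: "\<not> ?thesis"
        then have "\<not> d_connected G S x Z"
          using d_connected_add_sink[OF G U(1) Y, of x Z S] us ne by auto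
        moreover from this have "d_connected G S Z Y" using YZ' d_connected_sym by blast
        ultimately show False
          using d_connected_weak_transitive[OF G xY] n us by blast
      qed
    next
      assume xZ: "d_connected G (insert Y S) x Z"
      show "d_connected G S x Y"
      proof (rule ccontr)
        assume n: "\<not> ?thesis"
        then have n': "\<not> d_connected G S Y x" using d_connected_sym by blast
        have "d_connected G S x Z" using d_connected_drop[OF G, of S "{Y}" x Z] xZ n by simp
        moreover have "d_connected G S Y Z" using YZ' n' by blast
        ultimately have c: "d_connected G (S \<union> {Z}) x Y"
          using d_connected_weak_transitive[OF G, of S x Z Y] n us by simp
        then have c': "d_connected G (S \<union> {Z}) Y x" using d_connected_sym by blast
        obtain t where t: "sink_in G U t" "(Z, t) \<in> G\<^sup>*" using ex_sink_below[OF G U(2)] us by blast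
        then have "t = Y \<or> t = x \<or> t \<in> S" using last us by blast
        then show False
        proof (elim disjE)
          assume "t = Y"
          then show False using d_connected_drop_below[OF G c, of "{t}"] t n by auto
        next
          assume "t = x"
          then show False using d_connected_drop_below[OF G c', of "{t}"] t n' by auto
        next
          assume "t \<in> S"
          then show False using c n t unfolding d_connected_def
            by (metis active_walk_drop_above singletonD)
        qed
      qed
    qed
  qed
  moreover have "Y \<notin> parents ?D Y" using pY ne by simp
  ultimately have "parents ?D Y = parents ?D Z - {Y}" using pY pZ by blast
  then show ?thesis using arrow by (simp add: covered_arrow_def)
qed

text \<open>\<open>triangle_step\<close> for a relation \<open>J\<close> between sets, so that it
  can be used with \<open>d_sep G\<close> and with conditional independence alike.\<close>

definition covered_step :: "nat set \<Rightarrow> (nat set \<Rightarrow> nat set \<Rightarrow> nat set \<Rightarrow> bool) \<Rightarrow> digraph \<Rightarrow> digraph \<Rightarrow> bool" where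
  "covered_step V J D E \<longleftrightarrow>
     (\<exists>i j ys. covered_arrow D i j \<and> set ys = V \<and> topological ys (reverse_arrow i j D) \<and> E = order_imap J ys) \<and>
     card E \<le> card D"

text \<open>The reversed DAG is again an independence map, so it contains the minimal independence
  map of each of its linear extensions; the bound on the number of arrows is then automatic.\<close>

lemma (in graphoid) covered_step_reverse:
  assumes xs: "distinct xs" "set xs = V" and c: "covered_arrow (order_imap J xs) i j"
    and ys: "topological ys (reverse_arrow i j (order_imap J xs))" "set ys = V"
  shows "order_imap J ys \<subseteq> reverse_arrow i j (order_imap J xs)" "card (reverse_arrow i j (order_imap J xs)) = card (order_imap J xs)"
    "independence_map V J (reverse_arrow i j (order_imap J xs))"
    "covered_step V J (order_imap J xs) (order_imap J ys)"
proof -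
  let ?D = "order_imap J xs"
  have sub: "?D \<subseteq> V \<times> V" using order_imap_subset[of J xs] xs by simp
  obtain us vs ws where rev: "reverse_arrow i j ?D \<subseteq> V \<times> V" "card (reverse_arrow i j ?D) = card ?D"
      "independence_map V (d_sep ?D) (reverse_arrow i j ?D)"
    using covered_reversal[OF topological_order_imap[OF xs(1)] xs(2) sub c] by metis
  show im: "independence_map V J (reverse_arrow i j ?D)"
    using independence_map_trans[OF rev(3)] independence_map_order_imap[OF xs] .
  show sub': "order_imap J ys \<subseteq> reverse_arrow i j ?D" using order_imap_subset_imap[OF im ys] .
  show "card (reverse_arrow i j ?D) = card ?D" using rev(2) .
  have "finite (reverse_arrow i j ?D)" using finite_subset[OF rev(1)] finite_V by simp
  then have "card (order_imap J ys) \<le> card ?D" using card_mono[OF _ sub'] rev(2) by simp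
  then show "covered_step V J ?D (order_imap J ys)"
    unfolding covered_step_def using c ys by blast
qed

text \<open>Both orders are topological for the same independence map, and its \<open>prune\<close>
  does not depend on the order.\<close>

lemma (in graphoid) order_imap_swap:
  assumes "distinct (us @ a # b # ws)" "set (us @ a # b # ws) = V" "(a, b) \<notin> order_imap J (us @ a # b # ws)"
  shows "order_imap J (us @ b # a # ws) = order_imap J (us @ a # b # ws)"
proof -
  let ?D = "order_imap J (us @ a # b # ws)"
  have im: "independence_map V J ?D" using independence_map_order_imap[OF assms(1,2)] .
  have t: "topological (us @ a # b # ws) ?D" using topological_order_imap[OF assms(1)] .
  then have t': "topological (us @ b # a # ws) ?D"
    by (rule topological_swap) (use assms(3) in \<open>simp add: parents_def\<close>)
  have V': "set (us @ b # a # ws) = V" using assms(2) by auto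
  show ?thesis
    using order_imap_eq_prune[OF im t assms(2)] order_imap_eq_prune[OF im t' V'] by simp
qed

lemma last_sink_step:
  assumes G: "acyclic G" and xs: "xs = us @ Y # Z # ws" "distinct xs" "set xs = V"
    and U: "ancestral G U" "finite U" "insert Y (insert Z (set us)) \<subseteq> U"
    and Y: "sink_in G U Y" and last: "\<And>t. sink_in G U t \<Longrightarrow> t \<in> insert Y (set us)"
  shows "(covered_step V (d_sep G))\<^sup>*\<^sup>* (order_imap (d_sep G) xs) (order_imap (d_sep G) (us @ Z # Y # ws))"
proof -
  interpret graphoid V "d_sep G" using graphoid_d_sep[OF G] xs(3) by (metis List.finite_set)
  let ?D = "order_imap (d_sep G) xs"
  show ?thesis
  proof (cases "(Y, Z) \<in> ?D")
    case False
    then show ?thesis using order_imap_swap[of us Y Z ws] xs by simp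
  next
    case True
    have c: "covered_arrow ?D Y Z" using last_sink_covered[OF G xs(1,2) U Y last True] .
    have "topological (us @ Z # Y # ws) (reverse_arrow Y Z ?D)"
      by (rule topological_reverse_arrow[OF _ c]) (use topological_order_imap[OF xs(2)] xs(1) in simp)
    moreover have "set (us @ Z # Y # ws) = V" using xs by auto
    ultimately show ?thesis using covered_step_reverse(4)[OF xs(2,3) c] by blast
  qed
qed

text \<open>\<open>U\<close> stays the same while \<open>Y\<close> moves, and the part of
  \<open>U\<close> before \<open>Y\<close> only grows, so \<open>Y\<close> remains its last
  sink.\<close>

lemma last_sink_move:
  assumes G: "acyclic G" and xs: "distinct (us @ Y # vs @ bs)" "set (us @ Y # vs @ bs) = V"
    and U: "ancestral G U" "U = set (us @ Y # vs)"
    and Y: "sink_in G U Y" and last: "\<And>t. sink_in G U t \<Longrightarrow> t \<in> insert Y (set us)"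
  shows "(covered_step V (d_sep G))\<^sup>*\<^sup>* (order_imap (d_sep G) (us @ Y # vs @ bs)) (order_imap (d_sep G) (us @ vs @ Y # bs))"
  using xs U(2) last
proof (induction vs arbitrary: us)
  case (Cons Z vs)
  have "(covered_step V (d_sep G))\<^sup>*\<^sup>* (order_imap (d_sep G) (us @ Y # Z # vs @ bs))
      (order_imap (d_sep G) (us @ Z # Y # vs @ bs))"
    by (rule last_sink_step[OF G _ _ _ U(1) _ _ Y]) (use Cons.prems in auto)
  also have "(covered_step V (d_sep G))\<^sup>*\<^sup>* (order_imap (d_sep G) (us @ Z # Y # vs @ bs))
      (order_imap (d_sep G) (us @ Z # vs @ Y # bs))"
    using Cons.IH[of "us @ [Z]"] Cons.prems by (auto simp: insert_commute)
  finally show ?case by simp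
qed simp

lemma covered_steps_to_dag:
  assumes G: "acyclic G" "G \<subseteq> V \<times> V" and xs: "distinct xs" "set xs = V"
  shows "(covered_step V (d_sep G))\<^sup>*\<^sup>* (order_imap (d_sep G) xs) G"
proof -
  \<comment> \<open>\<open>bs\<close> holds the vertices already moved to the end, with no arrow of
    \<open>G\<close> pointing from them to an earlier vertex; \<open>as\<close> is the ancestral
    rest.\<close>
  have "(covered_step V (d_sep G))\<^sup>*\<^sup>* (order_imap (d_sep G) (as @ bs)) G"
    if "distinct (as @ bs)" "set (as @ bs) = V"
      "\<And>cs b ds c. bs = cs @ b # ds \<Longrightarrow> c \<in> set as \<union> set cs \<Longrightarrow> (b, c) \<notin> G" for as bs
    using that
  proof (induction "length as" arbitrary: as bs)
    case 0
    interpret graphoid V "d_sep G" using graphoid_d_sep[OF G(1)] xs(2) by (metis List.finite_set)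
    have as: "as = []" using 0 by simp
    have t: "topological bs G"
      unfolding topological_def
    proof (intro conjI allI impI subsetI)
      fix cs y ds u assume bs: "bs = cs @ y # ds" and "u \<in> parents G y"
      then have u: "(u, y) \<in> G" "u \<in> V" using G(2) by (auto simp: parents_def)
      then have "u \<noteq> y" using acyclic_antisym[OF G(1)] by blast
      moreover have "u \<notin> set ds"
      proof
        assume "u \<in> set ds"
        then obtain es fs where "ds = es @ u # fs" using split_list by metis
        then show False using 0(4)[of "cs @ y # es" u fs y] bs u by auto
      qed
      ultimately show "u \<in> set cs" using u 0(3) as bs by auto
    qed (use 0 in simp)
    have "independence_map V (d_sep G) G" using G by (simp add: independence_map_def)
    then have "order_imap (d_sep G) bs = prune (d_sep G) G"
      using order_imap_eq_prune t 0(3) as by simp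
    \<comment> \<open>Adjacent vertices are never d-separated, so nothing is pruned.\<close>
    also have "\<dots> = G"
      using d_connected_adjacent by (auto simp: prune_def d_sep_def adjacent_def)
    finally show ?case using as by simp
  next
    case (Suc n)
    let ?U = "set as"
    have U: "ancestral G ?U"
      unfolding ancestral_def
    proof (intro ballI allI impI)
      fix v u assume v: "v \<in> ?U" "(u, v) \<in> G"
      have "u \<notin> set bs"
      proof
        assume "u \<in> set bs"
        then obtain cs ds where "bs = cs @ u # ds" using split_list by metis
        then show False using Suc.prems(3)[of cs u ds v] v by auto
      qed
      then show "u \<in> ?U" using v G(2) Suc.prems(2) by auto
    qed
    obtain z where "z \<in> ?U" using Suc.hyps(2) by (cases as) auto
    then obtain t where "sink_in G ?U t" using ex_sink_below[OF G(1), of ?U] by auto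
    then have "\<exists>t\<in>set as. sink_in G ?U t" by (auto simp: sink_in_def)
    then obtain us Y vs where as: "as = us @ Y # vs" and Y: "sink_in G ?U Y" "\<forall>z\<in>set vs. \<not> sink_in G ?U z"
      using split_list_last_prop[of as "sink_in G ?U"] by auto
    have 1: "(covered_step V (d_sep G))\<^sup>*\<^sup>* (order_imap (d_sep G) (us @ Y # vs @ bs)) (order_imap (d_sep G) (us @ vs @ Y # bs))"
      by (rule last_sink_move[OF G(1) _ _ U _ Y(1)]) (use Suc.prems as Y in \<open>auto simp: sink_in_def\<close>)
    have 2: "(covered_step V (d_sep G))\<^sup>*\<^sup>* (order_imap (d_sep G) ((us @ vs) @ Y # bs)) G"
    proof (rule Suc.hyps(1))
      show "n = length (us @ vs)" using Suc.hyps(2) as by simp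
      show "distinct ((us @ vs) @ Y # bs)" "set ((us @ vs) @ Y # bs) = V" using Suc.prems as by auto
      fix cs b ds c assume *: "Y # bs = cs @ b # ds" "c \<in> set (us @ vs) \<union> set cs"
      show "(b, c) \<notin> G"
      proof (cases cs)
        case Nil
        then show ?thesis using * Y as by (auto simp: sink_in_def)
      next
        case (Cons y cs')
        then show ?thesis using * Suc.prems(3)[of cs' b ds c] as by auto
      qed
    qed
    from 1 2 show ?case using as by (simp add: rtranclp_trans)
  qed
  from this[of xs "[]"] xs show ?thesis by simp
qed

theorem stuck_markov_equivalent:
  assumes G: "acyclic G" "G \<subseteq> V \<times> V" and xs: "distinct xs" "set xs = V"
    and stuck: "\<And>E. (covered_step V (d_sep G))\<^sup>*\<^sup>* (order_imap (d_sep G) xs) E \<Longrightarrow> card (order_imap (d_sep G) xs) \<le> card E"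
  shows "independence_map V (d_sep G) (order_imap (d_sep G) xs)"
    and "independence_map V (d_sep (order_imap (d_sep G) xs)) G"
proof -
  interpret graphoid V "d_sep G" using graphoid_d_sep[OF G(1)] xs(2) by (metis List.finite_set)
  let ?R = "order_imap (d_sep G) xs"
  show "independence_map V (d_sep G) ?R" using independence_map_order_imap[OF xs] .
  have "card E \<le> card ?R \<and> (\<exists>zs. distinct zs \<and> set zs = V \<and> E = order_imap (d_sep G) zs) \<and>
      independence_map V (d_sep ?R) E"
    if "(covered_step V (d_sep G))\<^sup>*\<^sup>* ?R E" for E
    using that
  proof (induction rule: rtranclp_induct)
    case base
    have "independence_map V (d_sep ?R) ?R"
      using acyclic_order_imap[OF xs(1)] order_imap_subset[of "d_sep G" xs] xs(2)
      by (simp add: independence_map_def)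
    then show ?case using xs by blast
  next
    case (step E F)
    then obtain zs where zs: "distinct zs" "set zs = V" "E = order_imap (d_sep G) zs" by blast
    obtain i j ys where c: "covered_arrow E i j" and ys: "set ys = V" "topological ys (reverse_arrow i j E)"
      and F: "F = order_imap (d_sep G) ys" and card: "card F \<le> card E"
      using step.hyps(2) by (auto simp: covered_step_def)
    have E: "E \<subseteq> V \<times> V" using order_imap_subset[of "d_sep G" zs] zs by simp
    have t: "topological zs E" using topological_order_imap[OF zs(1)] zs(3) by simp
    have rev: "reverse_arrow i j E \<subseteq> V \<times> V" "card (reverse_arrow i j E) = card E"
      "independence_map V (d_sep E) (reverse_arrow i j E)"
      using covered_reversal[OF t zs(2) E c] by metis+
    \<comment> \<open>\<open>F\<close> is contained in the reversal of \<open>E\<close>; since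
      nothing sparser than \<open>?R\<close> is reachable, it has as many arrows and equals
      it.\<close>
    have "F \<subseteq> reverse_arrow i j E" using covered_step_reverse(1)[of zs i j ys] zs c ys F by simp
    moreover have "card ?R \<le> card F" using stuck step.hyps by (meson rtranclp.rtrancl_into_rtrancl)
    then have "card F = card (reverse_arrow i j E)" using card step.IH rev(2) by simp
    moreover have "finite (reverse_arrow i j E)" using finite_subset[OF rev(1)] finite_V by simp
    ultimately have "F = reverse_arrow i j E" by (metis card_subset_eq)
    then have "independence_map V (d_sep ?R) F"
      using rev(3) step.IH independence_map_trans by blast
    moreover have "distinct ys" using ys by (simp add: topological_def)
    ultimately show ?case using card step.IH ys F by auto
  qed
  then show "independence_map V (d_sep ?R) G" using covered_steps_to_dag[OF G xs] by blast
qed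

section \<open>Conditional independence is a semigraphoid\<close>

locale joint_dist =
  fixes p :: nat and M :: "nat \<Rightarrow> 'a measure" and P :: "(nat \<Rightarrow> 'a) measure"
  assumes joint_distribution: "joint_distribution p M P"
begin

sublocale prob_space P
  using joint_distribution by (simp add: joint_distribution_def)

abbreviation subalg :: "nat set \<Rightarrow> (nat \<Rightarrow> 'a) measure" where
  "subalg A \<equiv> subvector_algebra M P A"

lemma sets_P: "sets P = sets (Pi\<^sub>M {1..p} M)"
  using joint_distribution by (simp add: joint_distribution_def)

lemma space_P: "space P = (\<Pi>\<^sub>E i\<in>{1..p}. space (M i))"
  using sets_eq_imp_space_eq[OF sets_P] by (simp add: space_PiM)

lemma space_subalg [simp]: "space (subalg A) = space P"
  by (simp add: subvector_algebra_def)

lemma restrict_space: "A \<subseteq> {1..p} \<Longrightarrow> (\<lambda>\<omega>. restrict \<omega> A) \<in> space P \<rightarrow> space (Pi\<^sub>M A M)"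
  by (auto simp: space_P space_PiM PiE_def Pi_def)

lemma sets_subalg:
  "A \<subseteq> {1..p} \<Longrightarrow> sets (subalg A) = {(\<lambda>\<omega>. restrict \<omega> A) -` X \<inter> space P | X. X \<in> sets (Pi\<^sub>M A M)}"
  unfolding subvector_algebra_def by (rule sets_vimage_algebra2) (rule restrict_space)

text \<open>A random vector is measurable as soon as its coordinates are.\<close>

lemma sets_subalg_subset:
  assumes "space N = space P" "A \<subseteq> {1..p}"
    and "\<And>i X. i \<in> A \<Longrightarrow> X \<in> sets (M i) \<Longrightarrow> {\<omega> \<in> space P. \<omega> i \<in> X} \<in> sets N"
  shows "sets (subalg A) \<subseteq> sets N"
proof -
  have "(\<lambda>\<omega>. \<omega> i) \<in> measurable N (M i)" if "i \<in> A" for i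
    using that assms by (intro measurableI) (auto simp: space_P Int_def vimage_def conj_commute)
  then have "(\<lambda>\<omega>. restrict \<omega> A) \<in> measurable N (Pi\<^sub>M A M)"
    by (intro measurable_restrict)
  then show ?thesis using assms(1) by (auto simp: sets_subalg[OF assms(2)] dest: measurable_sets)
qed

lemma coordinate_in_subalg:
  assumes "A \<subseteq> {1..p}" "i \<in> A" "X \<in> sets (M i)"
  shows "{\<omega> \<in> space P. \<omega> i \<in> X} \<in> sets (subalg A)"
proof -
  have "(\<lambda>x. x i) -` X \<inter> space (Pi\<^sub>M A M) \<in> sets (Pi\<^sub>M A M)" (is "?Y \<in> _")
    using assms by (intro measurable_sets[OF measurable_component_singleton])
  moreover have "(\<lambda>\<omega>. restrict \<omega> A) -` ?Y \<inter> space P = {\<omega> \<in> space P. \<omega> i \<in> X}"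
    using assms restrict_space[OF assms(1)] by auto
  ultimately show ?thesis unfolding sets_subalg[OF assms(1)] by blast
qed

lemma subalgebra_mono:
  assumes "A \<subseteq> B" "B \<subseteq> {1..p}"
  shows "subalgebra (subalg B) (subalg A)"
  unfolding subalgebra_def
proof
  show "sets (subalg A) \<subseteq> sets (subalg B)"
    by (rule sets_subalg_subset) (use assms in \<open>auto intro!: coordinate_in_subalg\<close>)
qed simp

lemma subalgebra_subalg:
  assumes "A \<subseteq> {1..p}"
  shows "subalgebra P (subalg A)"
proof -
  have "{\<omega> \<in> space P. \<omega> i \<in> X} \<in> sets P" if "i \<in> {1..p}" "X \<in> sets (M i)" for i X
  proof -
    have "(\<lambda>x. x i) -` X \<inter> space (Pi\<^sub>M {1..p} M) \<in> sets (Pi\<^sub>M {1..p} M)"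
      using that by (intro measurable_sets[OF measurable_component_singleton])
    then show ?thesis
      by (simp add: sets_P sets_eq_imp_space_eq[OF sets_P] Int_def vimage_def conj_commute)
  qed
  then have "sets (subalg A) \<subseteq> sets P"
    using assms by (intro sets_subalg_subset) auto
  then show ?thesis by (simp add: subalgebra_def)
qed

lemma finite_measure_subalgebra: "A \<subseteq> {1..p} \<Longrightarrow> finite_measure_subalgebra P (subalg A)"
  by unfold_locales (rule subalgebra_subalg)

text \<open>Provides the intersection-stable generator for the Dynkin argument in
  \<open>AE_cond_exp_if_cond_indep\<close>.\<close>

lemma sets_subalg_Un:
  assumes "A \<subseteq> {1..p}" "B \<subseteq> {1..p}"
  shows "sets (subalg (A \<union> B)) =
    sigma_sets (space P) {X \<inter> Y | X Y. X \<in> sets (subalg A) \<and> Y \<in> sets (subalg B)}"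
    (is "_ = sigma_sets _ ?G")
proof
  have G: "?G \<subseteq> Pow (space P)" using sets.sets_into_space by fastforce
  show "sets (subalg (A \<union> B)) \<subseteq> sigma_sets (space P) ?G"
  proof -
    have "sets (subalg (A \<union> B)) \<subseteq> sets (sigma (space P) ?G)"
    proof (rule sets_subalg_subset)
      fix i X assume iX: "i \<in> A \<union> B" "X \<in> sets (M i)"
      have "space P \<in> sets (subalg A)" "space P \<in> sets (subalg B)"
        using sets.top[of "subalg A"] sets.top[of "subalg B"] by simp_all
      moreover have "{\<omega> \<in> space P. \<omega> i \<in> X} = {\<omega> \<in> space P. \<omega> i \<in> X} \<inter> space P"
        "{\<omega> \<in> space P. \<omega> i \<in> X} = space P \<inter> {\<omega> \<in> space P. \<omega> i \<in> X}" by auto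
      ultimately have "{\<omega> \<in> space P. \<omega> i \<in> X} \<in> ?G"
        using iX coordinate_in_subalg[OF assms(1), of i X] coordinate_in_subalg[OF assms(2), of i X] by blast
      then show "{\<omega> \<in> space P. \<omega> i \<in> X} \<in> sets (sigma (space P) ?G)"
        using G by (simp add: sets_measure_of sigma_sets.Basic)
    qed (use G assms in \<open>auto simp: space_measure_of\<close>)
    then show ?thesis using G by (simp add: sets_measure_of)
  qed
  have "sets (subalg A) \<subseteq> sets (subalg (A \<union> B))" "sets (subalg B) \<subseteq> sets (subalg (A \<union> B))"
    using subalgebra_mono[of A "A \<union> B"] subalgebra_mono[of B "A \<union> B"] assms by (auto simp: subalgebra_def)
  then have "?G \<subseteq> sets (subalg (A \<union> B))" by blast
  then show "sigma_sets (space P) ?G \<subseteq> sets (subalg (A \<union> B))"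
    using sets.sigma_sets_subset[of ?G "subalg (A \<union> B)"] by simp
qed

lemma integrable_cond_exp_indicator:
  assumes "A \<subseteq> {1..p}" "E \<in> sets P"
  shows "integrable P (real_cond_exp P (subalg A) (indicator E))"
proof -
  interpret FA: finite_measure_subalgebra P "subalg A" using finite_measure_subalgebra[OF assms(1)] .
  show ?thesis by (rule FA.real_cond_exp_int) (use assms in \<open>auto simp: emeasure_eq_measure\<close>)
qed

lemma sets_subalg_P: "A \<subseteq> {1..p} \<Longrightarrow> E \<in> sets (subalg A) \<Longrightarrow> E \<in> sets P"
  using subalgebra_subalg by (auto simp: subalgebra_def)

lemma integrable_indicator_P: "E \<in> sets P \<Longrightarrow> integrable P (indicator E :: _ \<Rightarrow> real)"
  by (auto simp: emeasure_eq_measure)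

text \<open>This asymmetric form turns weak union and contraction into statements about nested
  conditional expectations. Both sides have the same integrals over a generator, hence over all of
  \<open>subalg (B \<union> C)\<close>.\<close>

lemma AE_cond_exp_if_cond_indep:
  assumes sub: "A \<subseteq> {1..p}" "B \<subseteq> {1..p}" "C \<subseteq> {1..p}" and ci: "cond_indep M P A B C"
    and E: "E \<in> sets (subalg A)"
  shows "AE \<omega> in P. real_cond_exp P (subalg (B \<union> C)) (indicator E) \<omega> = real_cond_exp P (subalg C) (indicator E) \<omega>"
proof -
  interpret FC: finite_measure_subalgebra P "subalg C" by (rule finite_measure_subalgebra) (use sub in simp)
  interpret FBC: finite_measure_subalgebra P "subalg (B \<union> C)" by (rule finite_measure_subalgebra) (use sub in simp)
  let ?e = "indicator E :: _ \<Rightarrow> real"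
  let ?g = "real_cond_exp P (subalg C) ?e"
  have EP: "E \<in> sets P" using sets_subalg_P[OF sub(1) E] .
  note ie = integrable_indicator_P[OF EP]
  have ig: "integrable P ?g" by (rule integrable_cond_exp_indicator) (use sub EP in simp_all)
  \<comment> \<open>The product formula handles \<open>F\<close>, and \<open>K\<close> belongs to
    the algebra on which one conditions.\<close>
  have base: "(\<integral>x\<in>F \<inter> K. ?e x \<partial>P) = (\<integral>x\<in>F \<inter> K. ?g x \<partial>P)"
    if F: "F \<in> sets (subalg B)" and K: "K \<in> sets (subalg C)" for F K
  proof -
    have FP[measurable]: "F \<in> sets P" "K \<in> sets P"
      using sets_subalg_P[OF sub(2) F] sets_subalg_P[OF sub(3) K] .
    have int: "integrable P (\<lambda>x. ?g x * indicator F x)"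
      using integrable_real_mult_indicator[OF FP(1) ig] .
    have "AE x in P. real_cond_exp P (subalg C) (\<lambda>x. ?g x * indicator F x) x =
        ?g x * real_cond_exp P (subalg C) (indicator F) x"
      by (rule FC.real_cond_exp_mult) (use int FP in auto)
    moreover have "AE x in P. real_cond_exp P (subalg C) (indicator (E \<inter> F)) x =
        ?g x * real_cond_exp P (subalg C) (indicator F) x"
      using ci E F by (auto simp: cond_indep_def)
    ultimately have ae: "AE x in P. real_cond_exp P (subalg C) (\<lambda>x. ?g x * indicator F x) x =
        real_cond_exp P (subalg C) (indicator (E \<inter> F)) x" by eventually_elim simp
    have "(\<integral>x\<in>F \<inter> K. ?g x \<partial>P) = (\<integral>x\<in>K. ?g x * indicator F x \<partial>P)"
      unfolding set_lebesgue_integral_def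
      by (rule Bochner_Integration.integral_cong) (auto simp: indicator_def)
    also have "\<dots> = (\<integral>x\<in>K. real_cond_exp P (subalg C) (\<lambda>x. ?g x * indicator F x) x \<partial>P)"
      by (rule FC.real_cond_exp_intA[OF int K])
    also have "\<dots> = (\<integral>x\<in>K. real_cond_exp P (subalg C) (indicator (E \<inter> F)) x \<partial>P)"
      unfolding set_lebesgue_integral_def
      by (rule integral_cong_AE) (use ae in \<open>auto simp: borel_measurable_cond_exp2\<close>)
    also have "\<dots> = (\<integral>x\<in>K. indicator (E \<inter> F) x \<partial>P)"
      by (rule FC.real_cond_exp_intA[symmetric, OF _ K]) (use EP FP in \<open>auto simp: emeasure_eq_measure\<close>)
    also have "\<dots> = (\<integral>x\<in>F \<inter> K. ?e x \<partial>P)"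
      unfolding set_lebesgue_integral_def
      by (rule Bochner_Integration.integral_cong) (auto simp: indicator_def)
    finally show ?thesis by simp
  qed
  let ?G = "{X \<inter> Y | X Y. X \<in> sets (subalg B) \<and> Y \<in> sets (subalg C)}"
  have setint: "set_integrable P H ?e" "set_integrable P H ?g" if "H \<in> sets P" for H
    unfolding set_integrable_def
    using integrable_mult_indicator[OF that ie] integrable_mult_indicator[OF that ig] by auto
  have gen: "sets (subalg (B \<union> C)) = sigma_sets (space P) ?G" by (rule sets_subalg_Un) (use sub in simp_all)
  have inP: "H \<in> sets P" if "H \<in> sigma_sets (space P) ?G" for H
    using that gen sets_subalg_P[of "B \<union> C" H] sub by blast
  have stable: "Int_stable ?G"
  proof (rule Int_stableI)
    fix a b assume "a \<in> ?G" "b \<in> ?G"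
    then obtain X Y X' Y' where *: "a = X \<inter> Y" "b = X' \<inter> Y'" "X \<in> sets (subalg B)" "X' \<in> sets (subalg B)"
      "Y \<in> sets (subalg C)" "Y' \<in> sets (subalg C)" by blast
    then have "a \<inter> b = (X \<inter> X') \<inter> (Y \<inter> Y')" "X \<inter> X' \<in> sets (subalg B)" "Y \<inter> Y' \<in> sets (subalg C)" by auto
    then show "a \<inter> b \<in> ?G" by blast
  qed
  have pow: "?G \<subseteq> Pow (space P)" using sets.sets_into_space by fastforce
  have eq: "(\<integral>x\<in>H. ?e x \<partial>P) = (\<integral>x\<in>H. ?g x \<partial>P)" if "H \<in> sets (subalg (B \<union> C))" for H
    using stable pow that[unfolded gen]
  proof (induction rule: sigma_sets_induct_disjoint)
    case (basic H)
    then show ?case using base by blast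
  next
    case empty
    then show ?case by (simp add: set_lebesgue_integral_def)
  next
    case (compl H)
    have HP: "H \<in> sets P" using inP compl by blast
    have "space P \<in> sets (subalg B)" "space P \<in> sets (subalg C)"
      using sets.top[of "subalg B"] sets.top[of "subalg C"] by simp_all
    then have top: "(\<integral>x\<in>space P. ?e x \<partial>P) = (\<integral>x\<in>space P. ?g x \<partial>P)"
      using base[of "space P" "space P"] by simp
    have *: "(\<integral>x\<in>space P - H. f x \<partial>P) = (\<integral>x\<in>space P. f x \<partial>P) - (\<integral>x\<in>H. f x \<partial>P)"
      if "\<And>X. X \<in> sets P \<Longrightarrow> set_integrable P X f" for f :: "_ \<Rightarrow> real"
    proof -
      have "(\<integral>x\<in>(space P - H) \<union> H. f x \<partial>P) = (\<integral>x\<in>space P - H. f x \<partial>P) + (\<integral>x\<in>H. f x \<partial>P)"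
        by (rule set_integral_Un) (use that HP in auto)
      moreover have "(space P - H) \<union> H = space P" using sets.sets_into_space[OF HP] by auto
      ultimately show ?thesis by simp
    qed
    show ?case using *[of ?e] *[of ?g] setint top compl by simp
  next
    case (union H)
    have HP: "H i \<in> sets P" for i using inP union by blast
    have "(\<integral>x\<in>(\<Union>i. H i). ?e x \<partial>P) = (\<Sum>i. \<integral>x\<in>H i. ?e x \<partial>P)"
      by (rule lebesgue_integral_countable_add) (use union HP setint in \<open>auto simp: disjoint_family_on_def\<close>)
    moreover have "(\<integral>x\<in>(\<Union>i. H i). ?g x \<partial>P) = (\<Sum>i. \<integral>x\<in>H i. ?g x \<partial>P)"
      by (rule lebesgue_integral_countable_add) (use union HP setint in \<open>auto simp: disjoint_family_on_def\<close>)
    ultimately show ?case using union by simp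
  qed
  show ?thesis
  proof (rule FBC.real_cond_exp_charact[OF eq ie ig])
    show "?g \<in> borel_measurable (subalg (B \<union> C))"
      by (rule measurable_from_subalg[OF subalgebra_mono[of C]]) (use sub in auto)
  qed
qed

text \<open>Take the indicator of \<open>F\<close> out of the conditional expectation given
  \<open>B \<union> C\<close>, replace the conditional probability of \<open>E\<close> by the one
  given \<open>C\<close>, then project to \<open>C\<close> with the tower property.\<close>

lemma cond_indep_if_AE_cond_exp:
  assumes sub: "A \<subseteq> {1..p}" "B \<subseteq> {1..p}" "C \<subseteq> {1..p}"
    and ae: "\<And>E. E \<in> sets (subalg A) \<Longrightarrow>
      AE \<omega> in P. real_cond_exp P (subalg (B \<union> C)) (indicator E) \<omega> = real_cond_exp P (subalg C) (indicator E) \<omega>"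
  shows "cond_indep M P A B C"
  unfolding cond_indep_def
proof (intro ballI)
  fix E F assume E: "E \<in> sets (subalg A)" and F: "F \<in> sets (subalg B)"
  interpret FC: finite_measure_subalgebra P "subalg C" by (rule finite_measure_subalgebra) (use sub in simp)
  interpret FBC: finite_measure_subalgebra P "subalg (B \<union> C)" by (rule finite_measure_subalgebra) (use sub in simp)
  let ?e = "indicator E :: _ \<Rightarrow> real" and ?f = "indicator F :: _ \<Rightarrow> real"
  let ?g = "real_cond_exp P (subalg C) ?e" and ?h = "real_cond_exp P (subalg (B \<union> C)) ?e"
  have EP[measurable]: "E \<in> sets P" "F \<in> sets P"
    using sets_subalg_P[OF sub(1) E] sets_subalg_P[OF sub(2) F] .
  have FBC: "F \<in> sets (subalg (B \<union> C))" using subalgebra_mono[of B "B \<union> C"] sub F by (auto simp: subalgebra_def)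
  have mf: "?f \<in> borel_measurable (subalg (B \<union> C))" using FBC by simp
  have ig: "integrable P ?g" "integrable P ?h" by (rule integrable_cond_exp_indicator; use sub EP in simp)+
  have ief: "integrable P (\<lambda>x. ?f x * ?e x)"
    using integrable_mult_indicator[OF EP(2) integrable_indicator_P[OF EP(1)]] by simp
  have 1: "AE x in P. real_cond_exp P (subalg (B \<union> C)) (\<lambda>x. ?f x * ?e x) x = ?f x * ?h x"
    by (rule FBC.real_cond_exp_mult[OF mf _ ief]) simp
  have 2: "AE x in P. real_cond_exp P (subalg (B \<union> C)) (\<lambda>x. ?f x * ?e x) x = ?g x * ?f x"
    using 1 ae[OF E] by eventually_elim simp
  have igf: "integrable P (\<lambda>x. ?g x * ?f x)" using integrable_real_mult_indicator[OF EP(2) ig(1)] .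
  have 3: "AE x in P. real_cond_exp P (subalg C) (real_cond_exp P (subalg (B \<union> C)) (\<lambda>x. ?f x * ?e x)) x =
      real_cond_exp P (subalg C) (\<lambda>x. ?f x * ?e x) x"
    by (rule FC.real_cond_exp_nested_subalg[OF subalgebra_subalg subalgebra_mono ief]) (use sub in auto)
  have 4: "AE x in P. real_cond_exp P (subalg C) (real_cond_exp P (subalg (B \<union> C)) (\<lambda>x. ?f x * ?e x)) x =
      real_cond_exp P (subalg C) (\<lambda>x. ?g x * ?f x) x"
    by (rule FC.real_cond_exp_cong[OF 2]) auto
  have 5: "AE x in P. real_cond_exp P (subalg C) (\<lambda>x. ?g x * ?f x) x =
      ?g x * real_cond_exp P (subalg C) ?f x"
    by (rule FC.real_cond_exp_mult) (use igf in auto)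
  have eq: "(\<lambda>x. ?f x * ?e x) = indicator (E \<inter> F)" by (auto simp: indicator_def fun_eq_iff)
  show "AE \<omega> in P. real_cond_exp P (subalg C) (indicator (E \<inter> F)) \<omega> =
      ?g \<omega> * real_cond_exp P (subalg C) ?f \<omega>"
    using 3[unfolded eq] 4[unfolded eq] 5 by eventually_elim simp
qed

lemma cond_indep_sym:
  assumes "cond_indep M P A B C"
  shows "cond_indep M P B A C"
  unfolding cond_indep_def
proof (intro ballI)
  fix E F assume "E \<in> sets (subalg B)" "F \<in> sets (subalg A)"
  then have "AE \<omega> in P. real_cond_exp P (subalg C) (indicator (F \<inter> E)) \<omega> =
      real_cond_exp P (subalg C) (indicator F) \<omega> * real_cond_exp P (subalg C) (indicator E) \<omega>"
    using assms by (auto simp: cond_indep_def)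
  then show "AE \<omega> in P. real_cond_exp P (subalg C) (indicator (E \<inter> F)) \<omega> =
      real_cond_exp P (subalg C) (indicator E) \<omega> * real_cond_exp P (subalg C) (indicator F) \<omega>"
    by eventually_elim (simp add: Int_commute mult.commute)
qed

lemma cond_indep_decomposition:
  assumes "B \<subseteq> B'" "B' \<subseteq> {1..p}" "cond_indep M P A B' C"
  shows "cond_indep M P A B C"
  using assms subalgebra_mono[OF assms(1,2)] unfolding cond_indep_def subalgebra_def by blast

lemma cond_indep_empty:
  assumes "A \<subseteq> {1..p}" "C \<subseteq> {1..p}"
  shows "cond_indep M P A {} C"
  by (rule cond_indep_if_AE_cond_exp) (use assms in auto)

text \<open>Conditional probabilities given \<open>B \<union> C \<union> D\<close> equal those given
  \<open>C\<close>; projecting this equation to \<open>C \<union> D\<close> shows that those given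
  \<open>C \<union> D\<close> do so too.\<close>

lemma cond_indep_weak_union:
  assumes sub: "A \<subseteq> {1..p}" "B \<subseteq> {1..p}" "C \<subseteq> {1..p}" "D \<subseteq> {1..p}"
    and ci: "cond_indep M P A (B \<union> D) C"
  shows "cond_indep M P A B (C \<union> D)"
proof (rule cond_indep_if_AE_cond_exp)
  fix E assume E: "E \<in> sets (subalg A)"
  have EP: "E \<in> sets P" using sets_subalg_P[OF sub(1) E] .
  interpret F: finite_measure_subalgebra P "subalg (C \<union> D)" by (rule finite_measure_subalgebra) (use sub in simp)
  let ?e = "indicator E :: _ \<Rightarrow> real"
  note ie = integrable_indicator_P[OF EP]
  have 1: "AE \<omega> in P. real_cond_exp P (subalg (B \<union> (C \<union> D))) ?e \<omega> = real_cond_exp P (subalg C) ?e \<omega>"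
    using AE_cond_exp_if_cond_indep[OF _ _ _ ci E] sub by (simp add: Un_ac)
  have 2: "AE \<omega> in P. real_cond_exp P (subalg (C \<union> D)) (real_cond_exp P (subalg (B \<union> (C \<union> D))) ?e) \<omega>
      = real_cond_exp P (subalg (C \<union> D)) ?e \<omega>"
    by (rule F.real_cond_exp_nested_subalg[OF subalgebra_subalg subalgebra_mono ie]) (use sub in auto)
  have 3: "AE \<omega> in P. real_cond_exp P (subalg (C \<union> D)) (real_cond_exp P (subalg (B \<union> (C \<union> D))) ?e) \<omega>
      = real_cond_exp P (subalg (C \<union> D)) (real_cond_exp P (subalg C) ?e) \<omega>"
    by (rule F.real_cond_exp_cong[OF 1]) auto
  have 4: "AE \<omega> in P. real_cond_exp P (subalg (C \<union> D)) (real_cond_exp P (subalg C) ?e) \<omega>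
      = real_cond_exp P (subalg C) ?e \<omega>"
  proof (rule F.real_cond_exp_F_meas)
    show "real_cond_exp P (subalg C) ?e \<in> borel_measurable (subalg (C \<union> D))"
      by (rule measurable_from_subalg[OF subalgebra_mono[of C]]) (use sub in auto)
  qed (rule integrable_cond_exp_indicator, use sub EP in simp_all)
  show "AE \<omega> in P. real_cond_exp P (subalg (B \<union> (C \<union> D))) ?e \<omega> = real_cond_exp P (subalg (C \<union> D)) ?e \<omega>"
    using 1 2 3 4 by eventually_elim simp
qed (use sub in auto)

text \<open>In the asymmetric form this is transitivity of equality.\<close>

lemma cond_indep_contraction:
  assumes sub: "A \<subseteq> {1..p}" "B \<subseteq> {1..p}" "C \<subseteq> {1..p}" "D \<subseteq> {1..p}"
    and ci: "cond_indep M P A B C" "cond_indep M P A D (C \<union> B)"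
  shows "cond_indep M P A (B \<union> D) C"
proof (rule cond_indep_if_AE_cond_exp)
  fix E assume E: "E \<in> sets (subalg A)"
  have "AE \<omega> in P. real_cond_exp P (subalg (B \<union> C)) (indicator E) \<omega> = real_cond_exp P (subalg C) (indicator E) \<omega>"
    using AE_cond_exp_if_cond_indep[OF _ _ _ ci(1) E] sub by simp
  moreover have "AE \<omega> in P. real_cond_exp P (subalg (B \<union> D \<union> C)) (indicator E) \<omega> =
      real_cond_exp P (subalg (B \<union> C)) (indicator E) \<omega>"
    using AE_cond_exp_if_cond_indep[OF _ _ _ ci(2) E] sub by (simp add: Un_ac)
  ultimately show "AE \<omega> in P. real_cond_exp P (subalg (B \<union> D \<union> C)) (indicator E) \<omega> =
      real_cond_exp P (subalg C) (indicator E) \<omega>" by eventually_elim simp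
qed (use sub in auto)

end

section \<open>The three implications\<close>

definition perm_list :: "nat \<Rightarrow> (nat \<Rightarrow> nat) \<Rightarrow> nat list" where
  "perm_list p \<pi> = map \<pi> [1..<Suc p]"

lemma length_perm_list [simp]: "length (perm_list p \<pi>) = p"
  by (simp add: perm_list_def)

lemma nth_perm_list: "k < p \<Longrightarrow> perm_list p \<pi> ! k = \<pi> (Suc k)"
  by (simp add: perm_list_def del: upt_Suc)

lemma perm_list_permutes:
  assumes "\<pi> permutes {1..p}"
  shows "distinct (perm_list p \<pi>)" "set (perm_list p \<pi>) = {1..p}"
proof -
  show "distinct (perm_list p \<pi>)"
    using permutes_inj_on[OF assms] by (simp add: perm_list_def distinct_map del: upt_Suc)
  show "set (perm_list p \<pi>) = {1..p}"
    using permutes_image[OF assms] by (simp add: perm_list_def atLeastLessThanSuc_atLeastAtMost del: upt_Suc)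
qed

lemma ex_perm_list:
  assumes "distinct xs" "set xs = {1..p}"
  obtains \<pi> where "\<pi> permutes {1..p}" "perm_list p \<pi> = xs"
proof -
  have len: "length xs = p" using distinct_card[OF assms(1)] assms(2) by simp
  define \<pi> where "\<pi> i = (if i \<in> {1..p} then xs ! (i - 1) else i)" for i
  have "bij_betw (\<lambda>i. i - 1) {1..p} {..<p}"
    by (rule bij_betw_byWitness[where f' = Suc]) auto
  moreover have "bij_betw ((!) xs) {..<p} {1..p}" using bij_betw_nth[of xs] assms len by simp
  ultimately have "bij_betw (\<lambda>i. xs ! (i - 1)) {1..p} {1..p}"
    using bij_betw_trans by (fastforce simp: comp_def)
  then have "bij_betw \<pi> {1..p} {1..p}"
    by (rule bij_betw_cong[THEN iffD1, rotated]) (auto simp: \<pi>_def)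
  then have "\<pi> permutes {1..p}" by (rule bij_imp_permutes) (auto simp: \<pi>_def)
  moreover have "perm_list p \<pi> = xs"
    by (rule nth_equalityI) (auto simp: len nth_perm_list \<pi>_def)
  ultimately show thesis using that by blast
qed

lemma perm_list_split:
  assumes "\<pi> permutes {1..p}" "perm_list p \<pi> = us @ y # ws"
  shows "Suc (length us) \<le> p" "\<pi> (Suc (length us)) = y" "\<pi> ` {1..length us} = set us"
proof -
  have len: "length us + Suc (length ws) = p"
    using arg_cong[OF assms(2), of length] by simp
  show "Suc (length us) \<le> p" using len by simp
  show "\<pi> (Suc (length us)) = y"
    using nth_perm_list[of "length us" p \<pi>] assms(2) len by simp
  have "us = take (length us) (perm_list p \<pi>)" using assms(2) by simp
  also have "\<dots> = map \<pi> [1..<Suc (length us)]"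
    using len by (simp add: perm_list_def take_map del: upt_Suc)
  finally show "\<pi> ` {1..length us} = set us"
    by (metis set_map set_upt atLeastLessThanSuc_atLeastAtMost)
qed

lemma perm_list_split_at:
  assumes "1 \<le> j" "j \<le> p"
  shows "perm_list p \<pi> = map \<pi> [1..<j] @ \<pi> j # map \<pi> [Suc j..<Suc p]"
proof -
  have "[1..<Suc p] = [1..<j] @ j # [Suc j..<Suc p]"
    using upt_add_eq_append[of 1 j "Suc p - j"] upt_conv_Cons[of j "Suc p"] assms by (simp del: upt_Suc)
  then show ?thesis by (simp add: perm_list_def del: upt_Suc)
qed

text \<open>The same \<open>C\<close> may represent two relations: \<open>ci_relations p M P\<close>
  always represents conditional independence, and under faithfulness it represents
  \<open>d_sep G\<close> as well.\<close>

definition represents :: "nat set \<Rightarrow> ci_set \<Rightarrow> (nat set \<Rightarrow> nat set \<Rightarrow> nat set \<Rightarrow> bool) \<Rightarrow> bool" where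
  "represents V C J \<longleftrightarrow>
     (\<forall>x\<in>V. \<forall>y\<in>V. \<forall>S. x \<noteq> y \<longrightarrow> S \<subseteq> V - {x, y} \<longrightarrow> ((x, y, S) \<in> C \<longleftrightarrow> J {x} {y} S))"

lemma representsD:
  "represents V C J \<Longrightarrow> x \<in> V \<Longrightarrow> y \<in> V \<Longrightarrow> x \<noteq> y \<Longrightarrow> S \<subseteq> V - {x, y} \<Longrightarrow> (x, y, S) \<in> C \<longleftrightarrow> J {x} {y} S"
  by (simp add: represents_def)

lemma min_imap_eq_order_imap:
  assumes \<pi>: "\<pi> permutes {1..p}" and C: "represents {1..p} C J"
  shows "min_imap p C \<pi> = order_imap J (perm_list p \<pi>)"
proof -
  let ?xs = "perm_list p \<pi>"
  have iff: "(\<pi> i, y, \<pi> ` {1..j} - {\<pi> i, y}) \<in> C \<longleftrightarrow> J {\<pi> i} {y} (set us - {\<pi> i})"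
    if split: "?xs = us @ y # ws" and ij: "1 \<le> i" "i < j" "j = Suc (length us)" for us y ws i j
  proof -
    note s = perm_list_split[OF \<pi> split]
    have d: "y \<notin> set us" "insert y (set us) \<subseteq> {1..p}"
      using perm_list_permutes[OF \<pi>] split by auto
    have "\<pi> ` {1..j} = insert y (set us)" using s ij(3) by (simp add: atLeastAtMostSuc_conv)
    then have "\<pi> ` {1..j} - {\<pi> i, y} = set us - {\<pi> i}" using d by auto
    moreover have "\<pi> i \<in> set us" using s(3) ij by auto
    moreover from this have "\<pi> i \<in> {1..p}" "y \<in> {1..p}" "\<pi> i \<noteq> y" "set us - {\<pi> i} \<subseteq> {1..p} - {\<pi> i, y}"
      using d by auto
    ultimately show ?thesis using C unfolding represents_def by metis
  qed
  show ?thesis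
  proof (rule set_eqI, rule iffI)
    fix e assume "e \<in> min_imap p C \<pi>"
    then obtain i j where ij: "e = (\<pi> i, \<pi> j)" "1 \<le> i" "i < j" "j \<le> p"
      "(\<pi> i, \<pi> j, \<pi> ` {1..j} - {\<pi> i, \<pi> j}) \<notin> C" by (auto simp: min_imap_def)
    have split: "?xs = map \<pi> [1..<j] @ \<pi> j # map \<pi> [Suc j..<Suc p]" by (rule perm_list_split_at) (use ij in simp_all)
    then show "e \<in> order_imap J ?xs"
      unfolding order_imap_def using iff[OF split, of i j] ij by auto
  next
    fix e assume "e \<in> order_imap J ?xs"
    then obtain x y us ws where e: "e = (x, y)" "?xs = us @ y # ws" "x \<in> set us" "\<not> J {x} {y} (set us - {x})"
      by (auto simp: order_imap_def)
    note s = perm_list_split[OF \<pi> e(2)]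
    have "x \<in> \<pi> ` {1..length us}" using e(3) s(3) by simp
    then obtain i where i: "1 \<le> i" "i \<le> length us" "x = \<pi> i" by auto
    have "(\<pi> i, y, \<pi> ` {1..Suc (length us)} - {\<pi> i, y}) \<notin> C"
      using iff[OF e(2), of i "Suc (length us)"] i e by simp
    then show "e \<in> min_imap p C \<pi>"
      unfolding min_imap_def using s i e(1)
      by (intro CollectI exI[of _ i] exI[of _ "Suc (length us)"]) auto
  qed
qed

lemma linear_extension_iff_topological:
  assumes \<pi>: "\<pi> permutes {1..p}" and G: "G \<subseteq> {1..p} \<times> {1..p}"
  shows "linear_extension p \<pi> G \<longleftrightarrow> topological (perm_list p \<pi>) G"
proof
  assume l: "linear_extension p \<pi> G"
  show "topological (perm_list p \<pi>) G"
    unfolding topological_def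
  proof (intro conjI allI impI subsetI)
    fix us y ws x assume split: "perm_list p \<pi> = us @ y # ws" and "x \<in> parents G y"
    then have x: "(x, y) \<in> G" "x \<in> {1..p}" using G by (auto simp: parents_def)
    note s = perm_list_split[OF \<pi> split]
    have "inv \<pi> x < inv \<pi> y" using l x by (auto simp: linear_extension_def)
    also have "inv \<pi> y = Suc (length us)" using s(2) permutes_inverses(2)[OF \<pi>] by auto
    finally have "inv \<pi> x \<le> length us" by simp
    moreover have "inv \<pi> x \<in> {1..p}" using permutes_in_image[OF permutes_inv[OF \<pi>]] x by blast
    ultimately have "\<pi> (inv \<pi> x) \<in> \<pi> ` {1..length us}" by auto
    then show "x \<in> set us" using s(3) permutes_inverses(1)[OF \<pi>] by simp
  qed (rule perm_list_permutes[OF \<pi>])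
next
  assume t: "topological (perm_list p \<pi>) G"
  have "inv \<pi> x < inv \<pi> y" if "(x, y) \<in> G" for x y
  proof -
    have "y \<in> set (perm_list p \<pi>)" using that G perm_list_permutes[OF \<pi>] by auto
    then obtain us ws where split: "perm_list p \<pi> = us @ y # ws" using split_list by metis
    note s = perm_list_split[OF \<pi> split]
    have "x \<in> set us" using topologicalD[OF t split] that by (auto simp: parents_def)
    then have "x \<in> \<pi> ` {1..length us}" using s(3) by simp
    then obtain i where "i \<le> length us" "x = \<pi> i" by auto
    moreover have "inv \<pi> y = Suc (length us)" using s(2) permutes_inverses(2)[OF \<pi>] by auto
    ultimately show ?thesis using permutes_inverses(2)[OF \<pi>] by simp
  qed
  then show "linear_extension p \<pi> G" using \<pi> by (auto simp: linear_extension_def)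
qed

lemma covered_step_subset: "covered_step V J D E \<Longrightarrow> E \<subseteq> V \<times> V"
  unfolding covered_step_def using order_imap_subset by blast

lemma reverse_arrow_subset: "covered_arrow G i j \<Longrightarrow> G \<subseteq> V \<times> V \<Longrightarrow> reverse_arrow i j G \<subseteq> V \<times> V"
  by (auto simp: covered_arrow_def reverse_arrow_def)

lemma triangle_step_iff:
  assumes C: "represents {1..p} C J" and D: "D \<subseteq> {1..p} \<times> {1..p}"
  shows "triangle_step p C D E \<longleftrightarrow> covered_step {1..p} J D E"
proof
  assume "triangle_step p C D E"
  then obtain i j \<tau> where *: "covered_arrow D i j" "linear_extension p \<tau> (reverse_arrow i j D)"
    "E = min_imap p C \<tau>" "card E \<le> card D" by (auto simp: triangle_step_def reverse_arrow_def)
  then have \<tau>: "\<tau> permutes {1..p}" by (simp add: linear_extension_def)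
  show "covered_step {1..p} J D E"
    unfolding covered_step_def
    using * perm_list_permutes[OF \<tau>] min_imap_eq_order_imap[OF \<tau> C]
      linear_extension_iff_topological[OF \<tau> reverse_arrow_subset[OF *(1) D]] by blast
next
  assume "covered_step {1..p} J D E"
  then obtain i j ys where *: "covered_arrow D i j" "set ys = {1..p}" "topological ys (reverse_arrow i j D)"
    "E = order_imap J ys" "card E \<le> card D" by (auto simp: covered_step_def)
  then obtain \<tau> where \<tau>: "\<tau> permutes {1..p}" "perm_list p \<tau> = ys"
    using ex_perm_list[of ys p] by (auto simp: topological_def)
  have "linear_extension p \<tau> (insert (j, i) (D - {(i, j)}))"
    using linear_extension_iff_topological[OF \<tau>(1) reverse_arrow_subset[OF *(1) D]] * \<tau>
    by (simp add: reverse_arrow_def)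
  then show "triangle_step p C D E"
    unfolding triangle_step_def using * \<tau> min_imap_eq_order_imap[OF \<tau>(1) C] by metis
qed

lemma triangle_steps_iff:
  assumes C: "represents {1..p} C J" and D: "D \<subseteq> {1..p} \<times> {1..p}"
  shows "(triangle_step p C)\<^sup>*\<^sup>* D E \<longleftrightarrow> (covered_step {1..p} J)\<^sup>*\<^sup>* D E"
proof
  assume "(triangle_step p C)\<^sup>*\<^sup>* D E"
  then have "(covered_step {1..p} J)\<^sup>*\<^sup>* D E \<and> E \<subseteq> {1..p} \<times> {1..p}"
  proof (induction rule: rtranclp_induct)
    case (step E F)
    then have "covered_step {1..p} J E F" using triangle_step_iff[OF C] by blast
    then show ?case using step.IH covered_step_subset by (meson rtranclp.rtrancl_into_rtrancl)
  qed (use D in simp)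
  then show "(covered_step {1..p} J)\<^sup>*\<^sup>* D E" ..
next
  assume "(covered_step {1..p} J)\<^sup>*\<^sup>* D E"
  then have "(triangle_step p C)\<^sup>*\<^sup>* D E \<and> E \<subseteq> {1..p} \<times> {1..p}"
  proof (induction rule: rtranclp_induct)
    case (step E F)
    then have "triangle_step p C E F" using triangle_step_iff[OF C] by blast
    then show ?case using step covered_step_subset by (meson rtranclp.rtrancl_into_rtrancl)
  qed (use D in simp)
  then show "(triangle_step p C)\<^sup>*\<^sup>* D E" ..
qed

definition swap_step :: "nat set \<Rightarrow> (nat set \<Rightarrow> nat set \<Rightarrow> nat set \<Rightarrow> bool) \<Rightarrow> digraph \<Rightarrow> digraph \<Rightarrow> bool" where
  "swap_step V J D E \<longleftrightarrow> D \<noteq> E \<and> card E \<le> card D \<and>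
     (\<exists>us a b ws. distinct (us @ a # b # ws) \<and> set (us @ a # b # ws) = V \<and>
        D = order_imap J (us @ a # b # ws) \<and> E = order_imap J (us @ b # a # ws))"

lemma permutohedron_edge_perm_list:
  assumes "permutohedron_edge p k \<pi> \<tau>"
  obtains us ws where "perm_list p \<pi> = us @ \<pi> k # \<pi> (Suc k) # ws" "perm_list p \<tau> = us @ \<pi> (Suc k) # \<pi> k # ws"
    "set us = \<pi> ` {1..<k}" "\<pi> permutes {1..p}" "\<tau> permutes {1..p}"
proof -
  have \<pi>: "\<pi> permutes {1..p}" and k: "1 \<le> k" "Suc k \<le> p" and \<tau>: "\<tau> = \<pi> \<circ> Transposition.transpose k (Suc k)"
    using assms by (auto simp: permutohedron_edge_def)
  have "Transposition.transpose k (Suc k) permutes {1..p}" by (rule permutes_swap_id) (use k in auto)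
  then have \<tau>p: "\<tau> permutes {1..p}" using permutes_compose \<pi> \<tau> by blast
  have u: "[1..<Suc p] = [1..<k] @ k # Suc k # [Suc (Suc k)..<Suc p]"
    using upt_add_eq_append[of 1 k "Suc p - k"] upt_conv_Cons[of k "Suc p"] upt_conv_Cons[of "Suc k" "Suc p"] k
    by (simp del: upt_Suc)
  have *: "map \<tau> [1..<k] = map \<pi> [1..<k]" "map \<tau> [Suc (Suc k)..<Suc p] = map \<pi> [Suc (Suc k)..<Suc p]"
    by (auto simp: \<tau> transpose_def)
  show thesis
  proof (rule that[OF _ _ _ \<pi> \<tau>p])
    show "perm_list p \<pi> = map \<pi> [1..<k] @ \<pi> k # \<pi> (Suc k) # map \<pi> [Suc (Suc k)..<Suc p]"
      unfolding perm_list_def u by simp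
    have "perm_list p \<tau> = map \<tau> [1..<k] @ \<tau> k # \<tau> (Suc k) # map \<tau> [Suc (Suc k)..<Suc p]"
      unfolding perm_list_def u by simp
    then show "perm_list p \<tau> = map \<pi> [1..<k] @ \<pi> (Suc k) # \<pi> k # map \<pi> [Suc (Suc k)..<Suc p]"
      unfolding * by (simp add: \<tau> transpose_def)
  qed simp
qed

lemma permutohedron_edge_of_list:
  assumes "\<pi> permutes {1..p}" "perm_list p \<pi> = us @ a # b # ws"
  obtains \<tau> k where "permutohedron_edge p k \<pi> \<tau>" "perm_list p \<tau> = us @ b # a # ws" "\<tau> permutes {1..p}"
    "a = \<pi> k" "b = \<pi> (Suc k)" "set us = \<pi> ` {1..<k}"
proof -
  define k where "k = Suc (length us)"
  have b: "Suc k \<le> p" "\<pi> (Suc k) = b" using perm_list_split[OF assms(1), of "us @ [a]" b ws] assms(2) by (auto simp: k_def)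
  have a: "\<pi> k = a" "\<pi> ` {1..<k} = set us"
    using perm_list_split[OF assms(1), of us a "b # ws"] assms(2) by (auto simp: k_def atLeastLessThanSuc_atLeastAtMost)
  define \<tau> where "\<tau> = \<pi> \<circ> Transposition.transpose k (Suc k)"
  have e: "permutohedron_edge p k \<pi> \<tau>" using assms b by (auto simp: permutohedron_edge_def \<tau>_def k_def)
  obtain us' ws' where l: "perm_list p \<pi> = us' @ a # b # ws'" "perm_list p \<tau> = us' @ b # a # ws'" "\<tau> permutes {1..p}"
    using permutohedron_edge_perm_list[OF e] a b by metis
  have "us' = us \<and> b # ws' = b # ws"
    using distinct_split_unique[of us a "b # ws" us' "b # ws'"] perm_list_permutes(1)[OF assms(1)] assms(2) l(1)
    by metis
  then show thesis using that[OF e] l(2,3) a b by (metis list.inject)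
qed

lemma edge_step_iff:
  assumes C: "represents {1..p} C J"
  shows "edge_step p C = swap_step {1..p} J"
proof (intro ext iffI)
  fix D E assume "edge_step p C D E"
  then obtain \<pi> \<tau> k where *: "D \<noteq> E" "card E \<le> card D" "permutohedron_edge p k \<pi> \<tau>"
    "D = min_imap p C \<pi>" "E = min_imap p C \<tau>" by (auto simp: edge_step_def polytope_edge_def)
  obtain us ws where l: "perm_list p \<pi> = us @ \<pi> k # \<pi> (Suc k) # ws" "perm_list p \<tau> = us @ \<pi> (Suc k) # \<pi> k # ws"
    "\<pi> permutes {1..p}" "\<tau> permutes {1..p}"
    using permutohedron_edge_perm_list[OF *(3)] by metis
  have "distinct (us @ \<pi> k # \<pi> (Suc k) # ws)" "set (us @ \<pi> k # \<pi> (Suc k) # ws) = {1..p}"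
    using perm_list_permutes[OF l(3)] l(1) by simp_all
  then show "swap_step {1..p} J D E"
    unfolding swap_step_def
    using * l min_imap_eq_order_imap[OF l(3) C] min_imap_eq_order_imap[OF l(4) C] by metis
next
  fix D E assume "swap_step {1..p} J D E"
  then obtain us a b ws where *: "D \<noteq> E" "card E \<le> card D" "distinct (us @ a # b # ws)" "set (us @ a # b # ws) = {1..p}"
    "D = order_imap J (us @ a # b # ws)" "E = order_imap J (us @ b # a # ws)" unfolding swap_step_def by blast
  obtain \<pi> where \<pi>: "\<pi> permutes {1..p}" "perm_list p \<pi> = us @ a # b # ws" using ex_perm_list[OF *(3,4)] by blast
  obtain \<tau> k where \<tau>: "permutohedron_edge p k \<pi> \<tau>" "perm_list p \<tau> = us @ b # a # ws" "\<tau> permutes {1..p}"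
    using permutohedron_edge_of_list[OF \<pi>] by metis
  show "edge_step p C D E"
    unfolding edge_step_def polytope_edge_def
    using * \<pi> \<tau> min_imap_eq_order_imap[OF \<pi>(1) C] min_imap_eq_order_imap[OF \<tau>(3) C] by metis
qed

lemma edge_steps_min_imap:
  assumes "(edge_step p C)\<^sup>*\<^sup>* (min_imap p C \<pi>) R" "\<pi> permutes {1..p}"
  shows "\<exists>\<rho>. \<rho> permutes {1..p} \<and> R = min_imap p C \<rho>"
  using assms(1)
proof (induction rule: rtranclp_induct)
  case (step D E)
  then obtain \<sigma> \<tau> k where "permutohedron_edge p k \<sigma> \<tau>" "E = min_imap p C \<tau>"
    unfolding edge_step_def polytope_edge_def by blast
  then show ?case using permutohedron_edge_perm_list by metis
qed (use assms(2) in blast)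

lemma search_returns_stuck:
  "search_returns step D R \<Longrightarrow> step\<^sup>*\<^sup>* D R \<and> \<not> (\<exists>E. step\<^sup>*\<^sup>* R E \<and> card E < card R)"
  by (induction rule: search_returns.induct) auto

lemma ex_search_returns: "\<exists>R. search_returns step D R"
proof (induction "card D" arbitrary: D rule: less_induct)
  case less
  show ?case
  proof (cases "\<exists>E. step\<^sup>*\<^sup>* D E \<and> card E < card D")
    case True
    then show ?thesis using less search_returns.improve by metis
  qed (use search_returns.stop in blast)
qed

lemma d_separated_iff_d_sep: "acyclic G \<Longrightarrow> d_separated G A B S \<longleftrightarrow> d_sep G A B S"
  by (simp add: d_separated_iff d_sep_def)

lemma markov_equiv_classI:
  assumes "dag_on p G" "dag_on p R"
    and "independence_map {1..p} (d_sep G) R" "independence_map {1..p} (d_sep R) G"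
  shows "R \<in> markov_equiv_class p G"
proof -
  have ac: "acyclic G" "acyclic R" using assms by (auto simp: dag_on_def)
  have "d_sep R A B S \<longleftrightarrow> d_sep G A B S" if t: "disjoint_triple p A B S" for A B S
    using independence_mapD[OF assms(3), of A B S] independence_mapD[OF assms(4), of A B S] t
    by (auto simp: disjoint_triple_def)
  then show ?thesis
    unfolding markov_equiv_class_def using assms(2) ac by (simp add: d_separated_iff_d_sep)
qed

lemma (in joint_dist) semigraphoid_cond_indep: "semigraphoid {1..p} (cond_indep M P)"
proof unfold_locales
  fix A B C D :: "nat set"
  show "cond_indep M P A B C \<Longrightarrow> cond_indep M P B A C" by (rule cond_indep_sym)
  show "A \<subseteq> {1..p} \<Longrightarrow> C \<subseteq> {1..p} \<Longrightarrow> cond_indep M P A {} C" by (rule cond_indep_empty)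
  show "cond_indep M P A D C \<Longrightarrow> D \<subseteq> {1..p} \<Longrightarrow> B \<subseteq> D \<Longrightarrow> cond_indep M P A B C"
    by (rule cond_indep_decomposition)
  show "cond_indep M P A (B \<union> D) C \<Longrightarrow> A \<subseteq> {1..p} \<Longrightarrow> B \<subseteq> {1..p} \<Longrightarrow> C \<subseteq> {1..p} \<Longrightarrow> D \<subseteq> {1..p} \<Longrightarrow>
      cond_indep M P A B (C \<union> D)" by (rule cond_indep_weak_union)
  show "cond_indep M P A B C \<Longrightarrow> cond_indep M P A D (C \<union> B) \<Longrightarrow> A \<subseteq> {1..p} \<Longrightarrow> B \<subseteq> {1..p} \<Longrightarrow> C \<subseteq> {1..p} \<Longrightarrow>
      D \<subseteq> {1..p} \<Longrightarrow> cond_indep M P A (B \<union> D) C" by (rule cond_indep_contraction)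
qed simp

lemma (in joint_dist) represents_ci_relations: "represents {1..p} (ci_relations p M P) (cond_indep M P)"
  by (auto simp: represents_def ci_relations_def)

lemma markov_wrt_iff:
  "dag_on p G \<Longrightarrow> markov_wrt p M P G \<longleftrightarrow> independence_map {1..p} (cond_indep M P) G"
  unfolding markov_wrt_def independence_map_def disjoint_triple_def dag_on_def
  by (auto simp: d_separated_iff_d_sep)

text \<open>Contraction assembles first \<open>B\<close>, then \<open>A\<close>, element by element.
  This bridges the gap between assumptions about pairs of vertices and the Markov property for
  sets.\<close>

lemma (in semigraphoid) set_of_pairs:
  assumes "A \<subseteq> V" "B \<subseteq> V" "C \<subseteq> V"
    and J: "\<And>a b A' B'. a \<in> A \<Longrightarrow> b \<in> B \<Longrightarrow> A' \<subseteq> A - {a} \<Longrightarrow> B' \<subseteq> B - {b} \<Longrightarrow> J {a} {b} (C \<union> A' \<union> B')"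
  shows "J A B C"
proof -
  have fin: "finite A" "finite B" using assms finite_V finite_subset by blast+
  have 1: "J {a} B' (C \<union> A')" if a: "a \<in> A" "A' \<subseteq> A - {a}" and B': "B' \<subseteq> B" for a A' B'
    using finite_subset[OF B' fin(2)] B'
  proof (induction B' rule: finite_induct)
    case empty
    show ?case by (rule trivial) (use a assms in auto)
  next
    case (insert b B')
    have "J {a} {b} (C \<union> A' \<union> B')" using J[OF a(1) _ a(2)] insert by auto
    with insert.IH insert.prems have "J {a} (B' \<union> {b}) (C \<union> A')"
      by (intro contraction[of "{a}" B' "C \<union> A'" "{b}"]) (use a assms in auto)
    then show ?case by simp
  qed
  have "J B A' C" if A': "A' \<subseteq> A" for A'
    using finite_subset[OF A' fin(1)] A'
  proof (induction A' rule: finite_induct)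
    case empty
    show ?case by (rule trivial) (use assms in auto)
  next
    case (insert a A')
    have "J {a} B (C \<union> A')" using 1[of a A' B] insert by auto
    then have "J B {a} (C \<union> A')" by (rule symmetric) (use insert.prems assms in auto)
    with insert.IH insert.prems have "J B (A' \<union> {a}) C"
      by (intro contraction[of B A' C "{a}"]) (use assms in auto)
    then show ?case by simp
  qed
  from this[of A] have "J B A C" by simp
  then show ?thesis by (rule symmetric) (use assms in auto)
qed

theorem faithfulness_imp_triangle:
  assumes jd: "joint_distribution p M P" and G: "dag_on p G" and f: "faithfulness_assumption p M P G"
  shows "triangle_assumption p M P G"
proof -
  interpret joint_dist p M P by unfold_locales (rule jd)
  interpret S: semigraphoid "{1..p}" "cond_indep M P" by (rule semigraphoid_cond_indep)
  have ac: "acyclic G" and sub: "G \<subseteq> {1..p} \<times> {1..p}" using G by (auto simp: dag_on_def)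
  interpret D: graphoid "{1..p}" "d_sep G" by (rule graphoid_d_sep[OF ac]) simp
  let ?C = "ci_relations p M P"
  have ci: "cond_indep M P {i} {j} S \<longleftrightarrow> d_sep G {i} {j} S"
    if "i \<in> {1..p}" "j \<in> {1..p}" "i \<noteq> j" "S \<subseteq> {1..p} - {i, j}" for i j S
    using f that d_separated_iff_d_sep[OF ac] unfolding faithfulness_assumption_def by blast
  \<comment> \<open>All minimal independence maps may now be computed in the graphoid
    \<open>d_sep G\<close>.\<close>
  have rep: "represents {1..p} ?C (d_sep G)"
    unfolding represents_def ci_relations_def using ci by auto
  have "independence_map {1..p} (cond_indep M P) G"
    unfolding independence_map_def
  proof (intro conjI allI impI ac sub)
    fix A B S assume *: "A \<subseteq> {1..p}" "B \<subseteq> {1..p}" "S \<subseteq> {1..p}" "A \<inter> B = {}" "A \<inter> S = {}" "B \<inter> S = {}"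
      "d_sep G A B S"
    show "cond_indep M P A B S"
    proof (rule S.set_of_pairs[OF *(1-3)])
      fix a b A' B' assume ab: "a \<in> A" "b \<in> B" "A' \<subseteq> A - {a}" "B' \<subseteq> B - {b}"
      have "d_sep G B A S" using *(7) by (rule d_sep_sym)
      then have "d_sep G B {a} (S \<union> A')" by (rule D.shrink) (use * ab in auto)
      then have "d_sep G {a} B (S \<union> A')" by (rule d_sep_sym)
      then have "d_sep G {a} {b} (S \<union> A' \<union> B')" by (rule D.shrink) (use * ab in auto)
      then show "cond_indep M P {a} {b} (S \<union> A' \<union> B')"
        by (subst ci) (use * ab in auto)
    qed
  qed
  then have "markov_wrt p M P G" using markov_wrt_iff[OF G] by blast
  moreover have "R \<in> markov_equiv_class p G"
    if \<pi>: "\<pi> permutes {1..p}" and R: "triangle_sp_returns p ?C \<pi> R" for \<pi> R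
  proof -
    have r: "(triangle_step p ?C)\<^sup>*\<^sup>* (min_imap p ?C \<pi>) R" "\<not> (\<exists>E. (triangle_step p ?C)\<^sup>*\<^sup>* R E \<and> card E < card R)"
      using search_returns_stuck R unfolding triangle_sp_returns_def by blast+
    obtain \<rho> where \<rho>: "\<rho> permutes {1..p}" "R = min_imap p ?C \<rho>"
      using r(1) \<pi> by (cases rule: rtranclp.cases) (auto simp: triangle_step_def linear_extension_def)
    define xs where "xs = perm_list p \<rho>"
    have xs: "distinct xs" "set xs = {1..p}" "R = order_imap (d_sep G) xs"
      using perm_list_permutes[OF \<rho>(1)] min_imap_eq_order_imap[OF \<rho>(1) rep] \<rho> by (auto simp: xs_def)
    have Rsub: "R \<subseteq> {1..p} \<times> {1..p}" using order_imap_subset[of "d_sep G" xs] xs by simp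
    have stuck: "card (order_imap (d_sep G) xs) \<le> card E"
      if "(covered_step {1..p} (d_sep G))\<^sup>*\<^sup>* (order_imap (d_sep G) xs) E" for E
      using r(2) that triangle_steps_iff[OF rep Rsub] xs(3) not_le by blast
    have "dag_on p R" using Rsub acyclic_order_imap[OF xs(1)] xs(3) by (simp add: dag_on_def)
    then show ?thesis
      using stuck_markov_equivalent[OF ac sub xs(1,2) stuck] xs(3) by (intro markov_equiv_classI[OF G]) auto
  qed
  ultimately show ?thesis by (simp add: triangle_assumption_def)
qed

text \<open>Take orders that begin with \<open>S\<close>, \<open>x\<close>, \<open>y\<close>,
  \<open>i\<close> and with \<open>S\<close>, \<open>x\<close>, \<open>i\<close>, \<open>y\<close>.
  The independence of \<open>i\<close> and \<open>y\<close> contracts the edge between them, so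
  their DAGs coincide. The first has no arrow from \<open>x\<close> to \<open>i\<close>, by the
  independence given \<open>y\<close> and \<open>S\<close>; hence neither has the second, where only
  \<open>S\<close> is in the condition.\<close>

lemma vertices_identified_intersection:
  assumes v: "vertices_identified_with_dags p C" and rep: "represents {1..p} C J"
    and sym: "\<And>x y S. x \<in> {1..p} \<Longrightarrow> y \<in> {1..p} \<Longrightarrow> S \<subseteq> {1..p} \<Longrightarrow> J {x} {y} S \<Longrightarrow> J {y} {x} S"
    and i: "i \<in> {1..p}" "x \<in> {1..p}" "y \<in> {1..p}" "i \<noteq> x" "i \<noteq> y" "x \<noteq> y" "S \<subseteq> {1..p} - {i, x, y}"
    and J: "J {i} {x} (insert y S)" "J {i} {y} (insert x S)"
  shows "J {i} {x} S"
proof -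
  have "finite S" using i(7) finite_subset by blast
  then obtain zs where zs: "distinct zs" "set zs = S" using finite_distinct_list by blast
  obtain ws where ws: "distinct ws" "set ws = {1..p} - {i, x, y} - S"
    using finite_distinct_list[of "{1..p} - {i, x, y} - S"] by auto
  let ?xs = "(zs @ [x]) @ y # i # ws" and ?ys = "(zs @ [x]) @ i # y # ws"
  have d: "distinct ?xs" "set ?xs = {1..p}" "distinct ?ys" using zs ws i by auto
  obtain \<pi> where \<pi>: "\<pi> permutes {1..p}" "perm_list p \<pi> = ?xs" using ex_perm_list[OF d(1,2)] .
  obtain \<tau> k where \<tau>: "permutohedron_edge p k \<pi> \<tau>" "perm_list p \<tau> = ?ys" "\<tau> permutes {1..p}"
    "y = \<pi> k" "i = \<pi> (Suc k)" "set (zs @ [x]) = \<pi> ` {1..<k}"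
    using permutohedron_edge_of_list[OF \<pi>] .
  have "J {y} {i} (insert x S)" by (rule sym[OF i(1,3) _ J(2)]) (use i in auto)
  then have "(y, i, insert x S) \<in> C" by (subst representsD[OF rep]) (use i in auto)
  then have "contracted_edge p C \<pi> \<tau>"
    unfolding contracted_edge_def using \<tau> zs by (intro exI[of _ k]) (auto simp: insert_commute)
  then have "min_imap p C \<pi> = min_imap p C \<tau>"
    using v \<pi> \<tau> unfolding vertices_identified_with_dags_def by blast
  then have eq: "order_imap J ?xs = order_imap J ?ys"
    using min_imap_eq_order_imap[OF _ rep] \<pi> \<tau> by metis
  have "J {x} {i} (insert y S)" by (rule sym) (use J i in auto)
  moreover have "set (zs @ [x, y]) - {x} = insert y S" using zs i by auto
  ultimately have "(x, i) \<notin> order_imap J ?xs"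
    using order_imap_iff[of "zs @ [x, y]" i ws x J] d(1) by simp
  then have "(x, i) \<notin> order_imap J ?ys" using eq by simp
  moreover have "set (zs @ [x]) - {x} = S" using zs i by auto
  ultimately have "J {x} {i} S"
    using order_imap_iff[of "zs @ [x]" i "y # ws" x J] d(3) by simp
  then show ?thesis by (rule sym[rotated 3]) (use i in auto)
qed

theorem triangle_imp_edge:
  assumes jd: "joint_distribution p M P" and v: "vertices_identified_with_dags p (ci_relations p M P)"
    and t: "triangle_assumption p M P G"
  shows "edge_assumption p M P G"
proof -
  interpret joint_dist p M P by unfold_locales (rule jd)
  interpret S: semigraphoid "{1..p}" "cond_indep M P" by (rule semigraphoid_cond_indep)
  let ?C = "ci_relations p M P" and ?J = "cond_indep M P"
  note rep = represents_ci_relations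
  have sym: "?J {x} {y} S \<Longrightarrow> ?J {y} {x} S" for x y S by (rule cond_indep_sym)
  interpret J: graphoid "{1..p}" ?J
  proof unfold_locales
    fix i x y S
    assume "i \<in> {1..p}" "x \<in> {1..p}" "y \<in> {1..p}" "i \<noteq> x" "i \<noteq> y" "x \<noteq> y" "S \<subseteq> {1..p} - {i, x, y}"
      "?J {i} {x} (insert y S)" "?J {i} {y} (insert x S)"
    from vertices_identified_intersection[OF v rep sym this] show "?J {i} {x} S" .
  qed
  have single: "(swap_step {1..p} ?J)\<^sup>*\<^sup>* D E \<and> (\<exists>ys. distinct ys \<and> set ys = {1..p} \<and> E = order_imap ?J ys)"
    if D: "distinct xs" "set xs = {1..p}" "D = order_imap ?J xs" and s: "covered_step {1..p} ?J D E" for D E xs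
  proof -
    obtain i j ys where c: "covered_arrow D i j" and ys: "set ys = {1..p}" "topological ys (reverse_arrow i j D)"
      and E: "E = order_imap ?J ys" and card: "card E \<le> card D"
      using s by (auto simp: covered_step_def)
    have im: "independence_map {1..p} ?J D" using J.independence_map_order_imap[OF D(1,2)] D(3) by simp
    have tD: "topological xs D" using topological_order_imap[OF D(1)] D(3) by simp
    have subD: "D \<subseteq> {1..p} \<times> {1..p}" using order_imap_subset[of ?J xs] D by simp
    obtain us vs ws where o: "xs = us @ i # vs @ j # ws" "topological (us @ i # j # vs @ ws) D"
      "topological (us @ j # i # vs @ ws) (reverse_arrow i j D)"
      "independence_map {1..p} (d_sep D) (reverse_arrow i j D)"
      using covered_reversal[OF tD D(2) subD c] by metis
    have im': "independence_map {1..p} ?J (reverse_arrow i j D)" using independence_map_trans[OF o(4) im] .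
    have V: "set (us @ i # j # vs @ ws) = {1..p}" "set (us @ j # i # vs @ ws) = {1..p}"
      unfolding D(2)[symmetric] o(1) by auto
    have 1: "order_imap ?J (us @ i # j # vs @ ws) = D"
      using J.order_imap_eq_prune[OF im o(2) V(1)] J.order_imap_eq_prune[OF im tD D(2)] D(3) by metis
    have 2: "order_imap ?J (us @ j # i # vs @ ws) = E"
      using J.order_imap_eq_prune[OF im' o(3) V(2)] J.order_imap_eq_prune[OF im' ys(2,1)] E by metis
    have "D = E \<or> swap_step {1..p} ?J D E"
      unfolding swap_step_def using 1 2 V(1) o(2) card by (metis topological_def)
    moreover have "distinct ys" using ys(2) by (simp add: topological_def)
    ultimately show ?thesis using ys E by blast
  qed
  have steps: "(swap_step {1..p} ?J)\<^sup>*\<^sup>* D E"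
    if D: "distinct xs" "set xs = {1..p}" "D = order_imap ?J xs" and s: "(covered_step {1..p} ?J)\<^sup>*\<^sup>* D E" for D E xs
  proof -
    have "(swap_step {1..p} ?J)\<^sup>*\<^sup>* D E \<and> (\<exists>ys. distinct ys \<and> set ys = {1..p} \<and> E = order_imap ?J ys)"
      using s
    proof (induction rule: rtranclp_induct)
      case base
      then show ?case using D by blast
    next
      case (step E F)
      then obtain ys where "distinct ys" "set ys = {1..p}" "E = order_imap ?J ys" by blast
      then show ?case using single[of ys E F] step by (meson rtranclp_trans)
    qed
    then show ?thesis ..
  qed
  have "R \<in> markov_equiv_class p G"
    if \<pi>: "\<pi> permutes {1..p}" and R: "edge_sp_returns p ?C \<pi> R" for \<pi> R
  proof -
    have r: "(edge_step p ?C)\<^sup>*\<^sup>* (min_imap p ?C \<pi>) R" "\<not> (\<exists>E. (edge_step p ?C)\<^sup>*\<^sup>* R E \<and> card E < card R)"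
      using search_returns_stuck R unfolding edge_sp_returns_def by blast+
    obtain \<rho> where \<rho>: "\<rho> permutes {1..p}" "R = min_imap p ?C \<rho>"
      using edge_steps_min_imap[OF r(1) \<pi>] by blast
    have R': "R = order_imap ?J (perm_list p \<rho>)" using min_imap_eq_order_imap[OF \<rho>(1) rep] \<rho>(2) by simp
    then have Rsub: "R \<subseteq> {1..p} \<times> {1..p}"
      using order_imap_subset[of ?J "perm_list p \<rho>"] perm_list_permutes[OF \<rho>(1)] by simp
    \<comment> \<open>Where the edge search is stuck, the triangle search is stuck too; started from
      an order of \<open>R\<close>, it returns \<open>R\<close> at once.\<close>
    have "\<not> (\<exists>E. (triangle_step p ?C)\<^sup>*\<^sup>* R E \<and> card E < card R)"
      using r(2) steps[OF perm_list_permutes[OF \<rho>(1)] R'] triangle_steps_iff[OF rep Rsub] edge_step_iff[OF rep] by metis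
    then have "triangle_sp_returns p ?C \<rho> R"
      unfolding triangle_sp_returns_def \<rho>(2)[symmetric] by (rule search_returns.stop)
    then show ?thesis using t \<rho>(1) by (simp add: triangle_assumption_def)
  qed
  then show ?thesis using t by (simp add: triangle_assumption_def edge_assumption_def)
qed

section \<open>From the edge assumption to sparsest Markov representations\<close>

lemma ex_topological:
  assumes "acyclic G" "finite V" "G \<subseteq> V \<times> V"
  obtains xs where "topological xs G" "set xs = V"
proof -
  have "finite V \<Longrightarrow> \<exists>xs. distinct xs \<and> set xs = V \<and> topological xs (G \<inter> V \<times> V)" for V
  proof (induction "card V" arbitrary: V)
    case 0
    then show ?case by (auto simp: topological_def)
  next
    case (Suc n)
    then obtain z where "z \<in> V" by fastforce
    then obtain t where t: "sink_in G V t" using ex_sink_below[OF assms(1) Suc.prems] by blast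
    then have tV: "t \<in> V" by (simp add: sink_in_def)
    have "n = card (V - {t})" using Suc.hyps(2) tV by simp
    then obtain xs where xs: "distinct xs" "set xs = V - {t}" "topological xs (G \<inter> (V - {t}) \<times> (V - {t}))"
      using Suc.hyps(1)[of "V - {t}"] Suc.prems by auto
    have "topological (xs @ [t]) (G \<inter> V \<times> V)"
      unfolding topological_def
    proof (intro conjI allI impI subsetI)
      fix us y ws x assume eq: "xs @ [t] = us @ y # ws" and "x \<in> parents (G \<inter> V \<times> V) y"
      then have x: "(x, y) \<in> G" "x \<in> V" "y \<in> V" by (auto simp: parents_def)
      have xt: "x \<noteq> t" using t x by (auto simp: sink_in_def)
      show "x \<in> set us"
      proof (cases "y = t")
        case True
        then have "us = xs" using xs by (intro split_unique[OF _ _ eq]) auto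
        then show ?thesis using x xt xs(2) by auto
      next
        case False
        then obtain zs where "ws = zs @ [t]" "xs = us @ y # zs" using eq by (cases ws rule: rev_cases) auto
        then show ?thesis using topologicalD[OF xs(3)] x xt False by (fastforce simp: parents_def)
      qed
    qed (use xs in auto)
    moreover have "distinct (xs @ [t])" "set (xs @ [t]) = V" using xs tV by auto
    ultimately show ?case by blast
  qed
  from this[OF assms(2)] show thesis using that assms(3) by (metis Int_absorb2)
qed

text \<open>Two non-adjacent vertices are separated by the parents of the one that comes later in a
  topological order.\<close>

lemma adjacent_iff_connected:
  assumes G: "dag_on p G" and ab: "a \<in> {1..p}" "b \<in> {1..p}" "a \<noteq> b"
  shows "adjacent G a b \<longleftrightarrow> (\<forall>S \<subseteq> {1..p} - {a, b}. d_connected G S a b)"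
proof
  assume all: "\<forall>S \<subseteq> {1..p} - {a, b}. d_connected G S a b"
  have ac: "acyclic G" and sub: "G \<subseteq> {1..p} \<times> {1..p}" using G by (auto simp: dag_on_def)
  obtain xs where xs: "topological xs G" "set xs = {1..p}" using ex_topological[OF ac _ sub] by auto
  have *: "adjacent G x y" if "x \<in> set us" "xs = us @ y # ws" "\<forall>S \<subseteq> {1..p} - {x, y}. d_connected G S x y" for x y us ws
  proof (rule ccontr)
    assume n: "\<not> adjacent G x y"
    have pa: "parents G y \<subseteq> set us" "y \<notin> set us" "set us \<subseteq> {1..p}"
      using topologicalD[OF xs(1) that(2)] xs that(2) by (auto simp: topological_def)
    have "d_sep G {y} (set us - parents G y) (parents G y)"
      using d_sep_local_markov[OF _ ac] xs(1) that(2) by simp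
    moreover have "x \<notin> parents G y" using n by (simp add: parents_def adjacent_def)
    moreover have "parents G y \<subseteq> {1..p} - {x, y}" using pa calculation(2) by auto
    ultimately show False using that d_connected_sym by (auto simp: d_sep_def)
  qed
  obtain us ws where split: "xs = us @ b # ws" using ab xs split_list by metis
  show "adjacent G a b"
  proof (cases "a \<in> set us")
    case True
    then show ?thesis using * split all by blast
  next
    case False
    moreover have "a \<in> set xs" using ab(1) xs(2) by simp
    ultimately have "a \<in> set ws" using split ab(3) by simp
    then obtain ws1 ws2 where "ws = ws1 @ a # ws2" using split_list by metis
    then have "xs = (us @ b # ws1) @ a # ws2" using split by simp
    moreover have "\<forall>S \<subseteq> {1..p} - {b, a}. d_connected G S b a"
      using all d_connected_sym by (metis insert_commute)
    ultimately have "adjacent G b a" by (intro *[of b "us @ b # ws1" a ws2]) simp_all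
    then show ?thesis by (simp add: adjacent_sym)
  qed
qed (use d_connected_adjacent in blast)

text \<open>The d-separations determine the skeleton, and acyclicity gives one arrow for each of its
  edges.\<close>

lemma markov_equiv_card:
  assumes "dag_on p G" "H \<in> markov_equiv_class p G"
  shows "card H = card G"
proof -
  have H: "dag_on p H" using assms(2) by (simp add: markov_equiv_class_def)
  have edges: "card G = card {{a, b} | a b. a \<in> {1..p} \<and> b \<in> {1..p} \<and> a \<noteq> b \<and> adjacent G a b}"
    if "dag_on p G" for G
  proof -
    have ac: "acyclic G" and sub: "G \<subseteq> {1..p} \<times> {1..p}" using that by (auto simp: dag_on_def)
    have "inj_on (\<lambda>(a, b). {a, b}) G"
      using acyclic_antisym[OF ac] by (auto simp: inj_on_def doubleton_eq_iff)
    then have "card G = card ((\<lambda>(a, b). {a, b}) ` G)" by (simp add: card_image)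
    also have "(\<lambda>(a, b). {a, b}) ` G = {{a, b} | a b. a \<in> {1..p} \<and> b \<in> {1..p} \<and> a \<noteq> b \<and> adjacent G a b}"
    proof -
      have "a \<noteq> b" if "(a, b) \<in> G" for a b using acyclic_antisym[OF ac] that by blast
      then show ?thesis
        using sub by (fastforce simp: adjacent_def image_iff doubleton_eq_iff)
    qed
    finally show ?thesis .
  qed
  have "adjacent H a b \<longleftrightarrow> adjacent G a b" if ab: "a \<in> {1..p}" "b \<in> {1..p}" "a \<noteq> b" for a b
  proof -
    have "d_connected H S a b \<longleftrightarrow> d_connected G S a b" if S: "S \<subseteq> {1..p} - {a, b}" for S
    proof -
      have "disjoint_triple p {a} {b} S" using ab S by (auto simp: disjoint_triple_def)
      then have "d_separated H {a} {b} S \<longleftrightarrow> d_separated G {a} {b} S"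
        using assms(2) by (simp add: markov_equiv_class_def)
      then show ?thesis using H assms(1) by (simp add: d_separated_iff dag_on_def)
    qed
    then show ?thesis
      using adjacent_iff_connected[OF H ab] adjacent_iff_connected[OF assms(1) ab] by blast
  qed
  then show ?thesis unfolding edges[OF H] edges[OF assms(1)] by (intro arg_cong[of _ _ card]) blast
qed

text \<open>The map of a linear extension of \<open>H\<close> is contained in \<open>H\<close>, and
  the search from it ends in the class of \<open>G\<close>, hence with \<open>card G\<close> arrows.
  Either the search has strictly improved, or it returned its starting DAG, which is then a proper
  part of \<open>H\<close> because \<open>H\<close> is outside the class.\<close>

theorem edge_imp_sparsest:
  assumes jd: "joint_distribution p M P" and G: "dag_on p G" and e: "edge_assumption p M P G"
  shows "sparsest_markov_assumption p M P G"
  unfolding sparsest_markov_assumption_def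
proof (intro conjI allI impI)
  show "markov_wrt p M P G" using e by (simp add: edge_assumption_def)
  interpret joint_dist p M P by unfold_locales (rule jd)
  interpret S: semigraphoid "{1..p}" "cond_indep M P" by (rule semigraphoid_cond_indep)
  fix H assume H: "dag_on p H" "H \<notin> markov_equiv_class p G" "markov_wrt p M P H"
  let ?C = "ci_relations p M P"
  have im: "independence_map {1..p} (cond_indep M P) H" using markov_wrt_iff[OF H(1)] H(3) by blast
  have sub: "H \<subseteq> {1..p} \<times> {1..p}" and ac: "acyclic H" using H(1) by (auto simp: dag_on_def)
  have fin: "finite H" using finite_subset[OF sub] by simp
  obtain xs where xs: "topological xs H" "set xs = {1..p}" using ex_topological[OF ac _ sub] by auto
  then have "distinct xs" by (simp add: topological_def)
  then obtain \<pi> where \<pi>: "\<pi> permutes {1..p}" "perm_list p \<pi> = xs" using ex_perm_list xs(2) by blast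
  let ?D = "min_imap p ?C \<pi>"
  have DH: "?D \<subseteq> H"
    using S.order_imap_subset_imap[OF im xs] min_imap_eq_order_imap[OF \<pi>(1) represents_ci_relations] \<pi>(2) by simp
  obtain R where R: "search_returns (edge_step p ?C) ?D R" using ex_search_returns by blast
  then have RG: "R \<in> markov_equiv_class p G"
    using e \<pi>(1) by (auto simp: edge_assumption_def edge_sp_returns_def)
  then have cR: "card R = card G" using markov_equiv_card[OF G] by blast
  show "card G < card H"
  proof (cases "card R < card ?D")
    case True
    then show ?thesis using cR card_mono[OF fin DH] by simp
  next
    case False
    have le: "card E \<le> card D" if "search_returns s D E" for s :: "digraph \<Rightarrow> digraph \<Rightarrow> bool" and D E
      using that by (induction rule: search_returns.induct) auto
    from R have "R = ?D"
    proof (cases rule: search_returns.cases)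
      case (improve E)
      then show ?thesis using le[of "edge_step p ?C" E R] False by simp
    qed simp
    then have "?D \<noteq> H" using RG H(2) by blast
    then have "card ?D < card H" using DH fin by (intro psubset_card_mono) auto
    then show ?thesis using cR \<open>R = ?D\<close> by simp
  qed
qed

section \<open>Contracted edges and searches on lists\<close>

definition contracted_swap :: "(nat set \<Rightarrow> nat set \<Rightarrow> nat set \<Rightarrow> bool) \<Rightarrow> nat list \<Rightarrow> nat list \<Rightarrow> bool" where
  "contracted_swap J xs ys \<longleftrightarrow> (\<exists>us a b ws. xs = us @ a # b # ws \<and> ys = us @ b # a # ws \<and> J {a} {b} (set us))"

text \<open>No vertex of \<open>as\<close> is a parent of \<open>y\<close>, so each transposition
  that moves \<open>y\<close> to the left exchanges non-adjacent vertices: it keeps the map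
  \<open>D\<close> and is contracted.\<close>

lemma (in graphoid) contracted_swaps_bubble:
  assumes im: "independence_map V J D"
    and t: "topological (us @ as @ y # bs) D" "set (us @ as @ y # bs) = V" and D: "order_imap J (us @ as @ y # bs) = D"
    and pa: "parents D y \<subseteq> set us"
  shows "(contracted_swap J)\<^sup>*\<^sup>* (us @ as @ y # bs) (us @ y # as @ bs) \<and> topological (us @ y # as @ bs) D"
  using t D
proof (induction as arbitrary: bs rule: rev_induct)
  case (snoc a as)
  have d: "distinct (us @ as @ a # y # bs)" using snoc.prems(1) by (simp add: topological_def)
  have V: "set (us @ as @ y # a # bs) = V" using snoc.prems(2) by auto
  have n: "a \<notin> parents D y" using pa d by auto
  have t': "topological ((us @ as) @ y # a # bs) D"
    by (rule topological_swap) (use snoc.prems(1) n in auto)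
  have "order_imap J (us @ as @ y # a # bs) = D"
    using order_imap_eq_prune[OF im _ V] order_imap_eq_prune[OF im snoc.prems(1,2)] t' snoc.prems(3) by simp
  then have IH: "(contracted_swap J)\<^sup>*\<^sup>* (us @ as @ y # a # bs) (us @ y # as @ a # bs) \<and> topological (us @ y # as @ a # bs) D"
    using snoc.IH[of "a # bs"] t' V by simp
  have "(a, y) \<notin> order_imap J ((us @ as @ [a]) @ y # bs)" using n snoc.prems(3) by (simp add: parents_def)
  then have "J {a} {y} (set (us @ as @ [a]) - {a})" using order_imap_iff[of "us @ as @ [a]" y bs a J] d by simp
  moreover have "set (us @ as @ [a]) - {a} = set (us @ as)" using d by auto
  ultimately have "contracted_swap J (us @ as @ a # y # bs) (us @ as @ y # a # bs)"
    unfolding contracted_swap_def by (metis append_assoc)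
  then show ?case using IH by (simp add: converse_rtranclp_into_rtranclp)
qed simp

text \<open>Bring the first vertex of the target order to the front, then continue with the
  rest.\<close>

lemma (in graphoid) contracted_swaps_connected:
  assumes im: "independence_map V J D" and "topological (us @ xs) D" "topological (us @ ys) D"
    "set (us @ xs) = V" "set xs = set ys" "order_imap J (us @ xs) = D"
  shows "(contracted_swap J)\<^sup>*\<^sup>* (us @ xs) (us @ ys)"
  using assms(2-)
proof (induction ys arbitrary: us xs)
  case (Cons y ys)
  then obtain as bs where xs: "xs = as @ y # bs" using split_list by (metis list.set_intros(1))
  have pa: "parents D y \<subseteq> set us" using topologicalD[OF Cons.prems(2)] by blast
  have b: "(contracted_swap J)\<^sup>*\<^sup>* (us @ as @ y # bs) (us @ y # as @ bs)" "topological (us @ y # as @ bs) D"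
    using contracted_swaps_bubble[OF im _ _ _ pa] Cons.prems xs by auto
  have V: "set ((us @ [y]) @ as @ bs) = V" using Cons.prems(3) xs by auto
  have "order_imap J ((us @ [y]) @ as @ bs) = D"
    using order_imap_eq_prune[OF im Cons.prems(1,3)] order_imap_eq_prune[OF im _ V] b(2) Cons.prems(5) by simp
  moreover have "set (as @ bs) = set ys"
  proof -
    have "y \<notin> set (as @ bs)" using Cons.prems(1) xs by (auto simp: topological_def)
    moreover have "y \<notin> set ys" using Cons.prems(2) by (auto simp: topological_def)
    ultimately show ?thesis using Cons.prems(4) xs by auto
  qed
  ultimately have "(contracted_swap J)\<^sup>*\<^sup>* ((us @ [y]) @ as @ bs) ((us @ [y]) @ ys)"
    using Cons.IH[of "us @ [y]" "as @ bs"] b(2) Cons.prems(2) V by simp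
  then show ?case using b(1) xs by (simp add: rtranclp_trans)
qed simp

text \<open>Supplies the identification for the second and third separating distributions. A
  contracted edge exchanges non-adjacent vertices, and two orders with the same map are joined by
  such exchanges.\<close>

lemma vertices_identified_if_graphoid:
  assumes "graphoid {1..p} J" and rep: "represents {1..p} C J"
  shows "vertices_identified_with_dags p C"
  unfolding vertices_identified_with_dags_def
proof (intro allI impI)
  interpret graphoid "{1..p}" J by (rule assms(1))
  fix \<pi> \<tau> assume \<pi>: "\<pi> permutes {1..p}" and \<tau>: "\<tau> permutes {1..p}"
  have contracted_iff: "(\<rho> k, \<rho> (Suc k), \<rho> ` {1..<k}) \<in> C \<longleftrightarrow> J {a} {b} (set us)"
    if "\<rho> permutes {1..p}" "perm_list p \<rho> = us @ a # b # ws" "a = \<rho> k" "b = \<rho> (Suc k)" "set us = \<rho> ` {1..<k}"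
    for \<rho> k a b us ws
  proof -
    have d: "distinct (us @ a # b # ws)" "set (us @ a # b # ws) = {1..p}"
      using perm_list_permutes[OF that(1)] that(2) by simp_all
    have "a \<in> {1..p}" "b \<in> {1..p}" unfolding d(2)[symmetric] by simp_all
    moreover have "a \<noteq> b" "set us \<subseteq> {1..p} - {a, b}" unfolding d(2)[symmetric] using d(1) by auto
    ultimately show ?thesis using representsD[OF rep] that by metis
  qed
  show "(contracted_edge p C)\<^sup>*\<^sup>* \<pi> \<tau> \<longleftrightarrow> min_imap p C \<pi> = min_imap p C \<tau>"
  proof
    assume "(contracted_edge p C)\<^sup>*\<^sup>* \<pi> \<tau>"
    then show "min_imap p C \<pi> = min_imap p C \<tau>"
    proof (induction rule: rtranclp_induct)
      case (step \<rho> \<sigma>)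
      then obtain k where k: "permutohedron_edge p k \<rho> \<sigma>" "(\<rho> k, \<rho> (Suc k), \<rho> ` {1..<k}) \<in> C"
        by (auto simp: contracted_edge_def)
      obtain us ws where l: "perm_list p \<rho> = us @ \<rho> k # \<rho> (Suc k) # ws" "perm_list p \<sigma> = us @ \<rho> (Suc k) # \<rho> k # ws"
        "set us = \<rho> ` {1..<k}" "\<rho> permutes {1..p}" "\<sigma> permutes {1..p}"
        using permutohedron_edge_perm_list[OF k(1)] by metis
      have d: "distinct (us @ \<rho> k # \<rho> (Suc k) # ws)" "set (us @ \<rho> k # \<rho> (Suc k) # ws) = {1..p}"
        using perm_list_permutes[OF l(4)] l(1) by simp_all
      have "J {\<rho> k} {\<rho> (Suc k)} (set us)" using contracted_iff[OF l(4,1) _ _ l(3)] k(2) by simp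
      moreover have "set (us @ [\<rho> k]) - {\<rho> k} = set us" using d by auto
      ultimately have "(\<rho> k, \<rho> (Suc k)) \<notin> order_imap J ((us @ [\<rho> k]) @ \<rho> (Suc k) # ws)"
        using order_imap_iff[of "us @ [\<rho> k]" "\<rho> (Suc k)" ws "\<rho> k" J] d by simp
      then have "order_imap J (perm_list p \<sigma>) = order_imap J (perm_list p \<rho>)"
        unfolding l(1,2) by (intro order_imap_swap[OF d]) simp
      then show ?case
        using step.IH min_imap_eq_order_imap[OF l(4) rep] min_imap_eq_order_imap[OF l(5) rep] by simp
    qed simp
  next
    assume eq: "min_imap p C \<pi> = min_imap p C \<tau>"
    let ?D = "order_imap J (perm_list p \<pi>)"
    have D: "order_imap J (perm_list p \<tau>) = ?D"
      using eq min_imap_eq_order_imap[OF \<pi> rep] min_imap_eq_order_imap[OF \<tau> rep] by simp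
    have "(contracted_swap J)\<^sup>*\<^sup>* ([] @ perm_list p \<pi>) ([] @ perm_list p \<tau>)"
    proof (rule contracted_swaps_connected)
      show "independence_map {1..p} J ?D" by (rule independence_map_order_imap[OF perm_list_permutes[OF \<pi>]])
      show "topological ([] @ perm_list p \<pi>) ?D" using topological_order_imap[OF perm_list_permutes(1)[OF \<pi>]] by simp
      show "topological ([] @ perm_list p \<tau>) ?D"
        using topological_order_imap[OF perm_list_permutes(1)[OF \<tau>], of J] D by simp
    qed (use perm_list_permutes[OF \<pi>] perm_list_permutes[OF \<tau>] in simp_all)
    then have "\<exists>\<rho>. (contracted_edge p C)\<^sup>*\<^sup>* \<pi> \<rho> \<and> \<rho> permutes {1..p} \<and> perm_list p \<rho> = perm_list p \<tau>"
      unfolding append_Nil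
    proof (induction rule: rtranclp_induct)
      case (step xs ys)
      then obtain \<rho> where \<rho>: "(contracted_edge p C)\<^sup>*\<^sup>* \<pi> \<rho>" "\<rho> permutes {1..p}" "perm_list p \<rho> = xs" by blast
      obtain us a b ws where s: "xs = us @ a # b # ws" "ys = us @ b # a # ws" "J {a} {b} (set us)"
        using step.hyps(2) by (auto simp: contracted_swap_def)
      obtain \<sigma> k where \<sigma>: "permutohedron_edge p k \<rho> \<sigma>" "perm_list p \<sigma> = ys" "\<sigma> permutes {1..p}"
        "a = \<rho> k" "b = \<rho> (Suc k)" "set us = \<rho> ` {1..<k}"
        using permutohedron_edge_of_list[OF \<rho>(2), of us a b ws] \<rho>(3) s by metis
      have "contracted_edge p C \<rho> \<sigma>"
        unfolding contracted_edge_def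
        using contracted_iff[OF \<rho>(2) _ \<sigma>(4-6), of ws] \<rho>(3) s(1,3) \<sigma>(1) by blast
      with \<rho>(1) have "(contracted_edge p C)\<^sup>*\<^sup>* \<pi> \<sigma>" by simp
      then show ?case using \<sigma>(2,3) by blast
    qed (use \<pi> in blast)
    then obtain \<rho> where \<rho>: "(contracted_edge p C)\<^sup>*\<^sup>* \<pi> \<rho>" "\<rho> permutes {1..p}" "perm_list p \<rho> = perm_list p \<tau>"
      by blast
    have "\<rho> = \<tau>"
    proof
      fix i
      show "\<rho> i = \<tau> i"
      proof (cases "i \<in> {1..p}")
        case True
        then obtain k where "i = Suc k" "k < p" by (cases i) auto
        then show ?thesis using nth_perm_list[of k p] \<rho>(3) by metis
      next
        case False
        then show ?thesis using permutes_not_in[OF \<rho>(2)] permutes_not_in[OF \<tau>] by simp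
      qed
    qed
    then show "(contracted_edge p C)\<^sup>*\<^sup>* \<pi> \<tau>" using \<rho>(1) by simp
  qed
qed

lemma markov_equiv_class_reverse:
  assumes G: "dag_on p G" and H: "H \<in> markov_equiv_class p G" and c: "covered_arrow H i j"
  shows "reverse_arrow i j H \<in> markov_equiv_class p G"
proof -
  have dH: "dag_on p H" using H by (simp add: markov_equiv_class_def)
  then have ac: "acyclic H" and sub: "H \<subseteq> {1..p} \<times> {1..p}" by (auto simp: dag_on_def)
  obtain xs where xs: "topological xs H" "set xs = {1..p}" using ex_topological[OF ac _ sub] by auto
  have r: "reverse_arrow i j H \<subseteq> {1..p} \<times> {1..p}"
    "independence_map {1..p} (d_sep (reverse_arrow i j H)) H" "independence_map {1..p} (d_sep H) (reverse_arrow i j H)"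
    using covered_reversal[OF xs sub c] by metis+
  then have "dag_on p (reverse_arrow i j H)" by (simp add: dag_on_def independence_map_def)
  then have "reverse_arrow i j H \<in> markov_equiv_class p H" using markov_equiv_classI[OF dH _ r(3,2)] by blast
  then show ?thesis using H by (auto simp: markov_equiv_class_def)
qed

text \<open>Every Markov DAG contains the minimal independence map of one of its linear extensions,
  which leaves finitely many orders to be checked.\<close>

lemma sparsest_markov_if_order_imaps:
  assumes jd: "joint_distribution p M P" and m: "markov_wrt p M P G"
    and le: "\<And>xs. distinct xs \<Longrightarrow> set xs = {1..p} \<Longrightarrow> card G \<le> card (order_imap (cond_indep M P) xs)"
    and eq: "\<And>xs. distinct xs \<Longrightarrow> set xs = {1..p} \<Longrightarrow> card (order_imap (cond_indep M P) xs) = card G \<Longrightarrow>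
      order_imap (cond_indep M P) xs \<in> markov_equiv_class p G"
  shows "sparsest_markov_assumption p M P G"
  unfolding sparsest_markov_assumption_def
proof (intro conjI allI impI m)
  interpret joint_dist p M P by unfold_locales (rule jd)
  interpret S: semigraphoid "{1..p}" "cond_indep M P" by (rule semigraphoid_cond_indep)
  fix H assume H: "dag_on p H" "H \<notin> markov_equiv_class p G" "markov_wrt p M P H"
  have im: "independence_map {1..p} (cond_indep M P) H" using markov_wrt_iff[OF H(1)] H(3) by blast
  have sub: "H \<subseteq> {1..p} \<times> {1..p}" and ac: "acyclic H" using H(1) by (auto simp: dag_on_def)
  have fin: "finite H" using finite_subset[OF sub] by simp
  obtain xs where xs: "topological xs H" "set xs = {1..p}" using ex_topological[OF ac _ sub] by auto
  then have d: "distinct xs" by (simp add: topological_def)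
  let ?D = "order_imap (cond_indep M P) xs"
  have DH: "?D \<subseteq> H" using S.order_imap_subset_imap[OF im xs] .
  show "card G < card H"
  proof (cases "card ?D = card G")
    case True
    then have "?D \<noteq> H" using eq[OF d xs(2)] H(2) by metis
    then show ?thesis using True DH fin psubset_card_mono by (metis psubsetI)
  next
    case False
    then show ?thesis using le[OF d xs(2)] card_mono[OF fin DH] by simp
  qed
qed

section \<open>Executable minimal independence maps and searches\<close>

fun list_imap_from :: "(nat \<Rightarrow> nat \<Rightarrow> nat list \<Rightarrow> bool) \<Rightarrow> nat list \<Rightarrow> nat list \<Rightarrow> (nat \<times> nat) list" where
  "list_imap_from c us [] = []"
| "list_imap_from c us (y # ws) =
     map (\<lambda>x. (x, y)) (filter (\<lambda>x. \<not> c x y (remove1 x us)) us) @ list_imap_from c (us @ [y]) ws"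

definition list_imap :: "(nat \<Rightarrow> nat \<Rightarrow> nat list \<Rightarrow> bool) \<Rightarrow> nat list \<Rightarrow> (nat \<times> nat) list" where
  "list_imap c xs = list_imap_from c [] xs"

definition list_represents :: "nat set \<Rightarrow> (nat \<Rightarrow> nat \<Rightarrow> nat list \<Rightarrow> bool) \<Rightarrow> (nat set \<Rightarrow> nat set \<Rightarrow> nat set \<Rightarrow> bool) \<Rightarrow> bool" where
  "list_represents V c J \<longleftrightarrow>
     (\<forall>x\<in>V. \<forall>y\<in>V. \<forall>S. x \<noteq> y \<longrightarrow> distinct S \<longrightarrow> set S \<subseteq> V - {x, y} \<longrightarrow> (c x y S \<longleftrightarrow> J {x} {y} (set S)))"

lemma list_imap_from:
  assumes c: "list_represents V c J" and "distinct (us @ xs)" "set (us @ xs) = V"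
  shows "set (list_imap_from c us xs) = {(x, y). (x, y) \<in> order_imap J (us @ xs) \<and> y \<in> set xs}
    \<and> distinct (list_imap_from c us xs)"
  using assms(2,3)
proof (induction xs arbitrary: us)
  case (Cons y ws)
  have IH: "set (list_imap_from c (us @ [y]) ws) = {(x, z). (x, z) \<in> order_imap J (us @ y # ws) \<and> z \<in> set ws}"
    "distinct (list_imap_from c (us @ [y]) ws)"
    using Cons.IH[of "us @ [y]"] Cons.prems by auto
  have c': "c x y (remove1 x us) \<longleftrightarrow> J {x} {y} (set us - {x})" if x: "x \<in> set us" for x
  proof -
    have d: "distinct us" "y \<notin> set us" using Cons.prems(1) by auto
    have "set (remove1 x us) = set us - {x}" "distinct (remove1 x us)" using d by simp_all
    moreover have "set us - {x} \<subseteq> V - {x, y}" "x \<in> V" "y \<in> V" "x \<noteq> y" using Cons.prems(2) d x by auto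
    ultimately show ?thesis using c unfolding list_represents_def by metis
  qed
  have "set (filter (\<lambda>x. \<not> c x y (remove1 x us)) us) = {x. (x, y) \<in> order_imap J (us @ y # ws)}"
    using c' order_imap_iff[OF Cons.prems(1), of _ J] by auto
  then have "set (list_imap_from c us (y # ws)) =
      {(x, z). (x, z) \<in> order_imap J (us @ y # ws) \<and> z = y} \<union> {(x, z). (x, z) \<in> order_imap J (us @ y # ws) \<and> z \<in> set ws}"
    using IH(1) by auto
  moreover have "distinct (list_imap_from c us (y # ws))"
    using IH Cons.prems by (auto simp: distinct_map inj_on_def)
  ultimately show ?case by auto
qed auto

lemma list_imap:
  assumes "list_represents V c J" "distinct xs" "set xs = V"
  shows "order_imap J xs = set (list_imap c xs)" "card (order_imap J xs) = length (list_imap c xs)"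
proof -
  have "set (list_imap c xs) = {(x, y). (x, y) \<in> order_imap J xs \<and> y \<in> set xs} \<and> distinct (list_imap c xs)"
    using list_imap_from[OF assms(1), of "[]" xs] assms(2,3) by (simp add: list_imap_def)
  moreover have "{(x, y). (x, y) \<in> order_imap J xs \<and> y \<in> set xs} = order_imap J xs"
    using order_imap_subset[of J xs] by auto
  ultimately show "order_imap J xs = set (list_imap c xs)" "card (order_imap J xs) = length (list_imap c xs)"
    using distinct_card[of "list_imap c xs"] by auto
qed

text \<open>Depth-bounded search across a plateau of \<open>f\<close>; only its positive answers are
  used.\<close>

fun sparser_within :: "(nat list \<Rightarrow> nat list list) \<Rightarrow> (nat list \<Rightarrow> nat) \<Rightarrow> nat \<Rightarrow> nat list \<Rightarrow> bool" where
  "sparser_within next f 0 xs = False"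
| "sparser_within next f (Suc n) xs =
     list_ex (\<lambda>ys. f ys < f xs \<or> (f ys = f xs \<and> sparser_within next f n ys)) (next xs)"

text \<open>A move between orders may leave the DAG \<open>g xs\<close> unchanged, which is why it
  is matched with zero or more steps of \<open>R\<close>.\<close>

lemma sparser_within_rtranclp:
  assumes "sparser_within next f n xs" "Q xs"
    and "\<And>xs ys. Q xs \<Longrightarrow> ys \<in> set (next xs) \<Longrightarrow> f ys \<le> f xs \<Longrightarrow> Q ys \<and> R\<^sup>*\<^sup>* (g xs) (g ys)"
  shows "\<exists>ys. R\<^sup>*\<^sup>* (g xs) (g ys) \<and> Q ys \<and> f ys < f xs"
  using assms(1,2)
proof (induction n arbitrary: xs)
  case (Suc n)
  then obtain ys where ys: "ys \<in> set (next xs)" "f ys < f xs \<or> (f ys = f xs \<and> sparser_within next f n ys)"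
    by (auto simp: list_ex_iff)
  then have s: "Q ys \<and> R\<^sup>*\<^sup>* (g xs) (g ys)" using assms(3)[OF Suc.prems(2) ys(1)] by linarith
  show ?case
  proof (cases "f ys < f xs")
    case True
    then show ?thesis using s by blast
  next
    case False
    then have "f ys = f xs" "sparser_within next f n ys" using ys by auto
    then obtain zs where "R\<^sup>*\<^sup>* (g ys) (g zs) \<and> Q zs \<and> f zs < f ys" using Suc.IH[of ys] s by blast
    then show ?thesis using s \<open>f ys = f xs\<close> by (metis rtranclp_trans)
  qed
qed simp

fun swaps :: "nat list \<Rightarrow> nat list list" where
  "swaps (a # b # xs) = (b # a # xs) # map ((#) a) (swaps (b # xs))"
| "swaps xs = []"

lemma in_swapsD: "ys \<in> set (swaps xs) \<Longrightarrow> \<exists>us a b ws. xs = us @ a # b # ws \<and> ys = us @ b # a # ws"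
proof (induction xs arbitrary: ys rule: swaps.induct)
  case (1 a b xs)
  show ?case
  proof (cases "ys = b # a # xs")
    case True
    then show ?thesis by (intro exI[of _ "[]"]) simp
  next
    case False
    then obtain zs where zs: "zs \<in> set (swaps (b # xs))" "ys = a # zs" using "1.prems" by auto
    then obtain us c d ws where "b # xs = us @ c # d # ws" "zs = us @ d # c # ws" using "1.IH" by blast
    then show ?thesis using zs by (intro exI[of _ "a # us"]) simp
  qed
qed auto

lemma in_swapsI: "us @ b # a # ws \<in> set (swaps (us @ a # b # ws))"
proof (induction us)
  case (Cons u us)
  then show ?case by (cases us) auto
qed simp

definition list_covered :: "(nat \<times> nat) list \<Rightarrow> nat \<Rightarrow> nat \<Rightarrow> bool" where
  "list_covered D i j \<longleftrightarrow>
     list_all (\<lambda>(a, b). (b = i \<longrightarrow> (a, j) \<in> set D) \<and> (b = j \<longrightarrow> a = i \<or> (a, i) \<in> set D)) D"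

text \<open>One linear extension for each reversed covered arrow: \<open>j\<close> is moved directly
  in front of \<open>i\<close>. In a graphoid the other extensions give the same DAG
  (\<open>covered_step_covered_moves\<close>).\<close>

definition covered_moves :: "(nat \<Rightarrow> nat \<Rightarrow> nat list \<Rightarrow> bool) \<Rightarrow> nat list \<Rightarrow> nat list list" where
  "covered_moves c xs = (let D = list_imap c xs in
     map (\<lambda>(i, j). concat (map (\<lambda>v. if v = i then [j, i] else if v = j then [] else [v]) xs))
       (filter (\<lambda>(i, j). list_covered D i j) D))"

lemma list_covered:
  assumes "(i, j) \<in> set D" "acyclic (set D)"
  shows "list_covered D i j \<longleftrightarrow> covered_arrow (set D) i j"
proof -
  have "(i, i) \<notin> set D" using acyclic_antisym[OF assms(2)] by blast
  then have "covered_arrow (set D) i j \<longleftrightarrow> (\<forall>(a, b)\<in>set D. (b = i \<longrightarrow> (a, j) \<in> set D) \<and> (b = j \<longrightarrow> a = i \<or> (a, i) \<in> set D))"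
    using assms(1) by (auto simp: covered_arrow_def parents_def)
  then show ?thesis by (auto simp: list_covered_def list_all_iff)
qed

lemma covered_moves_step:
  assumes c: "list_represents V c J" and xs: "distinct xs" "set xs = V" and ys: "ys \<in> set (covered_moves c xs)"
    and le: "length (list_imap c ys) \<le> length (list_imap c xs)"
  shows "distinct ys \<and> set ys = V \<and> covered_step V J (order_imap J xs) (order_imap J ys)"
proof -
  let ?D = "order_imap J xs"
  have D: "set (list_imap c xs) = ?D" using list_imap(1)[OF c xs] by simp
  obtain i j where ij: "(i, j) \<in> ?D" "list_covered (list_imap c xs) i j"
    and ys': "ys = concat (map (\<lambda>v. if v = i then [j, i] else if v = j then [] else [v]) xs)"
    using ys D by (auto simp: covered_moves_def Let_def)
  have cov: "covered_arrow ?D i j"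
    using list_covered[of i j "list_imap c xs"] ij D acyclic_order_imap[OF xs(1), of J] by simp
  have sub: "?D \<subseteq> V \<times> V" using order_imap_subset[of J xs] xs by simp
  obtain us vs ws where r: "xs = us @ i # vs @ j # ws" "topological (us @ j # i # vs @ ws) (reverse_arrow i j ?D)"
    using covered_reversal[OF topological_order_imap[OF xs(1)] xs(2) sub cov] by metis
  have id: "concat (map (\<lambda>v. if v = i then [j, i] else if v = j then [] else [v]) zs) = zs"
    if "i \<notin> set zs" "j \<notin> set zs" for zs
    using that by (induction zs) auto
  have "ys = us @ j # i # vs @ ws" using ys' xs(1) r(1) id by auto
  then have t: "topological ys (reverse_arrow i j ?D)" "set ys = V" "distinct ys"
    using r xs by (auto simp: topological_def)
  moreover have "card (order_imap J ys) \<le> card ?D"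
    using le list_imap(2)[OF c xs] list_imap(2)[OF c t(3,2)] by simp
  ultimately show ?thesis unfolding covered_step_def using cov by blast
qed

section \<open>Distributions given by weighted rows\<close>

definition table_weight :: "(nat list \<times> nat) list \<Rightarrow> (nat list \<Rightarrow> bool) \<Rightarrow> nat" where
  "table_weight tab \<phi> = sum_list (map snd (filter (\<phi> \<circ> fst) tab))"

definition table_pmf :: "(nat list \<times> nat) list \<Rightarrow> nat list pmf" where
  "table_pmf tab = pmf_of_list (map (\<lambda>(r, w). (r, real w / real (table_weight tab (\<lambda>_. True)))) tab)"

text \<open>Points of the product space are extensional functions, hence the restricted abstraction;
  list positions start at 0.\<close>

definition row_point :: "nat \<Rightarrow> nat list \<Rightarrow> nat \<Rightarrow> real" where
  "row_point p r = (\<lambda>i\<in>{1..p}. real (r ! (i - 1)))"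

definition table_dist :: "nat \<Rightarrow> (nat list \<times> nat) list \<Rightarrow> (nat \<Rightarrow> real) measure" where
  "table_dist p tab = distr (measure_pmf (table_pmf tab)) (Pi\<^sub>M {1..p} (\<lambda>_. borel)) (row_point p)"

definition agree :: "nat list \<Rightarrow> nat list \<Rightarrow> nat list \<Rightarrow> bool" where
  "agree S r t \<longleftrightarrow> list_all (\<lambda>s. r ! (s - 1) = t ! (s - 1)) S"

text \<open>The product formula with denominators cleared, in natural numbers. Only values occurring
  in the table are tested: \<open>r\<close> supplies those of the condition and of coordinate
  \<open>i\<close>, \<open>r'\<close> that of coordinate \<open>j\<close>.\<close>

definition table_ci :: "(nat list \<times> nat) list \<Rightarrow> nat \<Rightarrow> nat \<Rightarrow> nat list \<Rightarrow> bool" where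
  "table_ci tab i j S \<longleftrightarrow> list_all (\<lambda>(r, _). list_all (\<lambda>(r', _). agree S r r' \<longrightarrow>
     table_weight tab (\<lambda>t. agree S r t \<and> t ! (i - 1) = r ! (i - 1) \<and> t ! (j - 1) = r' ! (j - 1)) *
       table_weight tab (agree S r) =
     table_weight tab (\<lambda>t. agree S r t \<and> t ! (i - 1) = r ! (i - 1)) *
       table_weight tab (\<lambda>t. agree S r t \<and> t ! (j - 1) = r' ! (j - 1))) tab) tab"

locale table =
  fixes p :: nat and tab :: "(nat list \<times> nat) list"
  assumes nonempty: "tab \<noteq> []" and pos: "(r, w) \<in> set tab \<Longrightarrow> w > 0"
begin

abbreviation "q \<equiv> table_pmf tab"
abbreviation "P \<equiv> table_dist p tab"
abbreviation "f \<equiv> row_point p"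
abbreviation "W \<equiv> table_weight tab (\<lambda>_. True)"

lemma W_eq: "W = sum_list (map snd tab)"
  by (simp add: table_weight_def comp_def)

lemma W_pos: "W > 0"
proof (cases tab)
  case (Cons x xs)
  then have "snd x > 0" using pos[of "fst x" "snd x"] by simp
  then show ?thesis by (simp add: Cons table_weight_def)
qed (use nonempty in simp)

lemma sum_list_weights: "sum_list (map (\<lambda>x. real (snd x) / c) xs) = real (sum_list (map snd xs)) / c"
  by (induction xs) (auto simp: add_divide_distrib)

lemma wf: "pmf_of_list_wf (map (\<lambda>(r, w). (r, real w / real W)) tab)" (is "pmf_of_list_wf ?l")
proof (rule pmf_of_list_wfI)
  have "map snd ?l = map (\<lambda>x. real (snd x) / real W) tab" by (auto simp: case_prod_unfold)
  then have "sum_list (map snd ?l) = real (sum_list (map snd tab)) / real W"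
    by (simp only: sum_list_weights)
  then show "sum_list (map snd ?l) = 1" unfolding W_eq[symmetric] using W_pos by simp
qed auto

lemma set_q: "set_pmf q = fst ` set tab"
proof -
  have "set_pmf q = fst ` set (map (\<lambda>(r, w). (r, real w / real W)) tab)"
    unfolding table_pmf_def using pos W_pos by (intro set_pmf_of_list_eq[OF wf]) auto
  then show ?thesis by (simp add: image_image case_prod_unfold)
qed

lemma finite_q: "finite (set_pmf q)"
  by (simp add: set_q)

lemma measure_q: "measure (measure_pmf q) {r. \<phi> r} = table_weight tab \<phi> / W"
proof -
  let ?l = "map (\<lambda>(r, w). (r, real w / real W)) tab"
  have "measure (measure_pmf q) {r. \<phi> r} = sum_list (map snd (filter (\<lambda>x. fst x \<in> {r. \<phi> r}) ?l))"
    unfolding table_pmf_def by (rule measure_pmf_of_list[OF wf])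
  also have "map snd (filter (\<lambda>x. fst x \<in> {r. \<phi> r}) ?l) = map (\<lambda>x. real (snd x) / real W) (filter (\<phi> \<circ> fst) tab)"
    by (simp add: filter_map comp_def case_prod_unfold)
  finally show ?thesis by (simp add: sum_list_weights table_weight_def)
qed

lemma row_point_in_space: "f r \<in> space (Pi\<^sub>M {1..p} (\<lambda>_. borel :: real measure))"
  by (auto simp: row_point_def space_PiM)

lemma measurable_row_point: "f \<in> measurable (measure_pmf q) (Pi\<^sub>M {1..p} (\<lambda>_. borel))"
  using row_point_in_space by simp

lemma joint: "joint_distribution p (\<lambda>_. borel) P"
  unfolding joint_distribution_def table_dist_def
  using prob_space.prob_space_distr[OF prob_space_measure_pmf measurable_row_point] by simp

sublocale joint_dist p "\<lambda>_. borel" P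
  by unfold_locales (rule joint)

lemma row_point_space_P: "f r \<in> space P"
  using row_point_in_space by (simp add: table_dist_def)

lemma prob_eq: "E \<in> sets P \<Longrightarrow> prob E = measure (measure_pmf q) {r. f r \<in> E}"
  using measure_distr[OF measurable_row_point, of E] by (simp add: table_dist_def vimage_def)

lemma AE_P_iff:
  assumes "{\<omega> \<in> space P. Q \<omega>} \<in> sets P"
  shows "(AE \<omega> in P. Q \<omega>) \<longleftrightarrow> (\<forall>r\<in>set_pmf q. Q (f r))"
  using AE_distr_iff[OF measurable_row_point, of Q] assms unfolding table_dist_def
  by (simp only: AE_measure_pmf_iff space_distr sets_distr)

definition cell :: "nat set \<Rightarrow> nat list \<Rightarrow> (nat \<Rightarrow> real) set" where
  "cell S r = {\<omega> \<in> space P. \<forall>s\<in>S. \<omega> s = f r s}"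

lemma cell_in_subalg:
  assumes "S \<subseteq> {1..p}"
  shows "cell S r \<in> sets (subalg S)"
proof -
  have "{\<omega> \<in> space (subalg S). \<forall>s\<in>S. \<omega> s \<in> {f r s}} \<in> sets (subalg S)"
  proof (rule sets.sets_Collect_finite_All)
    fix s assume "s \<in> S"
    then show "{\<omega> \<in> space (subalg S). \<omega> s \<in> {f r s}} \<in> sets (subalg S)"
      using coordinate_in_subalg[OF assms, of s "{f r s}"] by simp
  qed (use assms finite_subset in blast)
  then show ?thesis by (simp add: cell_def)
qed

lemma subalg_depends:
  assumes "S \<subseteq> {1..p}" "E \<in> sets (subalg S)" "\<omega> \<in> space P" "\<omega>' \<in> space P" "\<And>s. s \<in> S \<Longrightarrow> \<omega> s = \<omega>' s"
  shows "\<omega> \<in> E \<longleftrightarrow> \<omega>' \<in> E"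
proof -
  have "restrict \<omega> S = restrict \<omega>' S" using assms(5) by (auto simp: restrict_def)
  then show ?thesis using assms(2-4) unfolding sets_subalg[OF assms(1)] by auto
qed

lemma prob_cell_pos:
  assumes "S \<subseteq> {1..p}" "r \<in> set_pmf q"
  shows "prob (cell S r) > 0"
proof -
  have "prob (cell S r) = measure (measure_pmf q) {t. f t \<in> cell S r}"
    using prob_eq sets_subalg_P[OF assms(1) cell_in_subalg[OF assms(1)]] by blast
  moreover have "measure (measure_pmf q) {r} \<le> measure (measure_pmf q) {t. f t \<in> cell S r}"
    by (rule measure_pmf.finite_measure_mono) (auto simp: cell_def row_point_space_P)
  moreover have "measure (measure_pmf q) {r} > 0" using assms(2) by (simp add: measure_pmf_single pmf_positive)
  ultimately show ?thesis by linarith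
qed

text \<open>A function measurable for \<open>subalg S\<close> is constant on the cell, so
  integrating it over the cell multiplies its value by the mass of the cell.\<close>

lemma cond_exp_cell:
  assumes S: "S \<subseteq> {1..p}" and E: "E \<in> sets P"
  shows "real_cond_exp P (subalg S) (indicator E) (f r) * prob (cell S r) = prob (E \<inter> cell S r)"
proof -
  interpret F: finite_measure_subalgebra P "subalg S" by (rule finite_measure_subalgebra[OF S])
  let ?h = "real_cond_exp P (subalg S) (indicator E)" and ?K = "cell S r"
  have K: "?K \<in> sets (subalg S)" "?K \<in> sets P" using cell_in_subalg[OF S] sets_subalg_P[OF S] by auto
  have const: "?h \<omega> = ?h (f r)" if "\<omega> \<in> ?K" for \<omega>
  proof -
    have "?h -` {?h (f r)} \<inter> space (subalg S) \<in> sets (subalg S)"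
      by (rule measurable_sets[of _ _ borel]) auto
    then show ?thesis
      using subalg_depends[OF S, of "?h -` {?h (f r)} \<inter> space P" \<omega> "f r"] that row_point_space_P
      by (auto simp: cell_def)
  qed
  have "prob (E \<inter> ?K) = (\<integral>x\<in>?K. indicator E x \<partial>P)"
    using E K by (simp add: set_lebesgue_integral_def indicator_inter_arith[symmetric] Int_commute)
  also have "\<dots> = (\<integral>x\<in>?K. ?h x \<partial>P)"
    by (rule F.real_cond_exp_intA[OF integrable_indicator_P[OF E] K(1)])
  also have "\<dots> = (\<integral>x\<in>?K. ?h (f r) \<partial>P)"
    unfolding set_lebesgue_integral_def
    by (rule Bochner_Integration.integral_cong) (auto simp: indicator_def const)
  also have "\<dots> = ?h (f r) * prob ?K"
    using K by (simp add: set_lebesgue_integral_def)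
  finally show ?thesis by simp
qed

text \<open>The cell of an atom has positive mass; multiplying by its square turns the equation
  between conditional expectations into one between probabilities.\<close>

lemma cond_indep_iff_cells:
  assumes sub: "A \<subseteq> {1..p}" "B \<subseteq> {1..p}" "S \<subseteq> {1..p}"
  shows "cond_indep (\<lambda>_. borel) P A B S \<longleftrightarrow>
    (\<forall>E\<in>sets (subalg A). \<forall>F\<in>sets (subalg B). \<forall>r\<in>set_pmf q.
       prob (E \<inter> F \<inter> cell S r) * prob (cell S r) = prob (E \<inter> cell S r) * prob (F \<inter> cell S r))"
  unfolding cond_indep_def
proof (intro ball_cong refl)
  fix E F assume E: "E \<in> sets (subalg A)" and F: "F \<in> sets (subalg B)"
  have EP: "E \<in> sets P" "F \<in> sets P" using sets_subalg_P[OF sub(1) E] sets_subalg_P[OF sub(2) F] .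
  let ?h = "\<lambda>E. real_cond_exp P (subalg S) (indicator E)"
  have "{\<omega> \<in> space P. ?h (E \<inter> F) \<omega> = ?h E \<omega> * ?h F \<omega>} \<in> sets P"
    by measurable
  then have "(AE \<omega> in P. ?h (E \<inter> F) \<omega> = ?h E \<omega> * ?h F \<omega>) \<longleftrightarrow> (\<forall>r\<in>set_pmf q. ?h (E \<inter> F) (f r) = ?h E (f r) * ?h F (f r))"
    by (rule AE_P_iff)
  also have "\<dots> \<longleftrightarrow> (\<forall>r\<in>set_pmf q.
       prob (E \<inter> F \<inter> cell S r) * prob (cell S r) = prob (E \<inter> cell S r) * prob (F \<inter> cell S r))"
  proof (rule ball_cong[OF refl])
    fix r assume "r \<in> set_pmf q"
    then have "prob (cell S r) > 0" using prob_cell_pos sub by blast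
    then show "?h (E \<inter> F) (f r) = ?h E (f r) * ?h F (f r) \<longleftrightarrow>
        prob (E \<inter> F \<inter> cell S r) * prob (cell S r) = prob (E \<inter> cell S r) * prob (F \<inter> cell S r)"
      unfolding cond_exp_cell[OF sub(3) EP(1), symmetric] cond_exp_cell[OF sub(3) EP(2), symmetric]
        cond_exp_cell[OF sub(3) sets.Int[OF EP], symmetric] by auto
  qed
  finally show "(AE \<omega> in P. ?h (E \<inter> F) \<omega> = ?h E \<omega> * ?h F \<omega>) \<longleftrightarrow> (\<forall>r\<in>set_pmf q.
       prob (E \<inter> F \<inter> cell S r) * prob (cell S r) = prob (E \<inter> cell S r) * prob (F \<inter> cell S r))" .
qed

lemma measure_q_sum: "measure (measure_pmf q) {t. \<phi> t} = (\<Sum>t\<in>{t\<in>set_pmf q. \<phi> t}. pmf q t)"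
proof -
  have "measure (measure_pmf q) {t. \<phi> t} = measure (measure_pmf q) ({t. \<phi> t} \<inter> set_pmf q)"
    by (rule measure_Int_set_pmf[symmetric])
  also have "{t. \<phi> t} \<inter> set_pmf q = {t\<in>set_pmf q. \<phi> t}" by auto
  finally show ?thesis using finite_q by (simp add: measure_measure_pmf_finite)
qed

lemma row_point_eq_iff: "s \<in> {1..p} \<Longrightarrow> f r s = f t s \<longleftrightarrow> r ! (s - 1) = t ! (s - 1)"
  by (simp add: row_point_def)

lemma row_point_in_cell: "set S \<subseteq> {1..p} \<Longrightarrow> f t \<in> cell (set S) r \<longleftrightarrow> agree S r t"
  using row_point_eq_iff row_point_space_P by (fastforce simp: cell_def agree_def list_all_iff)

text \<open>Within a cell, an event about one coordinate amounts to a finite set of values. The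
  product formula is bilinear, so summing it over single values gives it for events.\<close>

theorem cond_indep_iff_table_ci:
  assumes ij: "i \<in> {1..p}" "j \<in> {1..p}" and S: "set S \<subseteq> {1..p}"
  shows "cond_indep (\<lambda>_. borel) P {i} {j} (set S) \<longleftrightarrow> table_ci tab i j S"
proof -
  define m where "m r \<phi> = (\<Sum>t\<in>{t\<in>set_pmf q. agree S r t \<and> \<phi> t}. pmf q t)" for r \<phi>
  let ?v = "\<lambda>k t. t ! (k - 1)"
  have weight: "real (table_weight tab (\<lambda>t. agree S r t \<and> \<phi> t)) = m r \<phi> * W" for r \<phi>
    using measure_q[of "\<lambda>t. agree S r t \<and> \<phi> t"] measure_q_sum[of "\<lambda>t. agree S r t \<and> \<phi> t"] W_pos
    by (simp add: m_def field_simps)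
  have "table_weight tab (agree S r) = table_weight tab (\<lambda>t. agree S r t \<and> True)" for r
    by (simp add: table_weight_def comp_def)
  then have weight': "real (table_weight tab (agree S r)) = m r (\<lambda>_. True) * W" for r
    using weight[of r "\<lambda>_. True"] by simp
  have table: "table_ci tab i j S \<longleftrightarrow> (\<forall>r\<in>set_pmf q. \<forall>r'\<in>set_pmf q. agree S r r' \<longrightarrow>
      m r (\<lambda>t. ?v i t = ?v i r \<and> ?v j t = ?v j r') * m r (\<lambda>_. True) = m r (\<lambda>t. ?v i t = ?v i r) * m r (\<lambda>t. ?v j t = ?v j r'))"
  proof -
    \<comment> \<open>Both sides are products of two weights, so the normalising factor
      \<open>W\<close> cancels.\<close>
    have eq: "a * b = c * d \<longleftrightarrow> x * y = z * w"
      if "real a = x * W" "real b = y * W" "real c = z * W" "real d = w * W" for a b c d :: nat and x y z w :: real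
    proof -
      have "a * b = c * d \<longleftrightarrow> real a * real b = real c * real d" by (metis of_nat_eq_iff of_nat_mult)
      also have "\<dots> \<longleftrightarrow> (x * y) * (real W * real W) = (z * w) * (real W * real W)"
        unfolding that by (simp add: ac_simps)
      finally show ?thesis using W_pos by simp
    qed
    show ?thesis
      unfolding table_ci_def list_all_iff set_q
      by (simp add: eq[OF weight weight' weight weight] case_prod_unfold)
  qed
  have cells: "prob (E \<inter> cell (set S) r) = m r (\<lambda>t. f t \<in> E)" if "E \<in> sets P" for E r
  proof -
    have "E \<inter> cell (set S) r \<in> sets P" using that sets_subalg_P[OF S cell_in_subalg[OF S]] by blast
    then have "prob (E \<inter> cell (set S) r) = measure (measure_pmf q) {t. agree S r t \<and> f t \<in> E}"
      using prob_eq row_point_in_cell[OF S] by (simp add: conj_commute)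
    then show ?thesis by (simp add: measure_q_sum m_def)
  qed
  have cell: "prob (cell (set S) r) = m r (\<lambda>_. True)" for r
  proof -
    have "cell (set S) r \<in> sets P" using sets_subalg_P[OF S cell_in_subalg[OF S]] by blast
    then have "prob (cell (set S) r) = measure (measure_pmf q) {t. agree S r t \<and> True}"
      using prob_eq row_point_in_cell[OF S] by simp
    then show ?thesis by (simp add: measure_q_sum m_def)
  qed
  have sub: "{i} \<subseteq> {1..p}" "{j} \<subseteq> {1..p}" using ij by auto
  have agree_trans: "agree S r = agree S r'" if "agree S r r'" for r r'
    using that by (auto simp: agree_def list_all_iff fun_eq_iff)
  show ?thesis
    unfolding cond_indep_iff_cells[OF sub S] table
  proof
    assume ci: "\<forall>E\<in>sets (subalg {i}). \<forall>F\<in>sets (subalg {j}). \<forall>r\<in>set_pmf q.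
       prob (E \<inter> F \<inter> cell (set S) r) * prob (cell (set S) r) = prob (E \<inter> cell (set S) r) * prob (F \<inter> cell (set S) r)"
    show "\<forall>r\<in>set_pmf q. \<forall>r'\<in>set_pmf q. agree S r r' \<longrightarrow>
      m r (\<lambda>t. ?v i t = ?v i r \<and> ?v j t = ?v j r') * m r (\<lambda>_. True) = m r (\<lambda>t. ?v i t = ?v i r) * m r (\<lambda>t. ?v j t = ?v j r')"
    proof (intro ballI impI)
      fix r r' assume r: "r \<in> set_pmf q" "r' \<in> set_pmf q" "agree S r r'"
      define E where "E = {\<omega> \<in> space P. \<omega> i \<in> {f r i}}"
      define F where "F = {\<omega> \<in> space P. \<omega> j \<in> {f r' j}}"
      have EF: "E \<in> sets (subalg {i})" "F \<in> sets (subalg {j})"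
        unfolding E_def F_def by (rule coordinate_in_subalg; use ij in simp)+
      then have EP: "E \<in> sets P" "F \<in> sets P" using sets_subalg_P[OF sub(1)] sets_subalg_P[OF sub(2)] by blast+
      have in_EF: "f t \<in> E \<longleftrightarrow> ?v i t = ?v i r" "f t \<in> F \<longleftrightarrow> ?v j t = ?v j r'" for t
        using row_point_space_P row_point_eq_iff ij by (auto simp: E_def F_def)
      show "m r (\<lambda>t. ?v i t = ?v i r \<and> ?v j t = ?v j r') * m r (\<lambda>_. True) = m r (\<lambda>t. ?v i t = ?v i r) * m r (\<lambda>t. ?v j t = ?v j r')"
        using ci[rule_format, OF EF r(1)] cells[OF EP(1)] cells[OF EP(2)] cells[OF sets.Int[OF EP]] cell
        by (simp add: in_EF)
    qed
  next
    assume t: "\<forall>r\<in>set_pmf q. \<forall>r'\<in>set_pmf q. agree S r r' \<longrightarrow>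
      m r (\<lambda>t. ?v i t = ?v i r \<and> ?v j t = ?v j r') * m r (\<lambda>_. True) = m r (\<lambda>t. ?v i t = ?v i r) * m r (\<lambda>t. ?v j t = ?v j r')"
    show "\<forall>E\<in>sets (subalg {i}). \<forall>F\<in>sets (subalg {j}). \<forall>r\<in>set_pmf q.
       prob (E \<inter> F \<inter> cell (set S) r) * prob (cell (set S) r) = prob (E \<inter> cell (set S) r) * prob (F \<inter> cell (set S) r)"
    proof (intro ballI)
      fix E F r assume E: "E \<in> sets (subalg {i})" and F: "F \<in> sets (subalg {j})" and r: "r \<in> set_pmf q"
      have EP: "E \<in> sets P" "F \<in> sets P" using sets_subalg_P[OF sub(1) E] sets_subalg_P[OF sub(2) F] .
      define T where "T = {t\<in>set_pmf q. agree S r t}"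
      have fin: "finite T" using finite_q by (simp add: T_def)
      \<comment> \<open>On the cell of \<open>r\<close>, the finite sets \<open>X\<close> and
        \<open>Y\<close> of values determine the events \<open>E\<close> and
        \<open>F\<close>.\<close>
      define X where "X = ?v i ` {t\<in>T. f t \<in> E}"
      define Y where "Y = ?v j ` {t\<in>T. f t \<in> F}"
      have finXY: "finite X" "finite Y" using fin by (auto simp: X_def Y_def)
      have inX: "f t \<in> E \<longleftrightarrow> ?v i t \<in> X" if "t \<in> T" for t
      proof
        assume "?v i t \<in> X"
        then obtain t' where t': "t' \<in> T" "f t' \<in> E" "?v i t = ?v i t'" by (auto simp: X_def)
        then show "f t \<in> E"
          using subalg_depends[OF sub(1) E, of "f t" "f t'"] row_point_space_P row_point_eq_iff[OF ij(1)] by auto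
      qed (use that in \<open>auto simp: X_def\<close>)
      have inY: "f t \<in> F \<longleftrightarrow> ?v j t \<in> Y" if "t \<in> T" for t
      proof
        assume "?v j t \<in> Y"
        then obtain t' where t': "t' \<in> T" "f t' \<in> F" "?v j t = ?v j t'" by (auto simp: Y_def)
        then show "f t \<in> F"
          using subalg_depends[OF sub(2) F, of "f t" "f t'"] row_point_space_P row_point_eq_iff[OF ij(2)] by auto
      qed (use that in \<open>auto simp: Y_def\<close>)
      have m: "m r \<phi> = (\<Sum>t\<in>{t\<in>T. \<phi> t}. pmf q t)" for \<phi>
        unfolding m_def T_def by (rule sum.cong) auto
      have group: "m r (\<lambda>t. g t \<in> Z) = (\<Sum>z\<in>Z. m r (\<lambda>t. g t = z))" if "finite Z" for g :: "nat list \<Rightarrow> 'z" and Z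
      proof -
        have "m r (\<lambda>t. g t \<in> Z) = (\<Sum>z\<in>Z. \<Sum>t\<in>{t\<in>{t\<in>T. g t \<in> Z}. g t = z}. pmf q t)"
          unfolding m by (rule sum.group[symmetric]) (use fin that in auto)
        also have "\<dots> = (\<Sum>z\<in>Z. m r (\<lambda>t. g t = z))"
          unfolding m by (intro sum.cong refl) auto
        finally show ?thesis .
      qed
      have mE: "m r (\<lambda>t. f t \<in> E) = (\<Sum>a\<in>X. m r (\<lambda>t. ?v i t = a))"
      proof -
        have "m r (\<lambda>t. f t \<in> E) = m r (\<lambda>t. ?v i t \<in> X)" unfolding m using inX by (intro sum.cong) auto
        also have "\<dots> = (\<Sum>a\<in>X. m r (\<lambda>t. ?v i t = a))" by (rule group[OF finXY(1)])
        finally show ?thesis .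
      qed
      have mF: "m r (\<lambda>t. f t \<in> F) = (\<Sum>b\<in>Y. m r (\<lambda>t. ?v j t = b))"
      proof -
        have "m r (\<lambda>t. f t \<in> F) = m r (\<lambda>t. ?v j t \<in> Y)" unfolding m using inY by (intro sum.cong) auto
        also have "\<dots> = (\<Sum>b\<in>Y. m r (\<lambda>t. ?v j t = b))" by (rule group[OF finXY(2)])
        finally show ?thesis .
      qed
      have "m r (\<lambda>t. f t \<in> E \<inter> F) = m r (\<lambda>t. (?v i t, ?v j t) \<in> X \<times> Y)"
        unfolding m using inX inY by (intro sum.cong) auto
      also have "\<dots> = (\<Sum>z\<in>X \<times> Y. m r (\<lambda>t. (?v i t, ?v j t) = z))"
        by (rule group) (use finXY in simp)
      also have "\<dots> = (\<Sum>(a, b)\<in>X \<times> Y. m r (\<lambda>t. ?v i t = a \<and> ?v j t = b))"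
        by (rule sum.cong) auto
      finally have mEF: "m r (\<lambda>t. f t \<in> E \<inter> F) = (\<Sum>(a, b)\<in>X \<times> Y. m r (\<lambda>t. ?v i t = a \<and> ?v j t = b))" .
      \<comment> \<open>The values \<open>a\<close> and \<open>b\<close> may stem from different
        rows of the cell, which is why \<open>table_ci\<close> runs over pairs of rows.\<close>
      have pt: "m r (\<lambda>t. ?v i t = a \<and> ?v j t = b) * m r (\<lambda>_. True) = m r (\<lambda>t. ?v i t = a) * m r (\<lambda>t. ?v j t = b)"
        if ab: "a \<in> X" "b \<in> Y" for a b
      proof -
        obtain t t' where tt: "t \<in> T" "a = ?v i t" "t' \<in> T" "b = ?v j t'" using ab by (auto simp: X_def Y_def)
        then have "agree S r = agree S t" "agree S r = agree S t'" using agree_trans by (auto simp: T_def)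
        then have mt: "m t = m r" and att: "agree S t t'" using tt by (auto simp: m_def T_def fun_eq_iff)
        have "t \<in> set_pmf q" "t' \<in> set_pmf q" using tt by (simp_all add: T_def)
        from t[rule_format, OF this att] show ?thesis unfolding mt tt(2,4) .
      qed
      have "m r (\<lambda>t. f t \<in> E \<inter> F) * m r (\<lambda>_. True) =
          (\<Sum>(a, b)\<in>X \<times> Y. m r (\<lambda>t. ?v i t = a) * m r (\<lambda>t. ?v j t = b))"
        unfolding mEF sum_distrib_right using pt by (intro sum.cong) auto
      also have "\<dots> = m r (\<lambda>t. f t \<in> E) * m r (\<lambda>t. f t \<in> F)"
        unfolding mE mF by (simp add: sum_product sum.cartesian_product)
      finally show "prob (E \<inter> F \<inter> cell (set S) r) * prob (cell (set S) r) = prob (E \<inter> cell (set S) r) * prob (F \<inter> cell (set S) r)"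
        using cells[OF EP(1)] cells[OF EP(2)] cells[OF sets.Int[OF EP]] cell by simp
    qed
  qed
qed

end

section \<open>The separating distributions\<close>

definition check_ci :: "nat \<Rightarrow> (nat \<Rightarrow> nat \<Rightarrow> nat set \<Rightarrow> bool) \<Rightarrow> (nat list \<times> nat) list \<Rightarrow> bool" where
  "check_ci p ci tab \<longleftrightarrow> list_all (\<lambda>x. list_all (\<lambda>y. x = y \<or>
     list_all (\<lambda>S. ci x y (set S) \<longleftrightarrow> table_ci tab x y S) (List.subseqs (filter (\<lambda>s. s \<notin> {x, y}) [1..<Suc p])))
     [1..<Suc p]) [1..<Suc p]"

definition check_intersection :: "nat \<Rightarrow> (nat \<Rightarrow> nat \<Rightarrow> nat set \<Rightarrow> bool) \<Rightarrow> bool" where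
  "check_intersection p ci \<longleftrightarrow> list_all (\<lambda>i. list_all (\<lambda>x. list_all (\<lambda>y. i = x \<or> i = y \<or> x = y \<or>
     list_all (\<lambda>S. ci i x (set (y # S)) \<and> ci i y (set (x # S)) \<longrightarrow> ci i x (set S))
       (List.subseqs (filter (\<lambda>s. s \<notin> {i, x, y}) [1..<Suc p])))
     [1..<Suc p]) [1..<Suc p]) [1..<Suc p]"

lemma ex_subseq:
  assumes "S \<subseteq> {1..p} - A"
  obtains S' where "S' \<in> set (List.subseqs (filter (\<lambda>s. s \<notin> A) [1..<Suc p]))" "set S' = S"
proof -
  have "S \<in> set ` set (List.subseqs (filter (\<lambda>s. s \<notin> A) [1..<Suc p]))"
    unfolding List.subseqs_powset using assms by auto
  then show thesis using that by blast
qed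

lemma in_permutations:
  assumes "distinct xs" "set xs = {1..p}"
  shows "xs \<in> set (permutations_of_set_list [1..<Suc p])"
proof -
  have "{1..p} = set [1..<Suc p]" by (simp add: atLeastLessThanSuc_atLeastAtMost del: upt_Suc)
  then have "xs \<in> permutations_of_set (set [1..<Suc p])" using assms by (auto simp del: upt_Suc)
  then show ?thesis unfolding permutations_of_list by (simp add: distinct_remdups_id del: upt_Suc)
qed

text \<open>\<open>ci\<close> is a closed form of the independences of the table. It is compared
  with the table once, and the searches then evaluate \<open>ci\<close> alone.\<close>

locale table_model = table +
  fixes ci :: "nat \<Rightarrow> nat \<Rightarrow> nat set \<Rightarrow> bool"
  assumes check: "check_ci p ci tab"
begin

abbreviation "V \<equiv> {1..p}"
abbreviation "J \<equiv> cond_indep (\<lambda>_. borel :: real measure) P"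
abbreviation "C \<equiv> ci_relations p (\<lambda>_. borel :: real measure) P"
abbreviation "c \<equiv> (\<lambda>x y S. ci x y (set S))"
abbreviation "is_order xs \<equiv> distinct xs \<and> set xs = V"

lemma ci_iff:
  assumes "x \<in> V" "y \<in> V" "x \<noteq> y" "S \<subseteq> V - {x, y}"
  shows "ci x y S \<longleftrightarrow> J {x} {y} S"
proof -
  obtain S' where S': "S' \<in> set (List.subseqs (filter (\<lambda>s. s \<notin> {x, y}) [1..<Suc p]))" "set S' = S"
    using ex_subseq[OF assms(4)] .
  have "x \<in> set [1..<Suc p]" "y \<in> set [1..<Suc p]" using assms(1,2) by (auto simp del: upt_Suc)
  then have "ci x y (set S') \<longleftrightarrow> table_ci tab x y S'"
    using check S'(1) assms(3) unfolding check_ci_def list_all_iff by blast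
  then show ?thesis using cond_indep_iff_table_ci[OF assms(1,2), of S'] S'(2) assms(4) by auto
qed

lemma list_rep: "list_represents V c J"
  unfolding list_represents_def using ci_iff by simp

lemma rep: "represents V C J"
  by (rule represents_ci_relations)

sublocale S: semigraphoid V J
  by (rule semigraphoid_cond_indep)

lemma graphoid_if_check:
  assumes "check_intersection p ci"
  shows "graphoid V J"
proof unfold_locales
  fix i x y S
  assume V: "i \<in> V" "x \<in> V" "y \<in> V" "i \<noteq> x" "i \<noteq> y" "x \<noteq> y" "S \<subseteq> V - {i, x, y}"
    and J: "J {i} {x} (insert y S)" "J {i} {y} (insert x S)"
  obtain S' where S': "S' \<in> set (List.subseqs (filter (\<lambda>s. s \<notin> {i, x, y}) [1..<Suc p]))" "set S' = S"
    using ex_subseq[OF V(7)] .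
  have "i \<in> set [1..<Suc p]" "x \<in> set [1..<Suc p]" "y \<in> set [1..<Suc p]" using V by (auto simp del: upt_Suc)
  then have "ci i x (set (y # S')) \<and> ci i y (set (x # S')) \<longrightarrow> ci i x (set S')"
    using assms S'(1) V(4-6) unfolding check_intersection_def list_all_iff by blast
  then have "ci i x (insert y S) \<Longrightarrow> ci i y (insert x S) \<Longrightarrow> ci i x S" using S'(2) by simp
  moreover have "ci i x (insert y S)" using J(1) V by (subst ci_iff) auto
  moreover have "ci i y (insert x S)" using J(2) V by (subst ci_iff) auto
  moreover have "ci i x S \<longleftrightarrow> J {i} {x} S" using V by (intro ci_iff) auto
  ultimately show "J {i} {x} S" by blast
qed

lemma imap_list: "is_order xs \<Longrightarrow> order_imap J xs = set (list_imap c xs)"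
  using list_imap(1)[OF list_rep] by simp

lemma card_imap_list: "is_order xs \<Longrightarrow> card (order_imap J xs) = length (list_imap c xs)"
  using list_imap(2)[OF list_rep] by simp

lemma dag_order_imap: "is_order xs \<Longrightarrow> dag_on p (order_imap J xs)"
  using acyclic_order_imap[of xs J] order_imap_subset[of J xs] by (simp add: dag_on_def)

end

text \<open>The depth 5 is a search bound that suffices for both uses, \<open>search1\<close> and
  \<open>search2\<close>.\<close>

definition all_equiv_or_sparser ::
    "(nat \<Rightarrow> nat \<Rightarrow> nat list \<Rightarrow> bool) \<Rightarrow> nat \<Rightarrow> (nat list \<Rightarrow> nat list list) \<Rightarrow> nat \<Rightarrow> (nat \<times> nat) list list \<Rightarrow> bool" where
  "all_equiv_or_sparser c p next m Gs \<longleftrightarrow> list_all (\<lambda>xs. let D = list_imap c xs in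
     if length D \<le> m then list_ex (\<lambda>G. set D = set G) Gs
     else sparser_within next (\<lambda>xs. length (list_imap c xs)) 5 xs) (permutations_of_set_list [1..<Suc p])"

lemma all_equiv_or_sparserD:
  assumes "all_equiv_or_sparser c p next m Gs" "distinct xs" "set xs = {1..p}"
  shows "(length (list_imap c xs) \<le> m \<and> (\<exists>G\<in>set Gs. set (list_imap c xs) = set G)) \<or>
    sparser_within next (\<lambda>xs. length (list_imap c xs)) 5 xs"
  using assms(1) in_permutations[OF assms(2,3)]
  unfolding all_equiv_or_sparser_def list_all_iff list_ex_iff Let_def by (auto split: if_splits)

definition ci1 :: "nat \<Rightarrow> nat \<Rightarrow> nat set \<Rightarrow> bool" where
  "ci1 x y S \<longleftrightarrow> (\<exists>s\<in>S. min x y < s \<and> s < max x y) \<or> (min x y = 2 \<and> max x y = 4 \<and> S = {1, 5})"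

text \<open>The DAG with arrows from 3 and 4 to 1 and 2 has the d-separations of 3 and 4 given
  nothing and of 1 and 2 given \<open>{3, 4}\<close>. The other independences of 1 and 2 are added;
  they create the plateau of \<open>closed2\<close>.\<close>

definition ci2 :: "nat \<Rightarrow> nat \<Rightarrow> nat set \<Rightarrow> bool" where
  "ci2 x y S \<longleftrightarrow> (min x y = 1 \<and> max x y = 2 \<and> S \<noteq> {}) \<or> (min x y = 3 \<and> max x y = 4 \<and> S = {})"

text \<open>The DAG with arrows from 1 and 4 to 2 and 3 accounts for all relations except the
  marginal independence of 2 and 3, which is added to create the trap of
  \<open>closed3\<close>.\<close>

definition ci3 :: "nat \<Rightarrow> nat \<Rightarrow> nat set \<Rightarrow> bool" where
  "ci3 x y S \<longleftrightarrow> (min x y = 1 \<and> max x y = 4 \<and> S = {}) \<or>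
     (min x y = 2 \<and> max x y = 3 \<and> (S = {} \<or> S = {1, 4}))"

text \<open>Each row lists the values of \<open>X\<^sub>1, \<dots>, X\<^sub>p\<close> at an atom, followed by its weight. The tables were found
  by a computer search; their independences are exactly \<open>ci1\<close>, \<open>ci2\<close> and \<open>ci3\<close>. The first one is the chain
  \<open>1 \<rightarrow> 2 \<rightarrow> 3 \<rightarrow> 4 \<rightarrow> 5\<close> with the additional relation \<open>2 \<bottom> 4 | {1, 5}\<close>.\<close>

definition tab1 :: "(nat list \<times> nat) list" where
  "tab1 = [([0,0,1,0,0], 2), ([0,0,2,1,1], 2), ([1,1,0,0,0], 2), ([1,1,0,2,1], 2), ([1,1,2,1,1], 2), ([1,2,1,0,0], 1)]"

definition tab2 :: "(nat list \<times> nat) list" where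
  "tab2 = [([1,1,0,1], 2), ([0,0,1,0], 1), ([0,1,0,0], 2), ([0,1,1,1], 1)]"

definition tab3 :: "(nat list \<times> nat) list" where
  "tab3 = [([1,0,1,1], 3), ([0,1,0,1], 1), ([0,0,1,0], 3), ([1,0,0,0], 3), ([0,1,1,1], 2)]"

lemma triangle_steps_min_imap:
  assumes "(triangle_step p C)\<^sup>*\<^sup>* (min_imap p C \<pi>) R" "\<pi> permutes {1..p}"
  shows "\<exists>\<rho>. \<rho> permutes {1..p} \<and> R = min_imap p C \<rho>"
  using assms(1)
  by (cases rule: rtranclp.cases) (use assms(2) in \<open>auto simp: triangle_step_def linear_extension_def\<close>)

lemma markov_equiv_class_refl: "dag_on p G \<Longrightarrow> G \<in> markov_equiv_class p G"
  by (simp add: markov_equiv_class_def)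

text \<open>One order per DAG is enough here: in a graphoid the covered steps from a DAG do not
  depend on the order that represents it.\<close>

definition closed_under_covered_moves :: "(nat \<Rightarrow> nat \<Rightarrow> nat list \<Rightarrow> bool) \<Rightarrow> nat \<Rightarrow> nat list list \<Rightarrow> bool" where
  "closed_under_covered_moves c n Ks \<longleftrightarrow> list_all (\<lambda>xs. length (list_imap c xs) = n \<and>
     list_all (\<lambda>ys. length (list_imap c ys) \<le> n \<longrightarrow>
       list_ex (\<lambda>zs. set (list_imap c ys) = set (list_imap c zs)) Ks) (covered_moves c xs)) Ks"

text \<open>Different orders of the same DAG have different neighbours, so all orders whose DAG is
  represented in \<open>Ks\<close> have to be examined.\<close>

definition closed_under_swaps :: "(nat \<Rightarrow> nat \<Rightarrow> nat list \<Rightarrow> bool) \<Rightarrow> nat \<Rightarrow> nat \<Rightarrow> nat list list \<Rightarrow> bool" where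
  "closed_under_swaps c p n Ks \<longleftrightarrow> list_all (\<lambda>xs. length (list_imap c xs) = n) Ks \<and>
     list_all (\<lambda>xs. list_ex (\<lambda>zs. set (list_imap c xs) = set (list_imap c zs)) Ks \<longrightarrow>
       list_all (\<lambda>ys. length (list_imap c ys) \<le> n \<longrightarrow>
         list_ex (\<lambda>zs. set (list_imap c ys) = set (list_imap c zs)) Ks) (swaps xs))
     (permutations_of_set_list [1..<Suc p])"

text \<open>All linear extensions of the reversed DAG have the same minimal independence map, so the
  extension chosen by \<open>covered_moves\<close> represents them all.\<close>

lemma (in graphoid) covered_step_covered_moves:
  assumes c: "list_represents V c J" and xs: "distinct xs" "set xs = V" and s: "covered_step V J (order_imap J xs) E"
  shows "\<exists>ys\<in>set (covered_moves c xs). distinct ys \<and> set ys = V \<and> E = order_imap J ys"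
proof -
  let ?D = "order_imap J xs"
  obtain i j zs where cov: "covered_arrow ?D i j" and zs: "set zs = V" "topological zs (reverse_arrow i j ?D)"
    and E: "E = order_imap J zs" using s by (auto simp: covered_step_def)
  have sub: "?D \<subseteq> V \<times> V" using order_imap_subset[of J xs] xs by simp
  obtain us vs ws where r: "xs = us @ i # vs @ j # ws" "topological (us @ j # i # vs @ ws) (reverse_arrow i j ?D)"
    using covered_reversal[OF topological_order_imap[OF xs(1)] xs(2) sub cov] by metis
  let ?ys = "us @ j # i # vs @ ws"
  have V: "set ?ys = V" unfolding xs(2)[symmetric] r(1) by auto
  have im: "independence_map V J (reverse_arrow i j ?D)" using covered_step_reverse(3)[OF xs cov zs(2,1)] .
  have "E = order_imap J ?ys"
    using order_imap_eq_prune[OF im zs(2,1)] order_imap_eq_prune[OF im r(2) V] E by metis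
  moreover have "distinct ?ys" using r(2) by (simp add: topological_def)
  moreover have "?ys \<in> set (covered_moves c xs)"
  proof -
    have id: "concat (map (\<lambda>v. if v = i then [j, i] else if v = j then [] else [v]) zs) = zs"
      if "i \<notin> set zs" "j \<notin> set zs" for zs
      using that by (induction zs) auto
    have "concat (map (\<lambda>v. if v = i then [j, i] else if v = j then [] else [v]) xs) = ?ys"
      using xs(1) r(1) id by auto
    moreover have "(i, j) \<in> set (list_imap c xs)" "list_covered (list_imap c xs) i j"
      using cov list_imap(1)[OF c xs] list_covered[of i j "list_imap c xs"] acyclic_order_imap[OF xs(1), of J]
      by (auto simp: covered_arrow_def)
    ultimately show ?thesis by (force simp: covered_moves_def Let_def)
  qed
  ultimately show ?thesis using V by blast
qed

context table_model
begin

text \<open>A returned DAG has nothing sparser within reach, so the check at its order can only have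
  succeeded through the list \<open>Gs\<close>.\<close>

lemma triangle_assumption_if_search:
  assumes G: "independence_map V J G" "dag_on p G" and search: "all_equiv_or_sparser c p (covered_moves c) m Gs"
    and Gs: "\<And>H. H \<in> set Gs \<Longrightarrow> set H \<in> markov_equiv_class p G"
  shows "triangle_assumption p (\<lambda>_. borel) P G"
  unfolding triangle_assumption_def
proof (intro conjI allI impI)
  show "markov_wrt p (\<lambda>_. borel) P G" using markov_wrt_iff[OF G(2)] G(1) by blast
  fix \<pi> R assume \<pi>: "\<pi> permutes V" and R: "triangle_sp_returns p C \<pi> R"
  have r: "(triangle_step p C)\<^sup>*\<^sup>* (min_imap p C \<pi>) R" "\<not> (\<exists>E. (triangle_step p C)\<^sup>*\<^sup>* R E \<and> card E < card R)"
    using search_returns_stuck R unfolding triangle_sp_returns_def by blast+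
  obtain \<rho> where \<rho>: "\<rho> permutes V" "R = min_imap p C \<rho>" using triangle_steps_min_imap[OF r(1) \<pi>] by blast
  define xs where "xs = perm_list p \<rho>"
  have xs: "is_order xs" "R = order_imap J xs"
    using perm_list_permutes[OF \<rho>(1)] min_imap_eq_order_imap[OF \<rho>(1) rep] \<rho>(2) by (simp_all add: xs_def)
  have sub: "R \<subseteq> V \<times> V" using order_imap_subset[of J xs] xs by simp
  have "\<not> sparser_within (covered_moves c) (\<lambda>xs. length (list_imap c xs)) 5 xs"
  proof
    assume "sparser_within (covered_moves c) (\<lambda>xs. length (list_imap c xs)) 5 xs"
    then obtain ys where ys: "(covered_step V J)\<^sup>*\<^sup>* (order_imap J xs) (order_imap J ys)" "is_order ys"
      "length (list_imap c ys) < length (list_imap c xs)"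
      using sparser_within_rtranclp[where Q = is_order and R = "covered_step V J" and g = "order_imap J"]
        covered_moves_step[OF list_rep] xs(1) by blast
    then show False
      using r(2) triangle_steps_iff[OF rep sub] card_imap_list xs by auto
  qed
  then obtain H where "H \<in> set Gs" "set (list_imap c xs) = set H"
    using all_equiv_or_sparserD[OF search] xs(1) by blast
  then show "R \<in> markov_equiv_class p G" using Gs imap_list[OF xs(1)] xs(2) by simp
qed

lemma edge_assumption_if_search:
  assumes G: "independence_map V J G" "dag_on p G" and search: "all_equiv_or_sparser c p swaps m Gs"
    and Gs: "\<And>H. H \<in> set Gs \<Longrightarrow> set H \<in> markov_equiv_class p G"
  shows "edge_assumption p (\<lambda>_. borel) P G"
  unfolding edge_assumption_def
proof (intro conjI allI impI)
  show "markov_wrt p (\<lambda>_. borel) P G" using markov_wrt_iff[OF G(2)] G(1) by blast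
  fix \<pi> R assume \<pi>: "\<pi> permutes V" and R: "edge_sp_returns p C \<pi> R"
  have r: "(edge_step p C)\<^sup>*\<^sup>* (min_imap p C \<pi>) R" "\<not> (\<exists>E. (edge_step p C)\<^sup>*\<^sup>* R E \<and> card E < card R)"
    using search_returns_stuck R unfolding edge_sp_returns_def by blast+
  obtain \<rho> where \<rho>: "\<rho> permutes V" "R = min_imap p C \<rho>" using edge_steps_min_imap[OF r(1) \<pi>] by blast
  define xs where "xs = perm_list p \<rho>"
  have xs: "is_order xs" "R = order_imap J xs"
    using perm_list_permutes[OF \<rho>(1)] min_imap_eq_order_imap[OF \<rho>(1) rep] \<rho>(2) by (simp_all add: xs_def)
  have move: "is_order zs \<and> (swap_step V J)\<^sup>*\<^sup>* (order_imap J ys) (order_imap J zs)"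
    if ys: "is_order ys" "zs \<in> set (swaps ys)" "length (list_imap c zs) \<le> length (list_imap c ys)" for ys zs
  proof -
    obtain us a b ws where s: "ys = us @ a # b # ws" "zs = us @ b # a # ws" using in_swapsD[OF ys(2)] by blast
    have "set zs = set ys" unfolding s by auto
    then have zs: "is_order zs" using ys(1) s by auto
    have "card (order_imap J zs) \<le> card (order_imap J ys)"
      using ys(3) card_imap_list[OF ys(1)] card_imap_list[OF zs] by simp
    then have "order_imap J ys = order_imap J zs \<or> swap_step V J (order_imap J ys) (order_imap J zs)"
      unfolding swap_step_def using ys(1) s by blast
    then show ?thesis using zs by auto
  qed
  have "\<not> sparser_within swaps (\<lambda>xs. length (list_imap c xs)) 5 xs"
  proof
    assume "sparser_within swaps (\<lambda>xs. length (list_imap c xs)) 5 xs"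
    then obtain ys where ys: "(swap_step V J)\<^sup>*\<^sup>* (order_imap J xs) (order_imap J ys)" "is_order ys"
      "length (list_imap c ys) < length (list_imap c xs)"
      using sparser_within_rtranclp[where Q = is_order and R = "swap_step V J" and g = "order_imap J"] move xs(1) by blast
    then show False using r(2) edge_step_iff[OF rep] card_imap_list xs by auto
  qed
  then obtain H where "H \<in> set Gs" "set (list_imap c xs) = set H"
    using all_equiv_or_sparserD[OF search] xs(1) by blast
  then show "R \<in> markov_equiv_class p G" using Gs imap_list[OF xs(1)] xs(2) by simp
qed

text \<open>From a DAG in the closed set only DAGs with \<open>n\<close> arrows are reachable, so
  the search returns its start; Markov equivalent DAGs have equally many arrows, and
  \<open>G\<close> does not have \<open>n\<close>.\<close>

lemma not_triangle_assumption_if_closed: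
  assumes g: "graphoid V J" and G: "dag_on p G" "card G \<noteq> n" and K: "closed_under_covered_moves c n Ks"
    "\<And>xs. xs \<in> set Ks \<Longrightarrow> is_order xs" "xs \<in> set Ks"
  shows "\<not> triangle_assumption p (\<lambda>_. borel) P G"
proof
  assume t: "triangle_assumption p (\<lambda>_. borel) P G"
  interpret graphoid V J by (rule g)
  have card: "card (order_imap J zs) = n" if "zs \<in> set Ks" for zs
    using K(1) card_imap_list[OF K(2)[OF that]] that by (auto simp: closed_under_covered_moves_def list_all_iff)
  have closed: "\<exists>zs\<in>set Ks. E = order_imap J zs" if "(covered_step V J)\<^sup>*\<^sup>* (order_imap J xs) E" for E
    using that
  proof (induction rule: rtranclp_induct)
    case (step D E)
    then obtain zs where zs: "zs \<in> set Ks" "D = order_imap J zs" by blast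
    obtain ys where ys: "ys \<in> set (covered_moves c zs)" "is_order ys" "E = order_imap J ys"
      using covered_step_covered_moves[OF list_rep, of zs E] K(2)[OF zs(1)] step.hyps(2) zs(2) by blast
    have "card E \<le> card D" using step.hyps(2) by (simp add: covered_step_def)
    then have "length (list_imap c ys) \<le> n" using card[OF zs(1)] zs(2) ys(3) card_imap_list[OF ys(2)] by simp
    then obtain zs' where "zs' \<in> set Ks" "set (list_imap c ys) = set (list_imap c zs')"
      using K(1) zs(1) ys(1) unfolding closed_under_covered_moves_def list_all_iff list_ex_iff by blast
    then show ?case using imap_list[OF ys(2)] imap_list[OF K(2)] ys(3) by metis
  qed (use K(3) in blast)
  obtain \<pi> where \<pi>: "\<pi> permutes V" "perm_list p \<pi> = xs" using ex_perm_list K(2)[OF K(3)] by blast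
  have R: "min_imap p C \<pi> = order_imap J xs" using min_imap_eq_order_imap[OF \<pi>(1) rep] \<pi>(2) by simp
  have sub: "order_imap J xs \<subseteq> V \<times> V" using order_imap_subset[of J xs] K(2)[OF K(3)] by simp
  have "\<not> (\<exists>E. (triangle_step p C)\<^sup>*\<^sup>* (min_imap p C \<pi>) E \<and> card E < card (min_imap p C \<pi>))"
    unfolding R triangle_steps_iff[OF rep sub] using closed card K(3) by fastforce
  then have "triangle_sp_returns p C \<pi> (min_imap p C \<pi>)"
    unfolding triangle_sp_returns_def by (rule search_returns.stop)
  then have "order_imap J xs \<in> markov_equiv_class p G" using t \<pi>(1) R by (metis triangle_assumption_def)
  then show False using markov_equiv_card[OF G(1)] card[OF K(3)] G(2) by metis
qed

lemma not_edge_assumption_if_closed: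
  assumes G: "dag_on p G" "card G \<noteq> n" and K: "closed_under_swaps c p n Ks"
    "\<And>xs. xs \<in> set Ks \<Longrightarrow> is_order xs" "xs \<in> set Ks"
  shows "\<not> edge_assumption p (\<lambda>_. borel) P G"
proof
  assume t: "edge_assumption p (\<lambda>_. borel) P G"
  have card: "card (order_imap J zs) = n" if "zs \<in> set Ks" for zs
    using K(1) card_imap_list[OF K(2)[OF that]] that by (auto simp: closed_under_swaps_def list_all_iff)
  have closed: "\<exists>zs\<in>set Ks. E = order_imap J zs" if "(swap_step V J)\<^sup>*\<^sup>* (order_imap J xs) E" for E
    using that
  proof (induction rule: rtranclp_induct)
    case (step D E)
    then obtain zs where zs: "zs \<in> set Ks" "D = order_imap J zs" by blast
    obtain us a b ws where s: "is_order (us @ a # b # ws)" "D = order_imap J (us @ a # b # ws)"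
      "E = order_imap J (us @ b # a # ws)" "card E \<le> card D"
      using step.hyps(2) unfolding swap_step_def by blast
    have "set (us @ b # a # ws) = set (us @ a # b # ws)" by auto
    then have ys: "is_order (us @ b # a # ws)" using s(1) by auto
    have "set (list_imap c (us @ a # b # ws)) = set (list_imap c zs)"
      using imap_list[OF s(1)] imap_list[OF K(2)[OF zs(1)]] s(2) zs(2) by simp
    moreover have "length (list_imap c (us @ b # a # ws)) \<le> n"
      using card[OF zs(1)] zs(2) s(3,4) card_imap_list[OF ys] by simp
    moreover have "us @ a # b # ws \<in> set (permutations_of_set_list [1..<Suc p])" using in_permutations s(1) by blast
    ultimately obtain zs' where "zs' \<in> set Ks" "set (list_imap c (us @ b # a # ws)) = set (list_imap c zs')"
      using K(1) zs(1) in_swapsI[of us b a ws] unfolding closed_under_swaps_def list_all_iff list_ex_iff by blast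
    then show ?case using imap_list[OF ys] imap_list[OF K(2)] s(3) by metis
  qed (use K(3) in blast)
  obtain \<pi> where \<pi>: "\<pi> permutes V" "perm_list p \<pi> = xs" using ex_perm_list K(2)[OF K(3)] by blast
  have R: "min_imap p C \<pi> = order_imap J xs" using min_imap_eq_order_imap[OF \<pi>(1) rep] \<pi>(2) by simp
  have "\<not> (\<exists>E. (edge_step p C)\<^sup>*\<^sup>* (min_imap p C \<pi>) E \<and> card E < card (min_imap p C \<pi>))"
    unfolding R edge_step_iff[OF rep] using closed card K(3) by fastforce
  then have "edge_sp_returns p C \<pi> (min_imap p C \<pi>)"
    unfolding edge_sp_returns_def by (rule search_returns.stop)
  then have "order_imap J xs \<in> markov_equiv_class p G" using t \<pi>(1) R by (metis edge_assumption_def)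
  then show False using markov_equiv_card[OF G(1)] card[OF K(3)] G(2) by metis
qed

end

section \<open>Finite checks by evaluation\<close>

lemma check2: "check_ci 4 ci2 tab2"
  by code_simp

lemma check3: "check_ci 4 ci3 tab3"
  by code_simp

lemma int2: "check_intersection 4 ci2"
  by code_simp

lemma int3: "check_intersection 4 ci3"
  by code_simp

lemma search2: "all_equiv_or_sparser (\<lambda>x y S. ci2 x y (set S)) 4 swaps 4 [list_imap (\<lambda>x y S. ci2 x y (set S)) [3,4,1,2]]"
  by code_simp

lemma check1: "check_ci 5 ci1 tab1"
  by code_simp

text \<open>The five listed DAGs are the orientations of the path 1 - 2 - 3 - 4 - 5 without a
  collider, one for each choice of the root.\<close>

lemma search1: "all_equiv_or_sparser (\<lambda>x y S. ci1 x y (set S)) 5 (covered_moves (\<lambda>x y S. ci1 x y (set S))) 4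
  [[(1,2),(2,3),(3,4),(4,5)],[(2,1),(2,3),(3,4),(4,5)],[(2,1),(3,2),(3,4),(4,5)],[(2,1),(3,2),(4,3),(4,5)],[(2,1),(3,2),(4,3),(5,4)]]"
  by code_simp



lemma length2: "length (list_imap (\<lambda>x y S. ci2 x y (set S)) [3,4,1,2]) = 4"
  by code_simp

lemma length3: "length (list_imap (\<lambda>x y S. ci3 x y (set S)) [1,4,2,3]) = 4"
  by code_simp

text \<open>The three orientations of the path 1 - 3 - 2 without a collider, each with 4 as a child
  of all other vertices. No arrow into 4 is covered, so 4 stays last.\<close>

lemma closed2: "closed_under_covered_moves (\<lambda>x y S. ci2 x y (set S)) 5 [[1,3,2,4],[3,1,2,4],[2,3,1,4]]"
  by code_simp

text \<open>With 2 and 3 in front, their marginal independence saves one arrow. An exchange that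
  separates them from the front restores all six arrows, so only 1 and 4 can change places.\<close>

lemma closed3: "closed_under_swaps (\<lambda>x y S. ci3 x y (set S)) 4 5 [[2,3,1,4],[2,3,4,1]]"
  by code_simp

lemma sparsest3: "list_all (\<lambda>xs. 4 < length (list_imap (\<lambda>x y S. ci3 x y (set S)) xs) \<or>
    length (list_imap (\<lambda>x y S. ci3 x y (set S)) xs) = 4 \<and>
    set (list_imap (\<lambda>x y S. ci3 x y (set S)) xs) = set (list_imap (\<lambda>x y S. ci3 x y (set S)) [1,4,2,3]))
  (permutations_of_set_list [1..<Suc 4])"
  by code_simp

lemma list_mem_cases:
  "x \<in> set (y # ys) \<Longrightarrow> (x = y \<Longrightarrow> R) \<Longrightarrow> (x \<in> set ys \<Longrightarrow> R) \<Longrightarrow> R"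
  "x \<in> set [] \<Longrightarrow> R"
  by auto

lemma model1: "table_model 5 tab1 ci1"
proof unfold_locales
  show "tab1 \<noteq> []" by (simp add: tab1_def)
  show "0 < w" if "(r, w) \<in> set tab1" for r w using that by (auto simp: tab1_def)
qed (rule check1)

lemma model2: "table_model 4 tab2 ci2"
proof unfold_locales
  show "tab2 \<noteq> []" by (simp add: tab2_def)
  show "0 < w" if "(r, w) \<in> set tab2" for r w using that by (auto simp: tab2_def)
qed (rule check2)

lemma model3: "table_model 4 tab3 ci3"
proof unfold_locales
  show "tab3 \<noteq> []" by (simp add: tab3_def)
  show "0 < w" if "(r, w) \<in> set tab3" for r w using that by (auto simp: tab3_def)
qed (rule check3)

text \<open>In \<open>tab1\<close> the first coordinate is a function of the second and the fifth
  one of the fourth. Intersection fails: 2 is independent of 4 given \<open>{1, 5}\<close> and of 5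
  given \<open>{1, 4}\<close>, but not of 4 given \<open>{1}\<close>.\<close>

lemma triangle_not_faithful:
  "\<exists>(p::nat) (P :: (nat \<Rightarrow> real) measure) G. joint_distribution p (\<lambda>_. borel) P \<and> dag_on p G \<and>
     triangle_assumption p (\<lambda>_. borel) P G \<and> \<not> faithfulness_assumption p (\<lambda>_. borel) P G"
proof -
  interpret table_model 5 tab1 ci1 by (rule model1)
  define G :: digraph where "G = (\<lambda>x. (x, Suc x)) ` {1..4}"
  have G_eq: "(x, y) \<in> G \<longleftrightarrow> y = Suc x \<and> 1 \<le> x \<and> x \<le> 4" for x y by (auto simp: G_def)
  have "{1..4::nat} = {1,2,3,4}" by auto
  then have G_list: "G = {(1,2),(2,3),(3,4),(4,5)}" by (simp add: G_def numeral_2_eq_2[symmetric])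
  have split: "us = [1..<y] \<and> 1 \<le> y \<and> y \<le> 5" if s: "[1..<6] = us @ y # ws" for us ws y
  proof -
    have len: "length us + Suc (length ws) = 5" using arg_cong[OF s, of length] by (simp del: upt_rec_numeral)
    have "y = [1..<6] ! length us" using s by (metis nth_append_length)
    then have y: "y = 1 + length us" using len by (simp del: upt_rec_numeral)
    have "us = take (length us) [1..<6]" using s by (metis append_eq_conv_conj)
    then have "us = [1..<1 + length us]" using len by (simp only: take_upt)
    then show ?thesis using y len by simp
  qed
  have V: "set [1..<6] = V" by auto
  have t: "topological [1..<6] G"
    unfolding topological_def
  proof (intro conjI allI impI)
    fix us y ws assume "[1..<6] = us @ y # ws"
    from split[OF this] show "parents G y \<subseteq> set us" by (auto simp: parents_def G_eq)
  qed simp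
  have sub: "G \<subseteq> V \<times> V" by (auto simp: G_eq)
  have ac: "acyclic G" by (rule topological_acyclic[OF t, unfolded V, OF sub])
  have G: "dag_on 5 G" using ac sub by (simp add: dag_on_def)
  have im: "independence_map V J G"
  proof (rule S.independence_mapI[OF ac t V sub])
    fix us y ws assume "[1..<6] = us @ y # ws"
    from split[OF this] have us: "set us = {1..<y}" "1 \<le> y" "y \<le> 5" by auto
    show "J {y} (set us - parents G y) (parents G y)"
    proof (rule S.set_of_pairs)
      fix a b A' B' assume *: "a \<in> {y}" "b \<in> set us - parents G y" "A' \<subseteq> {y} - {a}" "B' \<subseteq> set us - parents G y - {b}"
      have b: "1 \<le> b" "b < y - 1" using *(2) us by (auto simp: parents_def G_eq)
      then have y: "y - 1 \<in> parents G y" using us by (auto simp: parents_def G_eq)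
      let ?S = "parents G y \<union> A' \<union> B'"
      have "\<exists>s\<in>?S. min y b < s \<and> s < max y b" using b y by (intro bexI[of _ "y - 1"]) auto
      then have "ci1 y b ?S" unfolding ci1_def by blast
      moreover have "?S \<subseteq> V - {y, b}" "y \<in> V" "b \<in> V" "y \<noteq> b"
        using * b us by (auto simp: parents_def G_eq)
      ultimately show "J {a} {b} ?S" using ci_iff[of y b ?S] *(1) by auto
    qed (use us in \<open>auto simp: parents_def G_eq\<close>)
  qed
  have rev: "set H' \<in> markov_equiv_class 5 G"
    if "set H \<in> markov_equiv_class 5 G" "covered_arrow (set H) i j" "set H' = reverse_arrow i j (set H)" for H H' i j
    using markov_equiv_class_reverse[OF G that(1,2)] that(3) by simp
  have m1: "set [(1,2),(2,3),(3,4),(4,5)] \<in> markov_equiv_class 5 G"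
    using markov_equiv_class_refl[OF G] by (simp add: G_list)
  have m2: "set [(2,1),(2,3),(3,4),(4,5)] \<in> markov_equiv_class 5 G"
    by (rule rev[OF m1, of 1 2]) (auto simp: covered_arrow_def parents_def reverse_arrow_def)
  have m3: "set [(2,1),(3,2),(3,4),(4,5)] \<in> markov_equiv_class 5 G"
    by (rule rev[OF m2, of 2 3]) (auto simp: covered_arrow_def parents_def reverse_arrow_def)
  have m4: "set [(2,1),(3,2),(4,3),(4,5)] \<in> markov_equiv_class 5 G"
    by (rule rev[OF m3, of 3 4]) (auto simp: covered_arrow_def parents_def reverse_arrow_def)
  have m5: "set [(2,1),(3,2),(4,3),(5,4)] \<in> markov_equiv_class 5 G"
    by (rule rev[OF m4, of 4 5]) (auto simp: covered_arrow_def parents_def reverse_arrow_def)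
  have "triangle_assumption 5 (\<lambda>_. borel) P G"
    by (rule triangle_assumption_if_search[OF im G search1]) (use m1 m2 m3 m4 m5 in auto)
  moreover have "\<not> faithfulness_assumption 5 (\<lambda>_. borel) P G"
  proof
    assume f: "faithfulness_assumption 5 (\<lambda>_. borel) P G"
    have "ci1 2 4 {1, 5}" by (simp add: ci1_def)
    then have "J {2} {4} {1, 5}" by (subst (asm) ci_iff) auto
    then have "d_separated G {2} {4} {1, 5}"
      using f[unfolded faithfulness_assumption_def, rule_format, of 2 4 "{1, 5}"] by auto
    \<comment> \<open>The only inner vertex is a non-collider outside the condition.\<close>
    moreover have "d_connecting G {1, 5} [2, 3, 4]"
      by (simp add: d_connecting_iff adjacent_def unblocked_def G_list)
    ultimately show False by (force simp: d_separated_def)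
  qed
  ultimately show ?thesis using joint G by blast
qed

text \<open>From the order 3, 1, 2, 4 the edge search can pass to 3, 1, 4, 2 with five arrows again
  and then to 3, 4, 1, 2 with four. The first exchange reverses the arrow from 2 to 4, which is not
  covered since 1 is a parent of 4 only.\<close>

lemma edge_not_triangle:
  "\<exists>(p::nat) (P :: (nat \<Rightarrow> real) measure) G. joint_distribution p (\<lambda>_. borel) P \<and> dag_on p G \<and>
     vertices_identified_with_dags p (ci_relations p (\<lambda>_. borel) P) \<and>
     edge_assumption p (\<lambda>_. borel) P G \<and> \<not> triangle_assumption p (\<lambda>_. borel) P G"
proof -
  interpret table_model 4 tab2 ci2 by (rule model2)
  have V: "V = {1,2,3,4}" by auto
  have g: "graphoid V J" by (rule graphoid_if_check[OF int2])
  interpret graphoid V J by (rule g)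
  have orders: "is_order xs" if "xs \<in> set [[1,3,2,4],[3,1,2,4],[2,3,1,4]]" for xs
    unfolding V using that by (elim list_mem_cases) (simp_all add: insert_commute)
  let ?xs = "[3,4,1,2]"
  let ?G = "order_imap J ?xs"
  have o: "is_order ?xs" using V by auto
  have G: "dag_on 4 ?G" by (rule dag_order_imap[OF o])
  have im: "independence_map V J ?G" by (rule independence_map_order_imap) (use o in auto)
  have "edge_assumption 4 (\<lambda>_. borel) P ?G"
    by (rule edge_assumption_if_search[OF im G search2])
      (use imap_list[OF o] markov_equiv_class_refl[OF G] in auto)
  moreover have "\<not> triangle_assumption 4 (\<lambda>_. borel) P ?G"
  proof (rule not_triangle_assumption_if_closed[OF g G _ closed2])
    show "card ?G \<noteq> 5" using card_imap_list[OF o] length2 by simp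
    show "[1,3,2,4::nat] \<in> set [[1,3,2,4],[3,1,2,4],[2,3,1,4]]" by simp
  qed (rule orders)
  ultimately show ?thesis using joint G vertices_identified_if_graphoid[OF g rep] by blast
qed

text \<open>The map of 1, 4, 2, 3 is the only one with at most four arrows, but from 2, 3, 1, 4 it
  can be reached only through DAGs with six.\<close>

lemma sparsest_not_edge:
  "\<exists>(p::nat) (P :: (nat \<Rightarrow> real) measure) G. joint_distribution p (\<lambda>_. borel) P \<and> dag_on p G \<and>
     vertices_identified_with_dags p (ci_relations p (\<lambda>_. borel) P) \<and>
     sparsest_markov_assumption p (\<lambda>_. borel) P G \<and> \<not> edge_assumption p (\<lambda>_. borel) P G"
proof -
  interpret table_model 4 tab3 ci3 by (rule model3)
  have V: "V = {1,2,3,4}" by auto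
  have g: "graphoid V J" by (rule graphoid_if_check[OF int3])
  interpret graphoid V J by (rule g)
  have orders: "is_order xs" if "xs \<in> set [[2,3,1,4],[2,3,4,1]]" for xs
    unfolding V using that by (elim list_mem_cases) (simp_all add: insert_commute)
  let ?xs = "[1,4,2,3]"
  let ?G = "order_imap J ?xs"
  have o: "is_order ?xs" using V by auto
  have G: "dag_on 4 ?G" by (rule dag_order_imap[OF o])
  have im: "independence_map V J ?G" by (rule independence_map_order_imap) (use o in auto)
  have cG: "card ?G = 4" using card_imap_list[OF o] length3 by simp
  have sp: "4 < card (order_imap J ys) \<or> (card (order_imap J ys) = 4 \<and> order_imap J ys = ?G)" if "is_order ys" for ys
    using sparsest3 in_permutations[of ys 4] that card_imap_list[OF that] imap_list[OF that] imap_list[OF o]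
    unfolding list_all_iff by auto
  have "sparsest_markov_assumption 4 (\<lambda>_. borel) P ?G"
  proof (rule sparsest_markov_if_order_imaps[OF joint])
    show "markov_wrt 4 (\<lambda>_. borel) P ?G" using markov_wrt_iff[OF G] im by blast
    fix ys assume ys: "distinct ys" "set ys = V"
    show "card ?G \<le> card (order_imap J ys)" using sp[of ys] ys cG by auto
    assume "card (order_imap J ys) = card ?G"
    then show "order_imap J ys \<in> markov_equiv_class 4 ?G"
      using sp[of ys] ys cG markov_equiv_class_refl[OF G] by auto
  qed
  moreover have "\<not> edge_assumption 4 (\<lambda>_. borel) P ?G"
  proof (rule not_edge_assumption_if_closed[OF G _ closed3])
    show "card ?G \<noteq> 5" using cG by simp
    show "[2,3,1,4::nat] \<in> set [[2,3,1,4],[2,3,4,1]]" by simp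
  qed (rule orders)
  ultimately show ?thesis using joint G vertices_identified_if_graphoid[OF g rep] by blast
qed

theorem theorem11:
  shows
    "(\<forall>(p::nat) (M :: nat \<Rightarrow> 'a measure) P G.
        joint_distribution p M P \<longrightarrow> dag_on p G \<longrightarrow>
          (faithfulness_assumption p M P G \<longrightarrow> triangle_assumption p M P G) \<and>
          (vertices_identified_with_dags p (ci_relations p M P) \<longrightarrow>
             triangle_assumption p M P G \<longrightarrow> edge_assumption p M P G) \<and>
          (edge_assumption p M P G \<longrightarrow> sparsest_markov_assumption p M P G)) \<and>
     (\<exists>(p::nat) (P :: (nat \<Rightarrow> real) measure) G.
        joint_distribution p (\<lambda>_. borel) P \<and> dag_on p G \<and>
        triangle_assumption p (\<lambda>_. borel) P G \<and> \<not> faithfulness_assumption p (\<lambda>_. borel) P G) \<and>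
     (\<exists>(p::nat) (P :: (nat \<Rightarrow> real) measure) G.
        joint_distribution p (\<lambda>_. borel) P \<and> dag_on p G \<and>
        vertices_identified_with_dags p (ci_relations p (\<lambda>_. borel) P) \<and>
        edge_assumption p (\<lambda>_. borel) P G \<and> \<not> triangle_assumption p (\<lambda>_. borel) P G) \<and>
     (\<exists>(p::nat) (P :: (nat \<Rightarrow> real) measure) G.
        joint_distribution p (\<lambda>_. borel) P \<and> dag_on p G \<and>
        vertices_identified_with_dags p (ci_relations p (\<lambda>_. borel) P) \<and>
        sparsest_markov_assumption p (\<lambda>_. borel) P G \<and> \<not> edge_assumption p (\<lambda>_. borel) P G)"
proof (intro conjI allI impI)
  fix p :: nat and M :: "nat \<Rightarrow> 'a measure" and P G
  assume "joint_distribution p M P" "dag_on p G"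
  then show "faithfulness_assumption p M P G \<Longrightarrow> triangle_assumption p M P G"
    and "vertices_identified_with_dags p (ci_relations p M P) \<Longrightarrow> triangle_assumption p M P G \<Longrightarrow>
      edge_assumption p M P G"
    and "edge_assumption p M P G \<Longrightarrow> sparsest_markov_assumption p M P G"
    using faithfulness_imp_triangle triangle_imp_edge edge_imp_sparsest by blast+
qed (rule triangle_not_faithful edge_not_triangle sparsest_not_edge)+

end
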